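(* Let $V$ be a finite dimensional vector space over an arbitrary field $k$ and let $B=\{v_1,\ldots,v_n\}$ be a basis of $V$. Then, as an automorphism on $\mathrm{HH}_{\bullet}(S(V))$ (i.e. as an isomorphism from its description by the bar resolution to its description by the Koszul resolution), $(\Psi_B)_*$ is given at the chain level by $$(\Psi_B)_*(f_0\otimes f_1\otimes\cdots\otimes f_p)=\sum_{1\le i_1<\cdots<i_p\le n}f_0\,\frac{\partial f_1}{\partial v_{i_1}}\cdots\frac{\partial f_p}{\partial v_{i_p}}\otimes v_{i_1}\wedge\cdots\wedge v_{i_p}$$ for all $f_0,f_1,\ldots,f_p\in S(V)$.
   Context: Tensor and exterior products without subscript are over $k$. $S(V)^e=S(V)\otimes S(V)^{op}$; $\mathrm{HH}_{\bullet}(S(V)):=\operatorname{Tor}_{\bullet}^{S(V)^e}(S(V),S(V))$. Bar resolution of $S(V)$: $S(V)^{\otimes(p+2)}$ in degree $p\ge0$, $\delta_p(a_0\otimes\cdots\otimes a_{p+1})=\sum_{j=0}^p(-1)^ja_0\otimes\cdots\otimes a_ja_{j+1}\otimes\cdots\otimes a_{p+1}$. Koszul resolution of $S(V)$: $S(V)^e\otimes\bigwedge^p(V)$ in degree $p\ge0$, with $S(V)^e$-linear $d_p(1\otimes1\otimes v_{j_1}\wedge\cdots\wedge v_{j_p})=\sum_{i=1}^p(-1)^{i+1}(v_{j_i}\otimes1-1\otimes v_{j_i})\otimes(v_{j_1}\wedge\cdots\wedge\hat v_{j_i}\wedge\cdots\wedge v_{j_p})$. Applying $S(V)\otimes_{S(V)^e}-$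 yields complexes with terms $S(V)\otimes S(V)^{\otimes p}$ and $S(V)\otimes\bigwedge^p(V)$, respectively, each computing $\mathrm{HH}_{\bullet}(S(V))$. The chain map $\Psi_B$ from the bar to the Koszul resolution: write $\underline v^{\underline\ell}=v_1^{\ell_1}\cdots v_n^{\ell_n}$. $(\Psi_B)_0$ is the identity, and for $p\ge1$, $(\Psi_B)_p$ is $S(V)^e$-linear with $$(\Psi_B)_p(1\otimes\underline v^{\underline\ell^1}\otimes\cdots\otimes\underline v^{\underline\ell^p}\otimes1)=\sum_{1\le i_1<\cdots<i_p\le n}\ \sum_{0\le a_{i_j}<\ell^j_{i_j}}\underline v^{\underline Q}\otimes\underline v^{\underline{\hat Q}}\otimes v_{i_1}\wedge\cdots\wedge v_{i_p},$$ the second sum being over all integers $a_{i_1},\ldots,a_{i_p}$ with $0\le a_{i_j}<\ell^j_{i_j}$ for all $j$; here $\underline Q_i=a_i+\ell_i^1+\cdots+\ell_i^{j-1}$ if $i=i_j$ and $\underline Q_i=\ell_i^1+\cdots+\ell_i^j$ if $i_j<i<i_{j+1}$ (with $i_0=0$, $i_{p+1}=n+1$), and $\underline{\hat Q}$ is determined by $\underline v^{\underline Q}\,\underline v^{\underline{\hat Q}}\,v_{i_1}\cdots v_{i_p}=\underline v^{\underline\ell^1}\cdots\underline v^{\underline\ell^p}$. $(\Psi_B)_*:S(V)\otimes S(V)^{\otimes\bullet}\to S(V)\otimes\bigwedge^{\bullet}(V)$ denotes the map obtained from $\Psi_B$ by applying $S(V)\otimes_{S(V)^e}-$. *)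

theory Defs
  imports Complex_Main "HOL-Algebra.Free_Abelian_Groups" "HOL-Library.Multiset"
begin

section \<open>The symmetric algebra\<close>

(* 'v multiset \<Rightarrow>\<^sub>0 'k is the free commutative k-algebra on the underlying set of V, i.e. the
   polynomial ring with one variable x_w for every vector w of V. *)

definition free_eval ::
    "('k::field \<Rightarrow> 's::comm_ring_1 \<Rightarrow> 's) \<Rightarrow> ('v \<Rightarrow> 's) \<Rightarrow> ('v multiset \<Rightarrow>\<^sub>0 'k) \<Rightarrow> 's" where
  "free_eval sS \<iota> f =
     (\<Sum>m\<in>Poly_Mapping.keys f. sS (Poly_Mapping.lookup f m) (\<Prod>w\<in>#m. \<iota> w))"

definition linearity_relations ::
    "('k::field \<Rightarrow> 'v::ab_group_add \<Rightarrow> 'v) \<Rightarrow> ('v multiset \<Rightarrow>\<^sub>0 'k) set" where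
  "linearity_relations sV =
     {Poly_Mapping.single {#x + y#} 1 - Poly_Mapping.single {#x#} 1 - Poly_Mapping.single {#y#} 1
        | x y. True} \<union>
     {Poly_Mapping.single {#sV c x#} 1 - Poly_Mapping.single {#x#} c | c x. True}"

(* S(V) is given up to isomorphism: any commutative k-algebra S with a linear map \<iota> : V \<rightarrow> S that
   presents S as the free commutative algebra on V modulo the ideal expressing linearity of the
   generators (equivalently, as the tensor algebra modulo the commutators).
   The span of a subset of a commutative ring, with multiplication as scaling, is the ideal it
   generates. *)

locale symmetric_algebra =
  Vector_Spaces.linear sV sS \<iota>
  for sV :: "'k::field \<Rightarrow> 'v::ab_group_add \<Rightarrow> 'v"
    and sS :: "'k \<Rightarrow> 's::comm_ring_1 \<Rightarrow> 's"
    and \<iota> :: "'v \<Rightarrow> 's" +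
  assumes scale_mult: "sS c (x * y) = sS c x * y"
    and generated: "range (free_eval sS \<iota>) = UNIV"
    and relations: "{f. free_eval sS \<iota> f = 0} = module.span (*) (linearity_relations sV)"

(* B = {v_1, ..., v_n} *)
definition indexed_basis ::
    "('k::field \<Rightarrow> 'v::ab_group_add \<Rightarrow> 'v) \<Rightarrow> (nat \<Rightarrow> 'v) \<Rightarrow> nat \<Rightarrow> bool" where
  "indexed_basis sV v n \<longleftrightarrow>
     inj_on v {1..n} \<and> \<not> module.dependent sV (v ` {1..n}) \<and> module.span sV (v ` {1..n}) = UNIV"

definition vmonom :: "('v \<Rightarrow> 's::comm_ring_1) \<Rightarrow> (nat \<Rightarrow> 'v) \<Rightarrow> nat \<Rightarrow> (nat \<Rightarrow> nat) \<Rightarrow> 's" where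
  "vmonom \<iota> v n l = (\<Prod>i=1..n. \<iota> (v i) ^ l i)"

(* The formal partial derivative with respect to v_i: the k-linear map with
   v^l \<mapsto> l_i v^(l - e_i). For l_i = 0 the coefficient vanishes, so the truncated subtraction
   is harmless. *)
definition pdiff ::
    "('k::field \<Rightarrow> 's::comm_ring_1 \<Rightarrow> 's) \<Rightarrow> ('v \<Rightarrow> 's) \<Rightarrow> (nat \<Rightarrow> 'v) \<Rightarrow> nat \<Rightarrow> nat \<Rightarrow> 's \<Rightarrow> 's" where
  "pdiff sS \<iota> v n i =
     (THE D. Vector_Spaces.linear sS sS D \<and>
             (\<forall>l. D (vmonom \<iota> v n l) = of_nat (l i) * vmonom \<iota> v n (l(i := l i - 1))))"

section \<open>Abelian groups by generators and relations\<close>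

(* HOL-Algebra writes the abelian groups below multiplicatively: \<one> is the zero element, and
   mult is addition. *)

definition relation_subgroup :: "'x set \<Rightarrow> ('x \<Rightarrow>\<^sub>0 int) set \<Rightarrow> ('x \<Rightarrow>\<^sub>0 int) set" where
  "relation_subgroup X R = generate (free_Abelian_group X) R"

definition presented :: "'x set \<Rightarrow> ('x \<Rightarrow>\<^sub>0 int) set \<Rightarrow> ('x \<Rightarrow>\<^sub>0 int) set monoid" where
  "presented X R = free_Abelian_group X Mod relation_subgroup X R"

definition cls :: "'x set \<Rightarrow> ('x \<Rightarrow>\<^sub>0 int) set \<Rightarrow> ('x \<Rightarrow>\<^sub>0 int) \<Rightarrow> ('x \<Rightarrow>\<^sub>0 int) set" where
  "cls X R f = relation_subgroup X R #>\<^bsub>free_Abelian_group X\<^esub> f"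

(* The map into G Mod H induced on cosets by f: the union below is the single coset of H that
   contains f ` C whenever f respects the two subgroups. *)
definition induced :: "('b, 'r) monoid_scheme \<Rightarrow> 'b set \<Rightarrow> ('a \<Rightarrow> 'b) \<Rightarrow> 'a set \<Rightarrow> 'b set" where
  "induced G H f C = (\<Union>x\<in>C. H #>\<^bsub>G\<^esub> f x)"

(* The map out of a presented group that sends the class of each generator x to the class of g x
   in presented Y R. *)
definition lift ::
    "'y set \<Rightarrow> ('y \<Rightarrow>\<^sub>0 int) set \<Rightarrow> ('x \<Rightarrow> 'y \<Rightarrow>\<^sub>0 int) \<Rightarrow> ('x \<Rightarrow>\<^sub>0 int) set \<Rightarrow> ('y \<Rightarrow>\<^sub>0 int) set" where
  "lift Y R g = induced (free_Abelian_group Y) (relation_subgroup Y R) (frag_extend g)"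

section \<open>Tensor and exterior products over k\<close>

(* S^{\<otimes>q} for q \<ge> 1: multilinearity is additivity in every slot together with the freedom
   to move scalars between slots. *)

definition tpow_gens :: "nat \<Rightarrow> 's list set" where
  "tpow_gens q = {xs. length xs = q}"

definition tpow_rels ::
    "('k::field \<Rightarrow> 's::comm_ring_1 \<Rightarrow> 's) \<Rightarrow> nat \<Rightarrow> ('s list \<Rightarrow>\<^sub>0 int) set" where
  "tpow_rels sS q =
     {frag_of (xs[i := x + y]) - frag_of (xs[i := x]) - frag_of (xs[i := y])
        | xs i x y. length xs = q \<and> i < q} \<union>
     {frag_of (xs[i := sS c (xs ! i)]) - frag_of (xs[j := sS c (xs ! j)])
        | xs i j c. length xs = q \<and> i < q \<and> j < q}"

definition tpow ::
    "('k::field \<Rightarrow> 's::comm_ring_1 \<Rightarrow> 's) \<Rightarrow> nat \<Rightarrow> ('s list \<Rightarrow>\<^sub>0 int) set monoid" where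
  "tpow sS q = presented (tpow_gens q) (tpow_rels sS q)"

(* x_1 \<otimes> ... \<otimes> x_q *)
definition pure ::
    "('k::field \<Rightarrow> 's::comm_ring_1 \<Rightarrow> 's) \<Rightarrow> 's list \<Rightarrow> ('s list \<Rightarrow>\<^sub>0 int) set" where
  "pure sS xs = cls (tpow_gens (length xs)) (tpow_rels sS (length xs)) (frag_of xs)"

(* S^{\<otimes>q} \<otimes> \<And>^p(V) for q \<ge> 1: the generator (xs, ws) stands for
   x_1 \<otimes> ... \<otimes> x_q \<otimes> w_1 \<and> ... \<and> w_p. *)

definition tens_ext_gens :: "nat \<Rightarrow> nat \<Rightarrow> ('s list \<times> 'v list) set" where
  "tens_ext_gens q p = {(xs, ws). length xs = q \<and> length ws = p}"

definition tens_ext_rels ::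
    "('k::field \<Rightarrow> 'v::ab_group_add \<Rightarrow> 'v) \<Rightarrow> ('k \<Rightarrow> 's::comm_ring_1 \<Rightarrow> 's) \<Rightarrow> nat \<Rightarrow> nat
       \<Rightarrow> ('s list \<times> 'v list \<Rightarrow>\<^sub>0 int) set" where
  "tens_ext_rels sV sS q p =
     {frag_of (xs[i := x + y], ws) - frag_of (xs[i := x], ws) - frag_of (xs[i := y], ws)
        | xs ws i x y. length xs = q \<and> length ws = p \<and> i < q} \<union>
     {frag_of (xs, ws[i := x + y]) - frag_of (xs, ws[i := x]) - frag_of (xs, ws[i := y])
        | xs ws i x y. length xs = q \<and> length ws = p \<and> i < p} \<union>
     {frag_of (xs[i := sS c (xs ! i)], ws) - frag_of (xs[j := sS c (xs ! j)], ws)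
        | xs ws i j c. length xs = q \<and> length ws = p \<and> i < q \<and> j < q} \<union>
     {frag_of (xs[i := sS c (xs ! i)], ws) - frag_of (xs, ws[j := sV c (ws ! j)])
        | xs ws i j c. length xs = q \<and> length ws = p \<and> i < q \<and> j < p} \<union>
     {frag_of (xs, ws)
        | xs ws. length xs = q \<and> length ws = p \<and> (\<exists>i j. i < j \<and> j < p \<and> ws ! i = ws ! j)}"

definition tens_ext ::
    "('k::field \<Rightarrow> 'v::ab_group_add \<Rightarrow> 'v) \<Rightarrow> ('k \<Rightarrow> 's::comm_ring_1 \<Rightarrow> 's) \<Rightarrow> nat \<Rightarrow> nat
       \<Rightarrow> ('s list \<times> 'v list \<Rightarrow>\<^sub>0 int) set monoid" where
  "tens_ext sV sS q p = presented (tens_ext_gens q p) (tens_ext_rels sV sS q p)"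

section \<open>Modules over the enveloping algebra\<close>

(* S is commutative, and a module over S^e = S \<otimes> S^{op} is an abelian group M on which the
   elements a \<otimes> b, which generate S^e additively, act by m \<mapsto> a m b. The action of k is
   that of (c 1) \<otimes> 1. *)

record ('s, 'm) env_module = "'m monoid" +
  act :: "'s \<Rightarrow> 's \<Rightarrow> 'm \<Rightarrow> 'm"

definition env_linear ::
    "('s, 'm) env_module \<Rightarrow> ('s, 'l) env_module \<Rightarrow> ('m \<Rightarrow> 'l) \<Rightarrow> bool" where
  "env_linear M N f \<longleftrightarrow>
     f \<in> hom M N \<and> (\<forall>a b. \<forall>x\<in>carrier M. f (act M a b x) = act N a b (f x))"

(* S \<otimes>_{S^e} M, where S^e acts on S from the right by s (a \<otimes> b) = b s a. *)

definition stensor_gens :: "('s, 'm) env_module \<Rightarrow> ('s \<times> 'm) set" where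
  "stensor_gens M = UNIV \<times> carrier M"

definition stensor_rels ::
    "('s::comm_ring_1, 'm) env_module \<Rightarrow> ('s \<times> 'm \<Rightarrow>\<^sub>0 int) set" where
  "stensor_rels M =
     {frag_of (s + t, x) - frag_of (s, x) - frag_of (t, x) | s t x. x \<in> carrier M} \<union>
     {frag_of (s, x \<otimes>\<^bsub>M\<^esub> y) - frag_of (s, x) - frag_of (s, y)
        | s x y. x \<in> carrier M \<and> y \<in> carrier M} \<union>
     {frag_of (b * s * a, x) - frag_of (s, act M a b x) | s a b x. x \<in> carrier M}"

definition stensor ::
    "('s::comm_ring_1, 'm) env_module \<Rightarrow> ('s \<times> 'm \<Rightarrow>\<^sub>0 int) set monoid" where
  "stensor M = presented (stensor_gens M) (stensor_rels M)"

definition stensor_map ::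
    "('s::comm_ring_1, 'l) env_module \<Rightarrow> ('m \<Rightarrow> 'l)
       \<Rightarrow> ('s \<times> 'm \<Rightarrow>\<^sub>0 int) set \<Rightarrow> ('s \<times> 'l \<Rightarrow>\<^sub>0 int) set" where
  "stensor_map N f = lift (stensor_gens N) (stensor_rels N) (\<lambda>(s, x). frag_of (s, f x))"

definition stensor_scale ::
    "('k \<Rightarrow> 's \<Rightarrow> 's) \<Rightarrow> ('s::comm_ring_1, 'm) env_module \<Rightarrow> 'k
       \<Rightarrow> ('s \<times> 'm \<Rightarrow>\<^sub>0 int) set \<Rightarrow> ('s \<times> 'm \<Rightarrow>\<^sub>0 int) set" where
  "stensor_scale sS M c = lift (stensor_gens M) (stensor_rels M) (\<lambda>(s, x). frag_of (sS c s, x))"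

section \<open>The bar and Koszul resolutions\<close>

(* In both resolutions the differential of index p maps degree p to degree p - 1. Only p \<ge> 1 is
   meant; the augmentation onto S is not part of the complex. *)

definition bar ::
    "('k::field \<Rightarrow> 's::comm_ring_1 \<Rightarrow> 's) \<Rightarrow> nat \<Rightarrow> ('s, ('s list \<Rightarrow>\<^sub>0 int) set) env_module" where
  "bar sS p = monoid.extend (tpow sS (p + 2))
     (env_module.fields (\<lambda>a b. lift (tpow_gens (p + 2)) (tpow_rels sS (p + 2))
        (\<lambda>xs. frag_of (xs[0 := a * xs ! 0, p + 1 := xs ! (p + 1) * b]))))"

definition bar_diff ::
    "('k::field \<Rightarrow> 's::comm_ring_1 \<Rightarrow> 's) \<Rightarrow> nat
       \<Rightarrow> ('s list \<Rightarrow>\<^sub>0 int) set \<Rightarrow> ('s list \<Rightarrow>\<^sub>0 int) set" where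
  "bar_diff sS p = lift (tpow_gens (p + 1)) (tpow_rels sS (p + 1))
     (\<lambda>xs. \<Sum>j=0..p. frag_cmul ((-1) ^ j)
        (frag_of (take j xs @ [xs ! j * xs ! (j + 1)] @ drop (j + 2) xs)))"

definition kos ::
    "('k::field \<Rightarrow> 'v::ab_group_add \<Rightarrow> 'v) \<Rightarrow> ('k \<Rightarrow> 's::comm_ring_1 \<Rightarrow> 's) \<Rightarrow> nat
       \<Rightarrow> ('s, ('s list \<times> 'v list \<Rightarrow>\<^sub>0 int) set) env_module" where
  "kos sV sS p = monoid.extend (tens_ext sV sS 2 p)
     (env_module.fields (\<lambda>a b. lift (tens_ext_gens 2 p) (tens_ext_rels sV sS 2 p)
        (\<lambda>(xs, ws). frag_of ([a * xs ! 0, xs ! 1 * b], ws))))"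

(* Stated for wedges of arbitrary vectors, not only of basis vectors; the list positions are
   counted from 0, hence the sign (-1)^i. *)
definition kos_diff ::
    "('k::field \<Rightarrow> 'v::ab_group_add \<Rightarrow> 'v) \<Rightarrow> ('k \<Rightarrow> 's::comm_ring_1 \<Rightarrow> 's) \<Rightarrow> ('v \<Rightarrow> 's) \<Rightarrow> nat
       \<Rightarrow> ('s list \<times> 'v list \<Rightarrow>\<^sub>0 int) set \<Rightarrow> ('s list \<times> 'v list \<Rightarrow>\<^sub>0 int) set" where
  "kos_diff sV sS \<iota> p = lift (tens_ext_gens 2 (p - 1)) (tens_ext_rels sV sS 2 (p - 1))
     (\<lambda>(xs, ws). \<Sum>i<p. frag_cmul ((-1) ^ i)
        (frag_of ([xs ! 0 * \<iota> (ws ! i), xs ! 1], take i ws @ drop (i + 1) ws)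
         - frag_of ([xs ! 0, \<iota> (ws ! i) * xs ! 1], take i ws @ drop (i + 1) ws)))"

section \<open>The chain map from the bar to the Koszul resolution\<close>

(* i_1 < ... < i_p in {1, ..., n}; i_j is entry j - 1 of the list. *)
definition incr_seqs :: "nat \<Rightarrow> nat \<Rightarrow> nat list set" where
  "incr_seqs n p = {is. length is = p \<and> set is \<subseteq> {1..n} \<and> sorted_wrt (<) is}"

definition a_choices :: "(nat \<Rightarrow> nat) list \<Rightarrow> nat list \<Rightarrow> nat list set" where
  "a_choices ls is = {as. length as = length is \<and> (\<forall>j<length is. as ! j < (ls ! j) (is ! j))}"

(* With r the number of entries of is below i: if i = i_j then r = j - 1, and if
   i_j < i < i_{j+1} then r = j. *)
definition Q_exp :: "(nat \<Rightarrow> nat) list \<Rightarrow> nat list \<Rightarrow> nat list \<Rightarrow> nat \<Rightarrow> nat" where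
  "Q_exp ls is as i =
     (let r = card {j. j < length is \<and> is ! j < i}
      in (if i \<in> set is then as ! r else 0) + (\<Sum>m<r. (ls ! m) i))"

(* Determined by Q + Qhat + (e_{i_1} + ... + e_{i_p}) = l^1 + ... + l^p; the subtraction does not
   truncate when as is in a_choices ls is. *)
definition Qhat_exp :: "(nat \<Rightarrow> nat) list \<Rightarrow> nat list \<Rightarrow> nat list \<Rightarrow> nat \<Rightarrow> nat" where
  "Qhat_exp ls is as i =
     (\<Sum>m<length ls. (ls ! m) i) - (Q_exp ls is as i + (if i \<in> set is then 1 else 0))"

(* For p = 0 the defining formula reads 1 \<otimes> 1 \<mapsto> 1 \<otimes> 1, so that (Psi_B)_0 is the
   identity of S \<otimes> S = S \<otimes> S \<otimes> \<And>^0(V). *)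
definition Psi ::
    "('k::field \<Rightarrow> 'v::ab_group_add \<Rightarrow> 'v) \<Rightarrow> ('k \<Rightarrow> 's::comm_ring_1 \<Rightarrow> 's) \<Rightarrow> ('v \<Rightarrow> 's)
       \<Rightarrow> (nat \<Rightarrow> 'v) \<Rightarrow> nat \<Rightarrow> nat
       \<Rightarrow> ('s list \<Rightarrow>\<^sub>0 int) set \<Rightarrow> ('s list \<times> 'v list \<Rightarrow>\<^sub>0 int) set" where
  "Psi sV sS \<iota> v n p = (THE \<psi>.
     \<psi> \<in> extensional (carrier (bar sS p)) \<and>
     env_linear (bar sS p) (kos sV sS p) \<psi> \<and>
     (\<forall>ls. length ls = p \<longrightarrow>
        \<psi> (pure sS ([1] @ map (vmonom \<iota> v n) ls @ [1])) =
        cls (tens_ext_gens 2 p) (tens_ext_rels sV sS 2 p)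
          (\<Sum>is\<in>incr_seqs n p. \<Sum>as\<in>a_choices ls is.
             frag_of ([vmonom \<iota> v n (Q_exp ls is as), vmonom \<iota> v n (Qhat_exp ls is as)],
                      map v is))))"

section \<open>Hochschild chains\<close>

(* The canonical isomorphism S \<otimes> S^{\<otimes>p} \<rightarrow> S \<otimes>_{S^e} S^{\<otimes>(p+2)},
   f_0 \<otimes> f_1 \<otimes> ... \<otimes> f_p \<mapsto> f_0 \<otimes> (1 \<otimes> f_1 \<otimes> ... \<otimes> f_p \<otimes> 1). *)
definition bar_canon ::
    "('k::field \<Rightarrow> 's::comm_ring_1 \<Rightarrow> 's) \<Rightarrow> nat
       \<Rightarrow> ('s list \<Rightarrow>\<^sub>0 int) set \<Rightarrow> ('s \<times> ('s list \<Rightarrow>\<^sub>0 int) set \<Rightarrow>\<^sub>0 int) set" where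
  "bar_canon sS p = lift (stensor_gens (bar sS p)) (stensor_rels (bar sS p))
     (\<lambda>fs. frag_of (hd fs, pure sS ([1] @ tl fs @ [1])))"

(* The canonical isomorphism S \<otimes> \<And>^p(V) \<rightarrow> S \<otimes>_{S^e} (S^e \<otimes> \<And>^p(V)),
   f \<otimes> w \<mapsto> f \<otimes> (1 \<otimes> 1 \<otimes> w). *)
definition kos_canon ::
    "('k::field \<Rightarrow> 'v::ab_group_add \<Rightarrow> 'v) \<Rightarrow> ('k \<Rightarrow> 's::comm_ring_1 \<Rightarrow> 's) \<Rightarrow> nat
       \<Rightarrow> ('s list \<times> 'v list \<Rightarrow>\<^sub>0 int) set
       \<Rightarrow> ('s \<times> ('s list \<times> 'v list \<Rightarrow>\<^sub>0 int) set \<Rightarrow>\<^sub>0 int) set" where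
  "kos_canon sV sS p = lift (stensor_gens (kos sV sS p)) (stensor_rels (kos sV sS p))
     (\<lambda>(fs, ws). frag_of (hd fs,
        cls (tens_ext_gens 2 p) (tens_ext_rels sV sS 2 p) (frag_of ([1, 1], ws))))"

definition id_tensor_Psi ::
    "('k::field \<Rightarrow> 'v::ab_group_add \<Rightarrow> 'v) \<Rightarrow> ('k \<Rightarrow> 's::comm_ring_1 \<Rightarrow> 's) \<Rightarrow> ('v \<Rightarrow> 's)
       \<Rightarrow> (nat \<Rightarrow> 'v) \<Rightarrow> nat \<Rightarrow> nat
       \<Rightarrow> ('s \<times> ('s list \<Rightarrow>\<^sub>0 int) set \<Rightarrow>\<^sub>0 int) set
       \<Rightarrow> ('s \<times> ('s list \<times> 'v list \<Rightarrow>\<^sub>0 int) set \<Rightarrow>\<^sub>0 int) set" where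
  "id_tensor_Psi sV sS \<iota> v n p = stensor_map (kos sV sS p) (Psi sV sS \<iota> v n p)"

(* (Psi_B)_* : S \<otimes> S^{\<otimes>p} \<rightarrow> S \<otimes> \<And>^p(V) *)
definition Psi_star ::
    "('k::field \<Rightarrow> 'v::ab_group_add \<Rightarrow> 'v) \<Rightarrow> ('k \<Rightarrow> 's::comm_ring_1 \<Rightarrow> 's) \<Rightarrow> ('v \<Rightarrow> 's)
       \<Rightarrow> (nat \<Rightarrow> 'v) \<Rightarrow> nat \<Rightarrow> nat
       \<Rightarrow> ('s list \<Rightarrow>\<^sub>0 int) set \<Rightarrow> ('s list \<times> 'v list \<Rightarrow>\<^sub>0 int) set" where
  "Psi_star sV sS \<iota> v n p x =
     inv_into (carrier (tens_ext sV sS 1 p)) (kos_canon sV sS p)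
       (id_tensor_Psi sV sS \<iota> v n p (bar_canon sS p x))"

section \<open>Hochschild homology\<close>

definition cycles :: "(nat \<Rightarrow> 'c monoid) \<Rightarrow> (nat \<Rightarrow> 'c \<Rightarrow> 'c) \<Rightarrow> nat \<Rightarrow> 'c set" where
  "cycles C d p = (if p = 0 then carrier (C 0) else kernel (C p) (C (p - 1)) (d p))"

definition boundaries :: "(nat \<Rightarrow> 'c monoid) \<Rightarrow> (nat \<Rightarrow> 'c \<Rightarrow> 'c) \<Rightarrow> nat \<Rightarrow> 'c set" where
  "boundaries C d p = d (p + 1) ` carrier (C (p + 1))"

definition homology :: "(nat \<Rightarrow> 'c monoid) \<Rightarrow> (nat \<Rightarrow> 'c \<Rightarrow> 'c) \<Rightarrow> nat \<Rightarrow> 'c set monoid" where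
  "homology C d p = (C p)\<lparr>carrier := cycles C d p\<rparr> Mod boundaries C d p"

definition homology_map ::
    "(nat \<Rightarrow> 'c monoid) \<Rightarrow> (nat \<Rightarrow> 'c \<Rightarrow> 'c) \<Rightarrow> nat \<Rightarrow> ('b \<Rightarrow> 'c) \<Rightarrow> 'b set \<Rightarrow> 'c set" where
  "homology_map C d p f = induced (C p) (boundaries C d p) f"

definition bar_chains ::
    "('k::field \<Rightarrow> 's::comm_ring_1 \<Rightarrow> 's) \<Rightarrow> nat
       \<Rightarrow> ('s \<times> ('s list \<Rightarrow>\<^sub>0 int) set \<Rightarrow>\<^sub>0 int) set monoid" where
  "bar_chains sS p = stensor (bar sS p)"

definition bar_chain_diff ::
    "('k::field \<Rightarrow> 's::comm_ring_1 \<Rightarrow> 's) \<Rightarrow> nat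
       \<Rightarrow> ('s \<times> ('s list \<Rightarrow>\<^sub>0 int) set \<Rightarrow>\<^sub>0 int) set
       \<Rightarrow> ('s \<times> ('s list \<Rightarrow>\<^sub>0 int) set \<Rightarrow>\<^sub>0 int) set" where
  "bar_chain_diff sS p = stensor_map (bar sS (p - 1)) (bar_diff sS p)"

definition kos_chains ::
    "('k::field \<Rightarrow> 'v::ab_group_add \<Rightarrow> 'v) \<Rightarrow> ('k \<Rightarrow> 's::comm_ring_1 \<Rightarrow> 's) \<Rightarrow> nat
       \<Rightarrow> ('s \<times> ('s list \<times> 'v list \<Rightarrow>\<^sub>0 int) set \<Rightarrow>\<^sub>0 int) set monoid" where
  "kos_chains sV sS p = stensor (kos sV sS p)"

definition kos_chain_diff ::
    "('k::field \<Rightarrow> 'v::ab_group_add \<Rightarrow> 'v) \<Rightarrow> ('k \<Rightarrow> 's::comm_ring_1 \<Rightarrow> 's) \<Rightarrow> ('v \<Rightarrow> 's) \<Rightarrow> nat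
       \<Rightarrow> ('s \<times> ('s list \<times> 'v list \<Rightarrow>\<^sub>0 int) set \<Rightarrow>\<^sub>0 int) set
       \<Rightarrow> ('s \<times> ('s list \<times> 'v list \<Rightarrow>\<^sub>0 int) set \<Rightarrow>\<^sub>0 int) set" where
  "kos_chain_diff sV sS \<iota> p = stensor_map (kos sV sS (p - 1)) (kos_diff sV sS \<iota> p)"

(* HH_p(S(V)) computed from the bar and from the Koszul resolution, and the scalar
   multiplications on the two *)

definition HH_bar ::
    "('k::field \<Rightarrow> 's::comm_ring_1 \<Rightarrow> 's) \<Rightarrow> nat
       \<Rightarrow> ('s \<times> ('s list \<Rightarrow>\<^sub>0 int) set \<Rightarrow>\<^sub>0 int) set set monoid" where
  "HH_bar sS p = homology (bar_chains sS) (bar_chain_diff sS) p"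

definition HH_kos ::
    "('k::field \<Rightarrow> 'v::ab_group_add \<Rightarrow> 'v) \<Rightarrow> ('k \<Rightarrow> 's::comm_ring_1 \<Rightarrow> 's) \<Rightarrow> ('v \<Rightarrow> 's) \<Rightarrow> nat
       \<Rightarrow> ('s \<times> ('s list \<times> 'v list \<Rightarrow>\<^sub>0 int) set \<Rightarrow>\<^sub>0 int) set set monoid" where
  "HH_kos sV sS \<iota> p = homology (kos_chains sV sS) (kos_chain_diff sV sS \<iota>) p"

definition HH_bar_scale where
  "HH_bar_scale sS p c =
     homology_map (bar_chains sS) (bar_chain_diff sS) p (stensor_scale sS (bar sS p) c)"

definition HH_kos_scale where
  "HH_kos_scale sV sS \<iota> p c =
     homology_map (kos_chains sV sS) (kos_chain_diff sV sS \<iota>) p (stensor_scale sS (kos sV sS p) c)"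

definition HH_Psi where
  "HH_Psi sV sS \<iota> v n p =
     homology_map (kos_chains sV sS) (kos_chain_diff sV sS \<iota>) p (id_tensor_Psi sV sS \<iota> v n p)"

end

theory Submission
  imports Defs
begin

text \<open>
  Write x_i and y_i for the elements v_i \<otimes> 1 and 1 \<otimes> v_i of S^e. The homomorphism
  f \<mapsto> f(y_1, ..., y_i, x_{i+1}, ..., x_n) from S to S^e equals f \<otimes> 1 for i = 0 and 1 \<otimes> f for i = n,
  and the step from i - 1 to i is divisible by x_i - y_i. Call the quotient D_i f. On a monomial D_i
  is a product of powers with one geometric sum, and multiplying out these sums turns the definition
  of \<Psi> into

    \<Psi>(1 \<otimes> f_1 \<otimes> ... \<otimes> f_p \<otimes> 1) = \<Sum> D_{i_1} f_1 ... D_{i_p} f_p \<otimes> v_{i_1} \<and> ... \<and> v_{i_p},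

  summed over i_1 < ... < i_p (\<open>psig_expand\<close>, \<open>psig_monomials\<close>, \<open>Psi_eq\<close>). Everything follows from
  this closed form.

  The chain-level formula: S \<otimes>_{S^e} - identifies x_i with y_i, and on this diagonal the difference
  quotient D_i f becomes the derivative of f with respect to v_i (\<open>pdiff_eq\<close>). It remains to know that the
  identification of S \<otimes> \<And>^p V with S \<otimes>_{S^e} (S^e \<otimes> \<And>^p V) is injective; as S is commutative, its inverse is
  f \<otimes> (a \<otimes> b \<otimes> w) \<mapsto> f a b \<otimes> w (\<open>inj_kos_canon\<close>).

  The isomorphism on homology: the Koszul differential of the closed form telescopes, since
  (x_i - y_i) D_i f is the difference of two consecutive substitutions, and a twisted Leibniz rule for
  D_i(f g) produces the products of neighbours in the bar differential. So \<Psi> is a chain map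
  (\<open>kbd_psi\<close>). In the other direction, the bar resolution is contracted by 1 \<otimes> -, and this contraction
  builds recursively an S^e-linear chain map \<Phi> from the Koszul to the bar resolution (\<open>bd_Ph\<close>) and
  an S^e-linear homotopy from the identity to \<Phi> \<Psi> (\<open>homotopy\<close>). The composite \<Psi> \<Phi> is the identity
  on the nose (\<open>psi_Ph\<close>): it suffices to look at wedges of increasing basis vectors, which generate
  over S^e, and there D_j v_i = \<delta>_{ij} leaves a single summand. Hence \<Psi> is a homotopy equivalence
  over S^e, it remains one after S \<otimes>_{S^e} -, and it induces isomorphisms on homology. They
  commute with scalars because these act through the factor S on the left.

  All groups are given by generators and relations, and the maps are given on generators. The
  computations are made with formal integral combinations of generators of all degrees at once,
  up to the congruences \<open>\<approx>B\<close> and \<open>\<approx>K\<close> generated by the relations of all degrees. In this way the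
  operators can be composed without keeping track of degrees, which are put back by
  \<open>eqm_project\<close>.
\<close>

section \<open>Additive congruences\<close>

inductive_set gensub :: "'a::ab_group_add set \<Rightarrow> 'a set" for R where
  base: "x \<in> R \<Longrightarrow> x \<in> gensub R"
| zero: "0 \<in> gensub R"
| diff: "x \<in> gensub R \<Longrightarrow> y \<in> gensub R \<Longrightarrow> x - y \<in> gensub R"

definition eqm :: "'a::ab_group_add set \<Rightarrow> 'a \<Rightarrow> 'a \<Rightarrow> bool" where
  "eqm R a b \<longleftrightarrow> a - b \<in> gensub R"

lemma gensub_uminus: "x \<in> gensub R \<Longrightarrow> - x \<in> gensub R"
  using gensub.diff[OF gensub.zero, of x R] by simp

lemma gensub_add: "x \<in> gensub R \<Longrightarrow> y \<in> gensub R \<Longrightarrow> x + y \<in> gensub R"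
  using gensub.diff[of x R "- y"] gensub_uminus[of y R] by simp

lemma eqm_refl [simp, intro]: "eqm R a a"
  by (simp add: eqm_def gensub.zero)

lemma eqm_sym: "eqm R a b \<Longrightarrow> eqm R b a"
  unfolding eqm_def using gensub_uminus[of "a - b" R] by simp

lemma eqm_trans [trans]: "eqm R a b \<Longrightarrow> eqm R b c \<Longrightarrow> eqm R a c"
  unfolding eqm_def using gensub_add[of "a - b" R "b - c"] by simp

lemma eq_eqm_trans [trans]: "a = b \<Longrightarrow> eqm R b c \<Longrightarrow> eqm R a c"
  by simp

lemma eqm_eq_trans [trans]: "eqm R a b \<Longrightarrow> b = c \<Longrightarrow> eqm R a c"
  by simp

lemma eqm_double: "eqm R a (a + a) \<Longrightarrow> eqm R a 0"
  unfolding eqm_def using gensub_uminus[of "- a" R] by simp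

lemma eqm_add: "eqm R a b \<Longrightarrow> eqm R c d \<Longrightarrow> eqm R (a + c) (b + d)"
  unfolding eqm_def using gensub_add[of "a - b" R "c - d"] by (simp add: algebra_simps)

lemma eqm_uminus: "eqm R a b \<Longrightarrow> eqm R (- a) (- b)"
  unfolding eqm_def using gensub_uminus[of "a - b" R] by simp

lemma eqm_diff: "eqm R a b \<Longrightarrow> eqm R c d \<Longrightarrow> eqm R (a - c) (b - d)"
  using eqm_add[of R a b "- c" "- d"] eqm_uminus[of R c d] by simp

lemma eqm_sum: "(\<And>i. i \<in> I \<Longrightarrow> eqm R (f i) (g i)) \<Longrightarrow> eqm R (sum f I) (sum g I)"
  by (induction I rule: infinite_finite_induct) (auto intro: eqm_add)

lemma eqm_base: "a - b \<in> R \<Longrightarrow> eqm R a b"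
  by (simp add: eqm_def gensub.base)

lemma eqm_zero_iff: "eqm R a 0 \<longleftrightarrow> a \<in> gensub R"
  by (simp add: eqm_def)

lemma eqm_diff_zero: "eqm R (a - b) 0 \<longleftrightarrow> eqm R a b"
  by (simp add: eqm_def)

lemma eqm_frag_cmul:
  fixes a b :: "'x \<Rightarrow>\<^sub>0 int"
  assumes "eqm R a b" shows "eqm R (frag_cmul k a) (frag_cmul k b)"
proof -
  have "frag_cmul k (a - b) \<in> gensub R"
    by (rule frag_closure_minus_cmul[where P = "\<lambda>x. x \<in> gensub R"])
       (use assms in \<open>auto simp: eqm_def intro: gensub.intros\<close>)
  moreover have "frag_cmul k (a - b) = frag_cmul k a - frag_cmul k b"
    by (simp add: poly_mapping_eqI lookup_minus right_diff_distrib)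
  ultimately show ?thesis by (simp add: eqm_def)
qed

lemma eqm_mono:
  assumes "eqm R a b" "R \<subseteq> gensub R'" shows "eqm R' a b"
proof -
  have "x \<in> gensub R'" if "x \<in> gensub R" for x
    using that by induction (use assms(2) in \<open>auto intro: gensub.intros\<close>)
  then show ?thesis using assms(1) by (simp add: eqm_def)
qed

lemma frag_induct [case_names zero one diff]:
  assumes "P 0" "\<And>x. P (frag_of x)" "\<And>a b. P a \<Longrightarrow> P b \<Longrightarrow> P (a - b)"
  shows "P (u :: 'x \<Rightarrow>\<^sub>0 int)"
  using frag_induction[of u UNIV P] assms by auto

definition resp :: "('x \<Rightarrow>\<^sub>0 int) set \<Rightarrow> ('y \<Rightarrow>\<^sub>0 int) set \<Rightarrow> ('x \<Rightarrow> 'y \<Rightarrow>\<^sub>0 int) \<Rightarrow> bool" where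
  "resp R R' g \<longleftrightarrow> (\<forall>r\<in>R. eqm R' (frag_extend g r) 0)"

lemma resp_eqm:
  assumes "resp R R' g" "eqm R a b"
  shows "eqm R' (frag_extend g a) (frag_extend g b)"
proof -
  have "frag_extend g x \<in> gensub R'" if "x \<in> gensub R" for x
    using that
  proof induction
    case (base x)
    then show ?case using assms(1) by (simp add: resp_def eqm_def)
  qed (auto simp: frag_extend_diff intro: gensub.intros)
  then show ?thesis using assms(2) by (simp add: eqm_def flip: frag_extend_diff)
qed

lemma frag_extend_eqm:
  assumes "\<And>x. x \<in> Poly_Mapping.keys u \<Longrightarrow> eqm R (g x) (h x)"
  shows "eqm R (frag_extend g u) (frag_extend h u)"
  unfolding frag_extend_def by (intro eqm_sum eqm_frag_cmul assms)

lemma resp_comp: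
  assumes "resp R R' g" "resp R' R'' h"
  shows "resp R R'' (\<lambda>x. frag_extend h (g x))"
  unfolding resp_def
proof
  fix r assume "r \<in> R"
  have "frag_extend (\<lambda>x. frag_extend h (g x)) u = frag_extend h (frag_extend g u)" for u
    by (induction u rule: frag_induct) (auto simp: frag_extend_diff)
  moreover have "eqm R' (frag_extend g r) 0"
    using assms(1) \<open>r \<in> R\<close> by (simp add: resp_def)
  from resp_eqm[OF assms(2) this] have "eqm R'' (frag_extend h (frag_extend g r)) 0" by simp
  ultimately show "eqm R'' (frag_extend (\<lambda>x. frag_extend h (g x)) r) 0" by simp
qed

lemma frag_extend_extend:
  "frag_extend h (frag_extend g u) = frag_extend (\<lambda>x. frag_extend h (g x)) u"
  by (induction u rule: frag_induct) (auto simp: frag_extend_diff)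

lemma frag_extend_add_fun:
  "frag_extend (\<lambda>x. g x + h x) u = frag_extend g u + frag_extend h u"
  by (induction u rule: frag_induct) (auto simp: frag_extend_diff)

lemma frag_extend_diff_fun:
  "frag_extend (\<lambda>x. g x - h x) u = frag_extend g u - frag_extend h u"
  by (induction u rule: frag_induct) (auto simp: frag_extend_diff)

lemma frag_extend_sum': "frag_extend f (sum g I) = (\<Sum>i\<in>I. frag_extend f (g i))"
  by (induction I rule: infinite_finite_induct) (simp_all add: frag_extend_add)

lemma frag_extend_frag_of [simp]: "frag_extend frag_of u = u"
  using frag_expansion[of u] by simp

lemma frag_extend_keys_subset:
  assumes "Poly_Mapping.keys u \<subseteq> X" "\<And>x. x \<in> X \<Longrightarrow> Poly_Mapping.keys (g x) \<subseteq> Y"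
  shows "Poly_Mapping.keys (frag_extend g u) \<subseteq> Y"
  using keys_frag_extend[of g u] assms by blast

text \<open>Killing the generators outside \<open>X\<close> respects the congruence, because every relation lies entirely
  inside or entirely outside \<open>X\<close>. It is applied to the generators of one degree.\<close>

lemma eqm_project:
  fixes u w :: "'x \<Rightarrow>\<^sub>0 int"
  assumes "eqm R u w" and "Poly_Mapping.keys u \<subseteq> X" "Poly_Mapping.keys w \<subseteq> X"
    and "\<And>r. r \<in> R \<Longrightarrow> r \<in> R' \<and> Poly_Mapping.keys r \<subseteq> X \<or> Poly_Mapping.keys r \<inter> X = {}"
  shows "eqm R' u w"
proof -
  define g :: "'x \<Rightarrow> 'x \<Rightarrow>\<^sub>0 int" where "g = (\<lambda>x. if x \<in> X then frag_of x else 0)"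
  have id: "frag_extend g r = r" if "Poly_Mapping.keys r \<subseteq> X" for r
  proof -
    have "frag_extend g r = frag_extend frag_of r"
      by (rule frag_extend_eq) (use that in \<open>auto simp: g_def\<close>)
    then show ?thesis by simp
  qed
  have "resp R R' g"
    unfolding resp_def
  proof
    fix r assume "r \<in> R"
    then consider "r \<in> R'" "Poly_Mapping.keys r \<subseteq> X" | "Poly_Mapping.keys r \<inter> X = {}"
      using assms(4) by blast
    then show "eqm R' (frag_extend g r) 0"
    proof cases
      case 1
      then show ?thesis by (simp add: id eqm_zero_iff gensub.base)
    next
      case 2
      then have "frag_extend g r = 0"
        by (intro frag_extend_eq_0) (auto simp: g_def)
      then show ?thesis by simp
    qed
  qed
  from resp_eqm[OF this assms(1)] show ?thesis
    using id assms(2,3) by simp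
qed

section \<open>Presented abelian groups\<close>

definition frags_on :: "'x set \<Rightarrow> ('x \<Rightarrow>\<^sub>0 int) set" where
  "frags_on X = {u. Poly_Mapping.keys u \<subseteq> X}"

lemma frags_on_0 [simp]: "0 \<in> frags_on X"
  and frags_on_add: "u \<in> frags_on X \<Longrightarrow> w \<in> frags_on X \<Longrightarrow> u + w \<in> frags_on X"
  and frags_on_diff: "u \<in> frags_on X \<Longrightarrow> w \<in> frags_on X \<Longrightarrow> u - w \<in> frags_on X"
  and frags_on_uminus: "u \<in> frags_on X \<Longrightarrow> - u \<in> frags_on X"
  and frags_on_of [simp]: "frag_of x \<in> frags_on X \<longleftrightarrow> x \<in> X"
  and frags_on_cmul: "u \<in> frags_on X \<Longrightarrow> frag_cmul k u \<in> frags_on X"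
  using keys_add[of u w] keys_diff[of u w] keys_cmul[of k u] by (auto simp: frags_on_def)

lemma frags_on_sum: "(\<And>i. i \<in> I \<Longrightarrow> f i \<in> frags_on X) \<Longrightarrow> sum f I \<in> frags_on X"
  by (induction I rule: infinite_finite_induct) (auto intro: frags_on_add)

lemma frags_on_extend:
  assumes "u \<in> frags_on X" "\<And>x. x \<in> X \<Longrightarrow> g x \<in> frags_on Y"
  shows "frag_extend g u \<in> frags_on Y"
  using frag_extend_keys_subset[of u X g Y] assms by (auto simp: frags_on_def)

lemma frags_on_induct [consumes 1, case_names zero one diff]:
  assumes "u \<in> frags_on X" "P 0" "\<And>x. x \<in> X \<Longrightarrow> P (frag_of x)" "\<And>a b. P a \<Longrightarrow> P b \<Longrightarrow> P (a - b)"
  shows "P u"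
  using frag_induction[of u X P] assms by (auto simp: frags_on_def)

lemma frag_extend_eq_on:
  assumes "u \<in> frags_on X" "\<And>x. x \<in> X \<Longrightarrow> g x = h x"
  shows "frag_extend g u = frag_extend h u"
  by (rule frag_extend_eq) (use assms in \<open>auto simp: frags_on_def\<close>)

lemma frag_extend_eqm_on:
  assumes "u \<in> frags_on X" "\<And>x. x \<in> X \<Longrightarrow> eqm R (g x) (h x)"
  shows "eqm R (frag_extend g u) (frag_extend h u)"
  by (rule frag_extend_eqm) (use assms in \<open>auto simp: frags_on_def\<close>)

lemma gensub_subset_frags_on: "R \<subseteq> frags_on X \<Longrightarrow> gensub R \<subseteq> frags_on X"
proof
  fix x assume "R \<subseteq> frags_on X" "x \<in> gensub R"
  from this(2,1) show "x \<in> frags_on X"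
    by induction (auto intro: frags_on_diff)
qed

text \<open>The subgroup is described by closure under differences, which suits induction better than products
  and inverses in a multiplicatively written group.\<close>

lemma relation_subgroup_eq:
  assumes "R \<subseteq> frags_on X" shows "relation_subgroup X R = gensub R"
proof
  interpret F: group "free_Abelian_group X" by simp
  have sub: "R \<subseteq> carrier (free_Abelian_group X)"
    using assms by (auto simp: frags_on_def)
  show "relation_subgroup X R \<subseteq> gensub R"
  proof
    fix x assume "x \<in> relation_subgroup X R"
    then have "x \<in> generate (free_Abelian_group X) R"
      by (simp add: relation_subgroup_def)
    then show "x \<in> gensub R"
    proof induction
      case (inv h)
      then have "inv\<^bsub>free_Abelian_group X\<^esub> h = - h"
        using assms inv by (intro inv_free_Abelian_group) (auto simp: frags_on_def)
      then show ?case using inv by (auto intro: gensub_uminus gensub.base)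
    qed (auto intro: gensub.intros gensub_add)
  qed
  have S: "subgroup (generate (free_Abelian_group X) R) (free_Abelian_group X)"
    by (rule F.generate_is_subgroup[OF sub])
  show "gensub R \<subseteq> relation_subgroup X R"
  proof
    fix x assume "x \<in> gensub R"
    then show "x \<in> relation_subgroup X R"
    proof induction
      case (base x)
      then show ?case by (simp add: relation_subgroup_def generate.incl)
    next
      case zero
      then show ?case using generate.one[of "free_Abelian_group X" R]
        by (simp add: relation_subgroup_def)
    next
      case (diff x y)
      have "inv\<^bsub>free_Abelian_group X\<^esub> y \<in> relation_subgroup X R"
        using subgroup.m_inv_closed[OF S] diff by (simp add: relation_subgroup_def)
      moreover have "inv\<^bsub>free_Abelian_group X\<^esub> y = - y"
        using gensub_subset_frags_on[OF assms] diff by (intro inv_free_Abelian_group) (auto simp: frags_on_def)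
      ultimately have "- y \<in> relation_subgroup X R" by simp
      then have "x \<otimes>\<^bsub>free_Abelian_group X\<^esub> (- y) \<in> relation_subgroup X R"
        using diff unfolding relation_subgroup_def by (blast intro: generate.eng)
      then show ?case by simp
    qed
  qed
qed

lemma cls_eq: "R \<subseteq> frags_on X \<Longrightarrow> cls X R f = {g. eqm R g f}"
  unfolding cls_def r_coset_def
  by (auto simp: relation_subgroup_eq eqm_def)

lemma cls_eq_iff:
  assumes "R \<subseteq> frags_on X" shows "cls X R f = cls X R g \<longleftrightarrow> eqm R f g"
  using assms by (auto simp: cls_eq intro: eqm_trans eqm_sym)

lemma relation_subgroup_normal:
  assumes "R \<subseteq> frags_on X"
  shows "relation_subgroup X R \<lhd> free_Abelian_group X"
proof -
  interpret F: comm_group "free_Abelian_group X" by (rule abelian_free_Abelian_group)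
  have "R \<subseteq> carrier (free_Abelian_group X)"
    using assms by (auto simp: frags_on_def)
  then show ?thesis
    unfolding relation_subgroup_def
    by (intro F.subgroup_imp_normal F.generate_is_subgroup)
qed

lemma comm_group_presented:
  assumes "R \<subseteq> frags_on X" shows "comm_group (presented X R)"
proof -
  interpret F: comm_group "free_Abelian_group X" by (rule abelian_free_Abelian_group)
  interpret N: normal "relation_subgroup X R" "free_Abelian_group X"
    by (rule relation_subgroup_normal[OF assms])
  show ?thesis
    unfolding presented_def
    by (rule F.abelian_FactGroup) (rule N.is_subgroup)
qed

lemma carrier_presented: "carrier (presented X R) = cls X R ` frags_on X"
  by (auto simp: presented_def FactGroup_def RCOSETS_def cls_def frags_on_def)

lemma mult_presented:
  assumes "R \<subseteq> frags_on X" "f \<in> frags_on X" "g \<in> frags_on X"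
  shows "cls X R f \<otimes>\<^bsub>presented X R\<^esub> cls X R g = cls X R (f + g)"
proof -
  interpret N: normal "relation_subgroup X R" "free_Abelian_group X"
    by (rule relation_subgroup_normal[OF assms(1)])
  show ?thesis
    using N.rcos_sum[of f g] assms
    by (simp add: presented_def FactGroup_def cls_def frags_on_def)
qed

lemma one_presented:
  assumes "R \<subseteq> frags_on X" shows "\<one>\<^bsub>presented X R\<^esub> = cls X R 0"
  by (simp add: presented_def FactGroup_def cls_eq[OF assms] relation_subgroup_eq[OF assms] eqm_def)

lemma lift_cls:
  assumes "R \<subseteq> frags_on X" "R' \<subseteq> frags_on Y" "resp R R' g"
  shows "lift Y R' g (cls X R f) = cls Y R' (frag_extend g f)"
proof -
  have "lift Y R' g (cls X R f) = (\<Union>x\<in>cls X R f. cls Y R' (frag_extend g x))"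
    by (simp add: lift_def induced_def cls_def)
  moreover have "cls Y R' (frag_extend g x) = cls Y R' (frag_extend g f)" if "x \<in> cls X R f" for x
    using that resp_eqm[OF assms(3)] by (simp add: cls_eq_iff[OF assms(2)] cls_eq[OF assms(1)])
  then have "(\<Union>x\<in>cls X R f. cls Y R' (frag_extend g x)) = (\<Union>x\<in>cls X R f. cls Y R' (frag_extend g f))"
    by (rule SUP_cong[OF refl])
  moreover have "f \<in> cls X R f" by (simp add: cls_eq[OF assms(1)])
  then have "(\<Union>x\<in>cls X R f. cls Y R' (frag_extend g f)) = cls Y R' (frag_extend g f)" by blast
  ultimately show ?thesis by (simp only:)
qed

lemma lift_hom:
  assumes R: "R \<subseteq> frags_on X" and R': "R' \<subseteq> frags_on Y" and "resp R R' g"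
    and g: "\<And>x. x \<in> X \<Longrightarrow> g x \<in> frags_on Y"
  shows "lift Y R' g \<in> hom (presented X R) (presented Y R')"
proof (rule homI)
  fix C assume "C \<in> carrier (presented X R)"
  then obtain f where "C = cls X R f" "f \<in> frags_on X" by (auto simp: carrier_presented)
  then show "lift Y R' g C \<in> carrier (presented Y R')"
    by (simp add: carrier_presented lift_cls[OF assms(1-3)] frags_on_extend[OF _ g])
next
  fix C C' assume "C \<in> carrier (presented X R)" "C' \<in> carrier (presented X R)"
  then obtain f f' where "C = cls X R f" "f \<in> frags_on X" "C' = cls X R f'" "f' \<in> frags_on X"
    by (auto simp: carrier_presented)
  then show "lift Y R' g (C \<otimes>\<^bsub>presented X R\<^esub> C') = lift Y R' g C \<otimes>\<^bsub>presented Y R'\<^esub> lift Y R' g C'"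
    by (simp add: mult_presented R R' frag_extend_add lift_cls[OF assms(1-3)]
        frags_on_extend[OF _ g])
qed

section \<open>Tensoring over the enveloping algebra\<close>

locale env_mod =
  fixes M :: "('s::comm_ring_1, 'm) env_module"
  assumes comm: "comm_group M"
    and act_closed: "x \<in> carrier M \<Longrightarrow> act M a b x \<in> carrier M"
begin

lemma stensor_rels_on: "stensor_rels M \<subseteq> frags_on (stensor_gens M)"
proof
  interpret comm_group M by (rule comm)
  fix r assume "r \<in> stensor_rels M"
  then show "r \<in> frags_on (stensor_gens M)"
    unfolding stensor_rels_def
    by (elim UnE CollectE exE conjE) (simp_all add: frags_on_diff stensor_gens_def act_closed)
qed

end

definition smap :: "('m \<Rightarrow> 'l) \<Rightarrow> 's \<times> 'm \<Rightarrow> ('s \<times> 'l \<Rightarrow>\<^sub>0 int)" where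
  "smap f = (\<lambda>(s, x). frag_of (s, f x))"

lemma smap_resp:
  assumes "env_mod M" "env_mod N" "env_linear M N f"
  shows "resp (stensor_rels M) (stensor_rels N) (smap f)"
proof -
  interpret M: env_mod M by fact
  interpret N: env_mod N by fact
  have h: "f \<in> hom M N" and l: "\<And>a b x. x \<in> carrier M \<Longrightarrow> f (act M a b x) = act N a b (f x)"
    using assms(3) unfolding env_linear_def by blast+
  have cl: "\<And>x. x \<in> carrier M \<Longrightarrow> f x \<in> carrier N" by (rule hom_in_carrier[OF h])
  show ?thesis
    unfolding resp_def
  proof
    fix r assume "r \<in> stensor_rels M"
    then consider
      (1) s t x where "r = frag_of (s + t, x) - frag_of (s, x) - frag_of (t, x)" "x \<in> carrier M"
    | (2) s x y where "r = frag_of (s, x \<otimes>\<^bsub>M\<^esub> y) - frag_of (s, x) - frag_of (s, y)" "x \<in> carrier M" "y \<in> carrier M"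
    | (3) s a b x where "r = frag_of (b * s * a, x) - frag_of (s, act M a b x)" "x \<in> carrier M"
      unfolding stensor_rels_def by blast
    then have "frag_extend (smap f) r \<in> stensor_rels N"
    proof cases
      case 1
      have "frag_of (s + t, f x) - frag_of (s, f x) - frag_of (t, f x) \<in> stensor_rels N"
        using cl[OF 1(2)] unfolding stensor_rels_def by blast
      then show ?thesis by (simp add: 1 frag_extend_diff smap_def)
    next
      case 2
      have "frag_of (s, f x \<otimes>\<^bsub>N\<^esub> f y) - frag_of (s, f x) - frag_of (s, f y) \<in> stensor_rels N"
        using cl[OF 2(2)] cl[OF 2(3)] unfolding stensor_rels_def by blast
      then show ?thesis by (simp add: 2 frag_extend_diff smap_def hom_mult[OF h])
    next
      case 3
      have "frag_of (b * s * a, f x) - frag_of (s, act N a b (f x)) \<in> stensor_rels N"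
        using cl[OF 3(2)] unfolding stensor_rels_def by blast
      then show ?thesis by (simp add: 3 frag_extend_diff smap_def l)
    qed
    then show "eqm (stensor_rels N) (frag_extend (smap f) r) 0"
      by (simp add: eqm_zero_iff gensub.base)
  qed
qed

lemma smap_on:
  assumes "env_linear M N f" "x \<in> stensor_gens M"
  shows "smap f x \<in> frags_on (stensor_gens N)"
proof -
  have "f \<in> hom M N" using assms(1) unfolding env_linear_def by blast
  then show ?thesis
    using assms(2) hom_in_carrier[of f M N "snd x"] by (cases x) (simp add: stensor_gens_def smap_def)
qed

lemma stensor_map_eq: "stensor_map N f = lift (stensor_gens N) (stensor_rels N) (smap f)"
  by (simp only: stensor_map_def smap_def)

lemma stensor_map_cls:
  assumes "env_mod M" "env_mod N" "env_linear M N f"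
  shows "stensor_map N f (cls (stensor_gens M) (stensor_rels M) u) =
         cls (stensor_gens N) (stensor_rels N) (frag_extend (smap f) u)"
  unfolding stensor_map_eq
  by (rule lift_cls[OF env_mod.stensor_rels_on[OF assms(1)] env_mod.stensor_rels_on[OF assms(2)]
        smap_resp[OF assms]])

lemma stensor_map_hom:
  assumes "env_mod M" "env_mod N" "env_linear M N f"
  shows "stensor_map N f \<in> hom (stensor M) (stensor N)"
  unfolding stensor_map_eq stensor_def
  by (rule lift_hom[OF env_mod.stensor_rels_on[OF assms(1)] env_mod.stensor_rels_on[OF assms(2)]
        smap_resp[OF assms] smap_on[OF assms(3)]])

lemma stensor_carrierE:
  assumes "C \<in> carrier (stensor M)"
  obtains u where "C = cls (stensor_gens M) (stensor_rels M) u" "u \<in> frags_on (stensor_gens M)"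
  using assms by (auto simp: stensor_def carrier_presented)

lemma stensor_map_comp:
  assumes "env_mod M" "env_mod N" "env_mod L" "env_linear M N f" "env_linear N L g"
    and "env_linear M L k" "\<And>x. x \<in> carrier M \<Longrightarrow> g (f x) = k x"
    and "C \<in> carrier (stensor M)"
  shows "stensor_map L g (stensor_map N f C) = stensor_map L k C"
proof -
  obtain u where u: "C = cls (stensor_gens M) (stensor_rels M) u" "u \<in> frags_on (stensor_gens M)"
    using assms(8) by (rule stensor_carrierE)
  have "frag_extend (smap g) (frag_extend (smap f) u) = frag_extend (smap k) u"
    unfolding frag_extend_extend
    by (rule frag_extend_eq_on[OF u(2)]) (use assms(7) in \<open>auto simp: smap_def stensor_gens_def\<close>)
  then show ?thesis
    unfolding u(1) stensor_map_cls[OF assms(1,2,4)] stensor_map_cls[OF assms(2,3,5)]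
      stensor_map_cls[OF assms(1,3,6)] by simp
qed

lemma stensor_map_mult:
  assumes "env_mod M" "env_mod N" "env_linear M N f" "env_linear M N g" "env_linear M N k"
    and k: "\<And>x. x \<in> carrier M \<Longrightarrow> k x = f x \<otimes>\<^bsub>N\<^esub> g x"
    and "C \<in> carrier (stensor M)"
  shows "stensor_map N k C = stensor_map N f C \<otimes>\<^bsub>stensor N\<^esub> stensor_map N g C"
proof -
  interpret N: env_mod N by fact
  obtain u where u: "C = cls (stensor_gens M) (stensor_rels M) u" "u \<in> frags_on (stensor_gens M)"
    using assms(7) by (rule stensor_carrierE)
  have cl: "f x \<in> carrier N" "g x \<in> carrier N" if "x \<in> carrier M" for x
    using assms(3,4) that hom_in_carrier unfolding env_linear_def by fast+
  have "eqm (stensor_rels N) (frag_extend (smap k) u) (frag_extend (\<lambda>x. smap f x + smap g x) u)"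
  proof (rule frag_extend_eqm_on[OF u(2)])
    fix x assume "x \<in> stensor_gens M"
    then obtain s y where x: "x = (s, y)" "y \<in> carrier M" by (auto simp: stensor_gens_def)
    have "frag_of (s, f y \<otimes>\<^bsub>N\<^esub> g y) - frag_of (s, f y) - frag_of (s, g y) \<in> stensor_rels N"
      using cl x unfolding stensor_rels_def by blast
    then show "eqm (stensor_rels N) (smap k x) (smap f x + smap g x)"
      using x k by (intro eqm_base) (simp add: smap_def algebra_simps)
  qed
  then have "cls (stensor_gens N) (stensor_rels N) (frag_extend (smap k) u) =
      cls (stensor_gens N) (stensor_rels N) (frag_extend (smap f) u + frag_extend (smap g) u)"
    by (simp add: cls_eq_iff[OF N.stensor_rels_on] frag_extend_add_fun)
  then show ?thesis
    unfolding u(1) stensor_map_cls[OF assms(1,2,3)] stensor_map_cls[OF assms(1,2,4)]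
      stensor_map_cls[OF assms(1,2,5)] stensor_def
    by (subst mult_presented[OF N.stensor_rels_on frags_on_extend[OF u(2) smap_on[OF assms(3)]]
          frags_on_extend[OF u(2) smap_on[OF assms(4)]]])
qed

section \<open>Homotopy equivalences and homology\<close>

lemma induced_coset:
  assumes "comm_group G" "comm_group H" "f \<in> hom G H" "subgroup BH H" "BG \<subseteq> carrier G"
    "f ` BG \<subseteq> BH" "\<one>\<^bsub>G\<^esub> \<in> BG" "z \<in> carrier G"
  shows "induced H BH f (BG #>\<^bsub>G\<^esub> z) = BH #>\<^bsub>H\<^esub> f z"
proof -
  interpret G: comm_group G by fact
  interpret H: comm_group H by fact
  have fz: "f z \<in> carrier H" using assms(3,8) by (rule hom_in_carrier)
  have BHc: "BH \<subseteq> carrier H" using assms(4) by (rule subgroup.subset)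
  have "BH #>\<^bsub>H\<^esub> f x = BH #>\<^bsub>H\<^esub> f z" if x: "x \<in> BG #>\<^bsub>G\<^esub> z" for x
  proof -
    obtain b where b: "b \<in> BG" "x = b \<otimes>\<^bsub>G\<^esub> z" using x unfolding r_coset_def by blast
    have fb: "f b \<in> BH" using b(1) assms(6) by blast
    have "b \<in> carrier G" using b(1) assms(5) by blast
    then have "f x = f b \<otimes>\<^bsub>H\<^esub> f z" using b(2) hom_mult[OF assms(3)] assms(8) by simp
    moreover have "BH #>\<^bsub>H\<^esub> f b = BH"
      using fb BHc assms(4) by (intro H.coset_join2) blast+
    moreover have "BH #>\<^bsub>H\<^esub> f b #>\<^bsub>H\<^esub> f z = BH #>\<^bsub>H\<^esub> (f b \<otimes>\<^bsub>H\<^esub> f z)"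
      using fb BHc fz by (intro H.coset_mult_assoc) blast+
    ultimately show ?thesis by simp
  qed
  moreover have "z \<in> BG #>\<^bsub>G\<^esub> z"
    unfolding r_coset_def using assms(7) G.l_one[OF assms(8)] by (metis UN_I insertI1)
  ultimately show ?thesis unfolding induced_def by blast
qed

text \<open>The surjectivity assumption already concerns cycles, not only homology classes: one composite of
  the homotopy equivalence below is the identity, so no boundary has to be corrected there.\<close>

lemma induced_iso:
  assumes G: "comm_group G" and H: "comm_group H" and f: "f \<in> hom G H"
    and ZG: "subgroup ZG G" and ZH: "subgroup ZH H"
    and BG: "subgroup BG G" and BH: "subgroup BH H" and "BG \<subseteq> ZG" "BH \<subseteq> ZH"
    and fZ: "f ` ZG \<subseteq> ZH" and fB: "f ` BG \<subseteq> BH"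
    and inj: "\<And>z. z \<in> ZG \<Longrightarrow> f z \<in> BH \<Longrightarrow> z \<in> BG"
    and surj: "\<And>y. y \<in> ZH \<Longrightarrow> \<exists>z\<in>ZG. f z = y"
  shows "induced H BH f \<in> iso (G\<lparr>carrier := ZG\<rparr> Mod BG) (H\<lparr>carrier := ZH\<rparr> Mod BH)"
proof -
  interpret G: comm_group G by fact
  interpret H: comm_group H by fact
  interpret GZ: comm_group "G\<lparr>carrier := ZG\<rparr>"
    by (intro group.group_comm_groupI G.subgroup_imp_group[OF ZG]) (auto simp: G.m_comm subgroup.mem_carrier[OF ZG])
  interpret HZ: comm_group "H\<lparr>carrier := ZH\<rparr>"
    by (intro group.group_comm_groupI H.subgroup_imp_group[OF ZH]) (auto simp: H.m_comm subgroup.mem_carrier[OF ZH])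
  have "subgroup BG (G\<lparr>carrier := ZG\<rparr>)"
    using G.subgroup_incl[OF BG ZG] assms by simp
  then interpret BGn: normal BG "G\<lparr>carrier := ZG\<rparr>" by (rule GZ.subgroup_imp_normal)
  have "subgroup BH (H\<lparr>carrier := ZH\<rparr>)"
    using H.subgroup_incl[OF BH ZH] assms by simp
  then interpret BHn: normal BH "H\<lparr>carrier := ZH\<rparr>" by (rule HZ.subgroup_imp_normal)
  have carG: "carrier (G\<lparr>carrier := ZG\<rparr> Mod BG) = (\<lambda>z. BG #>\<^bsub>G\<^esub> z) ` ZG"
    by (auto simp: FactGroup_def RCOSETS_def r_coset_def)
  have carH: "carrier (H\<lparr>carrier := ZH\<rparr> Mod BH) = (\<lambda>z. BH #>\<^bsub>H\<^esub> z) ` ZH"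
    by (auto simp: FactGroup_def RCOSETS_def r_coset_def)
  have Zc: "ZG \<subseteq> carrier G" "ZH \<subseteq> carrier H" "BG \<subseteq> carrier G"
    by (rule subgroup.subset[OF ZG] subgroup.subset[OF ZH] subgroup.subset[OF BG])+
  have val: "induced H BH f (BG #>\<^bsub>G\<^esub> z) = BH #>\<^bsub>H\<^esub> f z" if "z \<in> ZG" for z
    using that Zc subgroup.one_closed[OF BG] by (intro induced_coset G H f BH fB) auto
  have mG: "(BG #>\<^bsub>G\<^esub> y) \<otimes>\<^bsub>G\<lparr>carrier := ZG\<rparr> Mod BG\<^esub> (BG #>\<^bsub>G\<^esub> z) = BG #>\<^bsub>G\<^esub> (y \<otimes>\<^bsub>G\<^esub> z)"
    if "y \<in> ZG" "z \<in> ZG" for y z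
    using BGn.rcos_sum[of y z] that by (simp add: FactGroup_def r_coset_def)
  have mH: "(BH #>\<^bsub>H\<^esub> y) \<otimes>\<^bsub>H\<lparr>carrier := ZH\<rparr> Mod BH\<^esub> (BH #>\<^bsub>H\<^esub> z) = BH #>\<^bsub>H\<^esub> (y \<otimes>\<^bsub>H\<^esub> z)"
    if "y \<in> ZH" "z \<in> ZH" for y z
    using BHn.rcos_sum[of y z] that by (simp add: FactGroup_def r_coset_def)
  show ?thesis
  proof (rule isoI)
    show "induced H BH f \<in> hom (G\<lparr>carrier := ZG\<rparr> Mod BG) (H\<lparr>carrier := ZH\<rparr> Mod BH)"
    proof (rule homI)
      fix C assume "C \<in> carrier (G\<lparr>carrier := ZG\<rparr> Mod BG)"
      then show "induced H BH f C \<in> carrier (H\<lparr>carrier := ZH\<rparr> Mod BH)"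
        using val fZ unfolding carG carH by auto
    next
      fix C C' assume "C \<in> carrier (G\<lparr>carrier := ZG\<rparr> Mod BG)" "C' \<in> carrier (G\<lparr>carrier := ZG\<rparr> Mod BG)"
      then obtain y z where yz: "y \<in> ZG" "z \<in> ZG" "C = BG #>\<^bsub>G\<^esub> y" "C' = BG #>\<^bsub>G\<^esub> z"
        unfolding carG by auto
      have "y \<otimes>\<^bsub>G\<^esub> z \<in> ZG" using yz ZG by (simp add: subgroup.m_closed)
      moreover have "f (y \<otimes>\<^bsub>G\<^esub> z) = f y \<otimes>\<^bsub>H\<^esub> f z"
        using yz Zc by (intro hom_mult[OF f]) auto
      ultimately show "induced H BH f (C \<otimes>\<^bsub>G\<lparr>carrier := ZG\<rparr> Mod BG\<^esub> C') =
          induced H BH f C \<otimes>\<^bsub>H\<lparr>carrier := ZH\<rparr> Mod BH\<^esub> induced H BH f C'"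
        using yz fZ by (simp add: mG mH val image_subset_iff del: mult_FactGroup)
    qed
    show "bij_betw (induced H BH f) (carrier (G\<lparr>carrier := ZG\<rparr> Mod BG)) (carrier (H\<lparr>carrier := ZH\<rparr> Mod BH))"
    proof (rule bij_betw_imageI)
      show "inj_on (induced H BH f) (carrier (G\<lparr>carrier := ZG\<rparr> Mod BG))"
      proof (rule inj_onI)
        fix C C' assume "C \<in> carrier (G\<lparr>carrier := ZG\<rparr> Mod BG)" "C' \<in> carrier (G\<lparr>carrier := ZG\<rparr> Mod BG)"
          and eq: "induced H BH f C = induced H BH f C'"
        then obtain y z where yz: "y \<in> ZG" "z \<in> ZG" "C = BG #>\<^bsub>G\<^esub> y" "C' = BG #>\<^bsub>G\<^esub> z"
          unfolding carG by auto
        have yzc: "y \<in> carrier G" "z \<in> carrier G" using yz Zc by auto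
        have fc: "f y \<in> carrier H" "f z \<in> carrier H" using yzc f by (auto simp: hom_in_carrier)
        have "BH #>\<^bsub>H\<^esub> f y = BH #>\<^bsub>H\<^esub> f z" using eq yz val by simp
        then have "f y \<in> BH #>\<^bsub>H\<^esub> f z" using H.rcos_self[OF fc(1) BH] by simp
        then obtain b where b: "b \<in> BH" "f y = b \<otimes>\<^bsub>H\<^esub> f z" by (auto simp: r_coset_def)
        have bc: "b \<in> carrier H" using b BH by (auto dest: subgroup.mem_carrier)
        have "f (y \<otimes>\<^bsub>G\<^esub> inv\<^bsub>G\<^esub> z) = f y \<otimes>\<^bsub>H\<^esub> inv\<^bsub>H\<^esub> f z"
          using yzc f by (simp add: hom_mult[OF f] group_hom.hom_inv[of G H f] group_hom_def group_hom_axioms_def G.group_axioms H.group_axioms)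
        also have "\<dots> = b" using b bc fc by (simp add: H.m_assoc)
        finally have "f (y \<otimes>\<^bsub>G\<^esub> inv\<^bsub>G\<^esub> z) \<in> BH" using b by simp
        moreover have "y \<otimes>\<^bsub>G\<^esub> inv\<^bsub>G\<^esub> z \<in> ZG"
          using yz ZG by (simp add: subgroup.m_closed subgroup.m_inv_closed)
        ultimately have "y \<otimes>\<^bsub>G\<^esub> inv\<^bsub>G\<^esub> z \<in> BG" by (rule inj[rotated])
        then have "BG #>\<^bsub>G\<^esub> (y \<otimes>\<^bsub>G\<^esub> inv\<^bsub>G\<^esub> z) = BG"
          using BG yzc by (intro G.coset_join2) auto
        moreover have "y = (y \<otimes>\<^bsub>G\<^esub> inv\<^bsub>G\<^esub> z) \<otimes>\<^bsub>G\<^esub> z" using yzc by (simp add: G.m_assoc)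
        ultimately have "BG #>\<^bsub>G\<^esub> y = BG #>\<^bsub>G\<^esub> z"
          using G.coset_mult_assoc[of BG "y \<otimes>\<^bsub>G\<^esub> inv\<^bsub>G\<^esub> z" z] yzc Zc by simp
        then show "C = C'" using yz by simp
      qed
      show "induced H BH f ` carrier (G\<lparr>carrier := ZG\<rparr> Mod BG) = carrier (H\<lparr>carrier := ZH\<rparr> Mod BH)"
      proof
        show "induced H BH f ` carrier (G\<lparr>carrier := ZG\<rparr> Mod BG) \<subseteq> carrier (H\<lparr>carrier := ZH\<rparr> Mod BH)"
          using val fZ unfolding carG carH by auto
        show "carrier (H\<lparr>carrier := ZH\<rparr> Mod BH) \<subseteq> induced H BH f ` carrier (G\<lparr>carrier := ZG\<rparr> Mod BG)"
        proof
          fix C assume "C \<in> carrier (H\<lparr>carrier := ZH\<rparr> Mod BH)"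
          then obtain y where y: "y \<in> ZH" "C = BH #>\<^bsub>H\<^esub> y" unfolding carH by auto
          then obtain z where "z \<in> ZG" "f z = y" using surj by blast
          then show "C \<in> induced H BH f ` carrier (G\<lparr>carrier := ZG\<rparr> Mod BG)"
            unfolding carG using y val[of z] by (metis imageI)
        qed
      qed
    qed
  qed
qed


declare One_nat_def [simp del]

section \<open>Polynomial mappings as free algebras\<close>

lemma poly_mapping_add_induct [case_names zero single add]:
  fixes F :: "'m \<Rightarrow>\<^sub>0 'a::monoid_add"
  assumes "P 0" "\<And>m c. P (Poly_Mapping.single m c)" "\<And>F G. P F \<Longrightarrow> P G \<Longrightarrow> P (F + G)"
  shows "P F"
proof (induction F rule: update_induct)
  case (update f a b)
  have "Poly_Mapping.update a b f = f + Poly_Mapping.single a b"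
    using update(1) by (intro poly_mapping_eqI)
      (auto simp: lookup_update lookup_add lookup_single in_keys_iff)
  then show ?case using update assms by simp
qed (rule assms(1))

text \<open>A sum over the terms of a polynomial mapping is additive as soon as its summand is additive in
  the coefficient. All evaluation maps below are of this form.\<close>

lemma keys_sum_add:
  assumes "\<And>m. f m 0 = 0" "\<And>m a b. f m (a + b) = f m a + f m b"
  shows "(\<Sum>m\<in>Poly_Mapping.keys (F + G). f m (Poly_Mapping.lookup (F + G) m)) =
    (\<Sum>m\<in>Poly_Mapping.keys F. f m (Poly_Mapping.lookup F m)) +
    (\<Sum>m\<in>Poly_Mapping.keys G. f m (Poly_Mapping.lookup G m))"
  by (rule setsum_keys_plus_distrib) (auto simp: assms)

lemma keys_sum_single:
  assumes "\<And>m. f m 0 = 0"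
  shows "(\<Sum>k\<in>Poly_Mapping.keys (Poly_Mapping.single m c). f k (Poly_Mapping.lookup (Poly_Mapping.single m c) k)) = f m c"
  using assms by (cases "c = 0") auto

text \<open>Linear maps from V into commutative algebras, evaluated on the free commutative algebra on the set V.
  The two instances are \<open>\<iota>\<close> itself and v_i \<mapsto> 1 \<otimes> v_i into S^e.\<close>

locale alg_map = Vector_Spaces.linear sV sT g
  for sV :: "'k::field \<Rightarrow> 'v::ab_group_add \<Rightarrow> 'v"
    and sT :: "'k \<Rightarrow> 't::comm_ring_1 \<Rightarrow> 't"
    and g :: "'v \<Rightarrow> 't" +
  assumes scale_mult: "sT c (x * y) = sT c x * y"
begin

lemma free_eval_add: "free_eval sT g (F + G) = free_eval sT g F + free_eval sT g G"
  unfolding free_eval_def by (rule keys_sum_add) (simp_all add: vs2.scale_left_distrib)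

lemma free_eval_single: "free_eval sT g (Poly_Mapping.single m c) = sT c (\<Prod>w\<in>#m. g w)"
  unfolding free_eval_def by (rule keys_sum_single) simp

lemma free_eval_zero [simp]: "free_eval sT g 0 = 0"
  by (simp add: free_eval_def)

lemma free_eval_1: "free_eval sT g 1 = sT 1 1"
  using free_eval_single[of "{#}" 1] by simp

lemma free_eval_diff: "free_eval sT g (F - G) = free_eval sT g F - free_eval sT g G"
  using free_eval_add[of "F - G" G] by (simp add: eq_diff_eq)

lemma free_eval_mult: "free_eval sT g (F * G) = free_eval sT g F * free_eval sT g G"
proof (induction F rule: poly_mapping_add_induct)
  case (single m c)
  show ?case
  proof (induction G rule: poly_mapping_add_induct)
    case (single m' c')
    have "sT (c * c') (x * y) = sT c x * sT c' y" for x y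
    proof -
      have "sT (c * c') (x * y) = sT c (sT c' y * x)"
        unfolding scale_mult[symmetric] by (simp add: mult.commute[of x y])
      also have "\<dots> = sT c (x * sT c' y)" by (simp only: mult.commute)
      also have "\<dots> = sT c x * sT c' y" by (rule scale_mult)
      finally show ?thesis .
    qed
    then show ?case by (simp add: mult_single free_eval_single)
  qed (simp_all add: free_eval_add distrib_left)
qed (simp_all add: free_eval_add distrib_right)

lemma free_eval_relations:
  assumes "F \<in> module.span (*) (linearity_relations sV)"
  shows "free_eval sT g F = 0"
proof -
  interpret R: module "(*) :: ('v multiset \<Rightarrow>\<^sub>0 'k) \<Rightarrow> _"
    by unfold_locales (simp_all add: algebra_simps)
  show ?thesis
    using assms
  proof (induction rule: R.span_induct_alt)
    case (step c x y)
    have "free_eval sT g x = 0"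
      using step(1) unfolding linearity_relations_def
      by (auto simp: free_eval_diff free_eval_single add scale)
    then show ?case using step by (simp add: free_eval_add free_eval_mult)
  qed simp
qed

end

section \<open>The symmetric algebra with a basis\<close>

text \<open>S^e is modelled as the polynomial ring over S in y_1, y_2, ...: the left factor
  consists of the constants, and the monomials of the right factor are written out. Only
  y_1, ..., y_n occur below. Thus elements of S^e have normal forms, in contrast to the
  classes in the tensor product.\<close>

type_synonym 's env = "(nat \<Rightarrow>\<^sub>0 nat) \<Rightarrow>\<^sub>0 's"

abbreviation lft :: "'s::comm_ring_1 \<Rightarrow> 's env" where
  "lft a \<equiv> Poly_Mapping.single 0 a"

abbreviation yvar :: "nat \<Rightarrow> 's::comm_ring_1 env" where
  "yvar i \<equiv> Poly_Mapping.single (Poly_Mapping.single i 1) 1"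

lemma lft_mult: "lft (a * b) = lft a * lft b"
  by (simp add: mult_single)

text \<open>The quotient (x^a - y^a) / (x - y).\<close>

primrec powdiff :: "'a::comm_ring_1 \<Rightarrow> 'a \<Rightarrow> nat \<Rightarrow> 'a" where
  "powdiff x y 0 = 0"
| "powdiff x y (Suc a) = y * powdiff x y a + x ^ a"

lemma powdiff_1 [simp]: "powdiff x y 1 = 1"
  by (simp add: One_nat_def)

lemma powdiff_mult: "(x - y) * powdiff x y a = x ^ a - y ^ a"
proof (induction a)
  case (Suc a)
  have "(x - y) * powdiff x y (Suc a) = y * ((x - y) * powdiff x y a) + (x - y) * x ^ a"
    by (simp add: algebra_simps)
  then show ?case unfolding Suc by (simp add: algebra_simps)
qed simp

lemma powdiff_add: "powdiff x y (a + b) = powdiff x y a * y ^ b + x ^ a * powdiff x y b"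
  by (induction b) (simp_all add: algebra_simps power_add)

lemma powdiff_sum: "powdiff x y a = (\<Sum>k<a. x ^ k * y ^ (a - 1 - k))"
proof (induction a)
  case (Suc a)
  have "y * (\<Sum>k<a. x ^ k * y ^ (a - 1 - k)) = (\<Sum>k<a. x ^ k * y ^ (a - k))"
    unfolding sum_distrib_left
  proof (rule sum.cong[OF refl])
    fix k assume "k \<in> {..<a}"
    then have "a - k = Suc (a - 1 - k)" by auto
    then show "y * (x ^ k * y ^ (a - 1 - k)) = x ^ k * y ^ (a - k)" by (simp add: ac_simps)
  qed
  then show ?case using Suc by simp
qed simp

lemma powdiff_diag: "powdiff x x a = of_nat a * x ^ (a - 1)"
proof (induction a)
  case (Suc a)
  then show ?case by (cases a) (simp_all add: algebra_simps)
qed simp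

locale sym_basis = symmetric_algebra sV sS \<iota>
  for sV :: "'k::field \<Rightarrow> 'v::ab_group_add \<Rightarrow> 'v"
    and sS :: "'k \<Rightarrow> 's::comm_ring_1 \<Rightarrow> 's"
    and \<iota> :: "'v \<Rightarrow> 's" +
  fixes v :: "nat \<Rightarrow> 'v" and n :: nat
  assumes basis: "indexed_basis sV v n"
begin

sublocale S: alg_map sV sS \<iota>
  by unfold_locales (rule scale_mult)

lemma indep: "vs1.independent (v ` {1..n})" and span: "vs1.span (v ` {1..n}) = UNIV"
  and inj: "inj_on v {1..n}"
  using basis by (auto simp: indexed_basis_def)

abbreviation sc :: "'k \<Rightarrow> 's" where "sc c \<equiv> sS c 1"

lemma scale_sc: "sS c x = sc c * x"
  using scale_mult[of c 1 x] by simp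

definition coord :: "nat \<Rightarrow> 'v \<Rightarrow> 'k" where
  "coord i w = vs1.representation (v ` {1..n}) w (v i)"

lemma coord_add: "coord i (x + y) = coord i x + coord i y"
  and coord_scale: "coord i (sV c x) = c * coord i x"
  by (simp_all add: coord_def vs1.representation_add[OF indep] vs1.representation_scale[OF indep] span)

lemma coord_basis: "i \<in> {1..n} \<Longrightarrow> j \<in> {1..n} \<Longrightarrow> coord i (v j) = (if i = j then 1 else 0)"
  unfolding coord_def
  by (subst vs1.representation_basis[OF indep]) (simp_all add: inj_on_eq_iff[OF inj])

definition sE :: "'k \<Rightarrow> 's env \<Rightarrow> 's env" where "sE c r = lft (sc c) * r"

text \<open>The image 1 \<otimes> w of a vector in the model of S^e.\<close>

definition yvec :: "'v \<Rightarrow> 's env" where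
  "yvec w = (\<Sum>i=1..n. sE (coord i w) (yvar i))"

lemma sc_mult: "sc a * sc b = sc (a * b)"
  using scale_sc[of a "sc b"] by simp

lemma vector_space_sE: "vector_space sE"
proof
  fix a b :: 'k and x y :: "'s env"
  show "sE a (x + y) = sE a x + sE a y" by (simp add: sE_def distrib_left)
  show "sE (a + b) x = sE a x + sE b x"
    by (simp add: sE_def vs2.scale_left_distrib single_add distrib_right)
  have "lft (sc a) * lft (sc b) = lft (sc (a * b))" by (simp add: mult_single sc_mult)
  then show "sE a (sE b x) = sE (a * b) x" unfolding sE_def by (simp only: mult.assoc[symmetric])
  show "sE 1 x = x" by (simp add: sE_def)
qed

sublocale Y: alg_map sV sE yvec
proof -
  interpret E: vector_space sE by (rule vector_space_sE)
  show "alg_map sV sE yvec"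
  proof
    fix c w w' and x y :: "'s env"
    show "yvec (w + w') = yvec w + yvec w'"
      by (simp add: yvec_def coord_add E.scale_left_distrib sum.distrib)
    show "yvec (sV c w) = sE c (yvec w)"
      by (simp add: yvec_def coord_scale E.scale_sum_right)
    show "sE c (x * y) = sE c x * y" by (simp add: sE_def mult.assoc)
  qed
qed

text \<open>The homomorphism f \<mapsto> 1 \<otimes> f, obtained from the presentation of S: linear maps from V to commutative
  algebras extend to S. As it sends monomials to monomials of the polynomial ring, it also shows that the
  monomials in v_1, ..., v_n are linearly independent, and it reads off coordinates in this basis.\<close>

definition yhom :: "'s \<Rightarrow> 's env" where
  "yhom f = free_eval sE yvec (SOME F. free_eval sS \<iota> F = f)"

lemma yhom_eval: "yhom (free_eval sS \<iota> F) = free_eval sE yvec F"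
proof -
  define G where "G = (SOME G. free_eval sS \<iota> G = free_eval sS \<iota> F)"
  have "free_eval sS \<iota> G = free_eval sS \<iota> F"
    unfolding G_def by (rule someI[of _ F]) simp
  then have "free_eval sS \<iota> (G - F) = 0" by (simp add: S.free_eval_diff)
  then have "free_eval sE yvec (G - F) = 0"
    using relations by (intro Y.free_eval_relations) blast
  then show ?thesis by (simp add: yhom_def G_def Y.free_eval_diff)
qed

lemma evalE: obtains F where "f = free_eval sS \<iota> F"
  using generated by (metis rangeE UNIV_I)

lemma yhom_add: "yhom (f + g) = yhom f + yhom g"
proof -
  obtain F G where "f = free_eval sS \<iota> F" "g = free_eval sS \<iota> G" by (metis evalE)
  then show ?thesis by (simp add: yhom_eval Y.free_eval_add flip: S.free_eval_add)
qed

lemma yhom_mult: "yhom (f * g) = yhom f * yhom g"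
proof -
  obtain F G where "f = free_eval sS \<iota> F" "g = free_eval sS \<iota> G" by (metis evalE)
  then show ?thesis by (simp add: yhom_eval Y.free_eval_mult flip: S.free_eval_mult)
qed

lemma yhom_1: "yhom 1 = 1"
  using yhom_eval[of 1] by (simp add: S.free_eval_1 Y.free_eval_1)

lemma yhom_sc: "yhom (sc c) = lft (sc c)"
  using yhom_eval[of "Poly_Mapping.single {#} c"]
  by (simp add: S.free_eval_single Y.free_eval_single) (simp add: sE_def)

lemma yhom_scale: "yhom (sS c f) = lft (sc c) * yhom f"
  by (subst scale_sc) (simp add: yhom_mult yhom_sc)

lemma yhom_vec: "yhom (\<iota> w) = yvec w"
  using yhom_eval[of "Poly_Mapping.single {#w#} 1"]
  by (simp add: S.free_eval_single Y.free_eval_single)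

lemma yvec_basis: "i \<in> {1..n} \<Longrightarrow> yvec (v i) = yvar i"
proof -
  assume i: "i \<in> {1..n}"
  have "yvec (v i) = (\<Sum>j=1..n. if j = i then yvar i else 0)"
    unfolding yvec_def by (rule sum.cong) (use i in \<open>auto simp: coord_basis sE_def\<close>)
  then show ?thesis using i by simp
qed

lemma yhom_power: "yhom (f ^ k) = yhom f ^ k"
  by (induction k) (simp_all add: yhom_1 yhom_mult)

lemma yhom_prod: "yhom (prod f I) = (\<Prod>i\<in>I. yhom (f i))"
  by (induction I rule: infinite_finite_induct) (simp_all add: yhom_1 yhom_mult)

abbreviation mon :: "(nat \<Rightarrow> nat) \<Rightarrow> 's" where "mon l \<equiv> vmonom \<iota> v n l"

lemma mon_add: "mon (\<lambda>i. l i + m i) = mon l * mon m"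
  by (simp add: vmonom_def power_add prod.distrib)

lemma mon_0: "mon (\<lambda>_. 0) = 1"
  by (simp add: vmonom_def)

lemma mon_cong: "(\<And>i. i \<in> {1..n} \<Longrightarrow> l i = m i) \<Longrightarrow> mon l = mon m"
  by (simp add: vmonom_def)

lemma mon_unit: "i \<in> {1..n} \<Longrightarrow> mon (\<lambda>j. if j = i then 1 else 0) = \<iota> (v i)"
proof -
  assume i: "i \<in> {1..n}"
  have "mon (\<lambda>j. if j = i then 1 else 0) = (\<Prod>j=1..n. if j = i then \<iota> (v i) else 1)"
    unfolding vmonom_def by (rule prod.cong) auto
  then show ?thesis using i by simp
qed

lemma yvar_power: "(yvar i :: 's env) ^ k = Poly_Mapping.single (Poly_Mapping.single i k) 1"
proof (induction k)
  case (Suc k)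
  have "Poly_Mapping.single i (Suc k) = Poly_Mapping.single i 1 + Poly_Mapping.single i k"
    by (simp only: single_add[symmetric] plus_1_eq_Suc)
  then show ?case by (simp add: Suc mult_single)
qed simp

lemma prod_single: "finite I \<Longrightarrow>
  (\<Prod>i\<in>I. Poly_Mapping.single (f i) (1::'s)) = Poly_Mapping.single (\<Sum>i\<in>I. f i :: nat \<Rightarrow>\<^sub>0 nat) 1"
  by (induction I rule: finite_induct) (simp_all add: mult_single)

definition restr :: "(nat \<Rightarrow> nat) \<Rightarrow> nat \<Rightarrow>\<^sub>0 nat" where
  "restr l = (\<Sum>i=1..n. Poly_Mapping.single i (l i))"

lemma lookup_restr: "Poly_Mapping.lookup (restr l) i = (if i \<in> {1..n} then l i else 0)"
proof -
  have "Poly_Mapping.lookup (restr l) i = (\<Sum>j=1..n. if j = i then l i else 0)"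
    unfolding restr_def lookup_sum by (rule sum.cong) (auto simp: lookup_single)
  then show ?thesis by simp
qed

lemma yhom_mon: "yhom (mon l) = (\<Prod>i=1..n. yvar i ^ l i)"
  unfolding vmonom_def yhom_prod
  by (rule prod.cong) (simp_all add: yhom_power yhom_vec yvec_basis)

lemma yhom_mon_single: "yhom (mon l) = Poly_Mapping.single (restr l) 1"
  unfolding yhom_mon yvar_power by (simp add: prod_single restr_def)

text \<open>Products of linear forms expand into monomials in the basis, so the monomials span.\<close>

lemma span_mon: "vs2.span (range mon) = UNIV"
proof -
  let ?M = "vs2.span (range mon)"
  have mult: "\<iota> w * f \<in> ?M" if "f \<in> ?M" for w f
  proof -
    have b: "\<iota> (v i) * f \<in> ?M" if "i \<in> {1..n}" "f \<in> ?M" for i f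
      using that(2)
    proof (induction rule: vs2.span_induct_alt)
      case (step c x y)
      then obtain l where "x = mon l" by blast
      have "\<iota> (v i) * mon l = mon (\<lambda>j. (if j = i then 1 else 0) + l j)"
        using mon_unit[OF that(1)] by (simp add: mon_add)
      then have "\<iota> (v i) * x \<in> ?M" using \<open>x = mon l\<close> by (auto intro: vs2.span_base)
      moreover have "\<iota> (v i) * sS c x = sS c (\<iota> (v i) * x)"
        by (metis scale_mult mult.commute)
      ultimately show ?case
        using step by (simp add: distrib_left vs2.span_add vs2.span_scale)
    qed (simp add: vs2.span_zero)
    have "w \<in> vs1.span (v ` {1..n})" using span by simp
    then show ?thesis
    proof (induction rule: vs1.span_induct_alt)
      case (step c x y)
      then show ?case
        using b that by (auto simp: add scale distrib_right scale_mult[symmetric] intro!: vs2.span_add vs2.span_scale)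
    qed (simp add: zero vs2.span_zero)
  qed
  have prodm: "(\<Prod>w\<in>#m. \<iota> w) \<in> ?M" for m
  proof (induction m)
    case empty
    show ?case using mon_0 by (auto intro!: vs2.span_base)
  qed (simp add: mult)
  have "free_eval sS \<iota> F \<in> ?M" for F
    by (induction F rule: poly_mapping_add_induct)
       (simp_all add: S.free_eval_single S.free_eval_add vs2.span_add vs2.span_scale vs2.span_zero prodm)
  then show ?thesis by (metis evalE UNIV_eq_I)
qed

lemma mon_induct [case_names mon add scale]:
  assumes "\<And>l. P (mon l)" "\<And>x y. P x \<Longrightarrow> P y \<Longrightarrow> P (x + y)" "\<And>c x. P x \<Longrightarrow> P (sS c x)"
  shows "P f"
proof -
  have "f \<in> vs2.span (range mon)" by (simp add: span_mon)
  then show ?thesis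
  proof (induction rule: vs2.span_induct_alt)
    case base
    show ?case using assms(3)[OF assms(1), of 0] by simp
  qed (auto intro: assms)
qed

section \<open>Difference quotients\<close>

abbreviation xvar :: "nat \<Rightarrow> 's env" where "xvar i \<equiv> lft (\<iota> (v i))"

text \<open>The linear map on S with value \<open>G l\<close> at the monomial with exponents \<open>l\<close>, provided that \<open>G\<close> depends
  only on the exponents of v_1, ..., v_n.\<close>

definition lin_ext :: "((nat \<Rightarrow> nat) \<Rightarrow> 's env) \<Rightarrow> 's \<Rightarrow> 's env" where
  "lin_ext G f = (\<Sum>m\<in>Poly_Mapping.keys (yhom f).
     lft (Poly_Mapping.lookup (yhom f) m) * G (Poly_Mapping.lookup m))"

lemma lin_ext_add: "lin_ext G (f + g) = lin_ext G f + lin_ext G g"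
  unfolding lin_ext_def yhom_add
  by (rule keys_sum_add[where f = "\<lambda>m a. lft a * G (Poly_Mapping.lookup m)"])
     (simp_all add: single_add distrib_right)

lemma lin_ext_scale: "lin_ext G (sS c f) = lft (sc c) * lin_ext G f"
proof -
  define L where "L r = (\<Sum>m\<in>Poly_Mapping.keys r. lft (Poly_Mapping.lookup r m) * G (Poly_Mapping.lookup m))"
    for r :: "'s env"
  have add: "L (r + r') = L r + L r'" for r r'
    unfolding L_def by (rule keys_sum_add[where f = "\<lambda>m a. lft a * G (Poly_Mapping.lookup m)"])
      (simp_all add: single_add distrib_right)
  have Lsingle: "L (Poly_Mapping.single m a) = lft a * G (Poly_Mapping.lookup m)" for m a
    unfolding L_def by (rule keys_sum_single[where f = "\<lambda>m a. lft a * G (Poly_Mapping.lookup m)"]) simp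
  have "L (lft a * r) = lft a * L r" for a r
  proof (induction r rule: poly_mapping_add_induct)
    case zero
    show ?case by (simp add: L_def)
  next
    case (single m c)
    have "lft (a * c) = lft a * lft c" by (simp add: mult_single)
    moreover have "L (lft a * Poly_Mapping.single m c) = lft (a * c) * G (Poly_Mapping.lookup m)"
      by (simp add: mult_single Lsingle)
    ultimately show ?case by (simp only: Lsingle mult.assoc)
  qed (simp add: distrib_left add)
  then show ?thesis by (simp add: lin_ext_def L_def yhom_scale)
qed

lemma lin_ext_mon:
  assumes "\<And>m. (\<And>i. i \<in> {1..n} \<Longrightarrow> m i = l i) \<Longrightarrow> G m = G l"
  shows "lin_ext G (mon l) = G l"
proof -
  have "lin_ext G (mon l) = G (Poly_Mapping.lookup (restr l))"
    unfolding lin_ext_def yhom_mon_single by simp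
  also have "\<dots> = G l" by (rule assms) (simp add: lookup_restr)
  finally show ?thesis .
qed

text \<open>The substitution f(y_1, ..., y_i, x_{i+1}, ..., x_n) on monomials, and its difference quotient,
  written out so that no division is needed.\<close>

definition sub_mon :: "nat \<Rightarrow> (nat \<Rightarrow> nat) \<Rightarrow> 's env" where
  "sub_mon i m = (\<Prod>j\<in>{1..i}. yvar j ^ m j) * (\<Prod>j\<in>{i<..n}. xvar j ^ m j)"

definition dq_mon :: "nat \<Rightarrow> (nat \<Rightarrow> nat) \<Rightarrow> 's env" where
  "dq_mon i m = (\<Prod>j\<in>{1..<i}. yvar j ^ m j) * powdiff (xvar i) (yvar i) (m i) *
     (\<Prod>j\<in>{i<..n}. xvar j ^ m j)"

definition sub :: "nat \<Rightarrow> 's \<Rightarrow> 's env" where "sub i = lin_ext (sub_mon i)"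
definition dq :: "nat \<Rightarrow> 's \<Rightarrow> 's env" where "dq i = lin_ext (dq_mon i)"

lemma sub_mon: "i \<le> n \<Longrightarrow> sub i (mon l) = sub_mon i l"
  unfolding sub_def by (rule lin_ext_mon) (auto simp: sub_mon_def intro!: arg_cong2[where f = "(*)"] prod.cong)

lemma dq_mon: "i \<in> {1..n} \<Longrightarrow> dq i (mon l) = dq_mon i l"
  unfolding dq_def by (rule lin_ext_mon) (auto simp: dq_mon_def intro!: arg_cong2[where f = "(*)"] prod.cong)

lemma sub_add: "sub i (f + g) = sub i f + sub i g" and sub_scale: "sub i (sS c f) = lft (sc c) * sub i f"
  and dq_add: "dq i (f + g) = dq i f + dq i g" and dq_scale: "dq i (sS c f) = lft (sc c) * dq i f"
  by (simp_all add: sub_def dq_def lin_ext_add lin_ext_scale)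

lemma lft_mon: "lft (mon l) = (\<Prod>i=1..n. xvar i ^ l i)"
proof -
  have p: "lft (a ^ k) = lft a ^ k" for a :: 's and k
    by (induction k) (simp_all add: lft_mult)
  have "lft (prod f I) = (\<Prod>i\<in>I. lft (f i))" for f :: "nat \<Rightarrow> 's" and I
    by (induction I rule: infinite_finite_induct) (simp_all add: lft_mult)
  then show ?thesis by (simp add: vmonom_def p)
qed

lemma sub_first: "sub 0 f = lft f"
proof (induction f rule: mon_induct)
  case (mon l)
  have "{0<..n} = {1..n}" by auto
  then show ?case by (simp add: sub_mon sub_mon_def lft_mon)
next
  case (scale c x)
  then show ?case by (subst (2) scale_sc) (simp add: sub_scale mult_single)
qed (simp add: sub_add single_add)

lemma sub_last: "sub n f = yhom f"
proof (induction f rule: mon_induct)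
  case (mon l)
  then show ?case by (simp add: sub_mon sub_mon_def yhom_mon)
qed (simp_all add: sub_add sub_scale yhom_add yhom_scale)

lemma dq_telescope:
  assumes "i \<in> {1..n}"
  shows "(xvar i - yvar i) * dq i f = sub (i - 1) f - sub i f"
proof (induction f rule: mon_induct)
  case (mon l)
  have s: "{1..i} = insert i {1..i - 1}" "{1..<i} = {1..i - 1}" "{i - 1<..n} = insert i {i<..n}"
    using assms by auto
  define A where "A = (\<Prod>j\<in>{1..i - 1}. yvar j ^ l j :: 's env)"
  define B where "B = (\<Prod>j\<in>{i<..n}. xvar j ^ l j)"
  have sp: "sub_mon i l = yvar i ^ l i * A * B"
  proof -
    have "i \<notin> {1..i - 1}" using assms by auto
    then show ?thesis unfolding sub_mon_def s(1) A_def B_def by (subst prod.insert) auto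
  qed
  have sm: "sub_mon (i - 1) l = A * (xvar i ^ l i * B)"
    unfolding sub_mon_def s(3) A_def B_def by (subst prod.insert) auto
  have d: "dq_mon i l = A * powdiff (xvar i) (yvar i) (l i) * B"
    unfolding dq_mon_def s(2) A_def B_def ..
  have "(xvar i - yvar i) * dq_mon i l = A * ((xvar i - yvar i) * powdiff (xvar i) (yvar i) (l i)) * B"
    unfolding d by (simp only: ac_simps)
  also have "\<dots> = sub_mon (i - 1) l - sub_mon i l"
    unfolding powdiff_mult sp sm by (simp add: algebra_simps)
  finally show ?case using assms sub_mon[OF le_trans[OF diff_le_self], of i 1 l] by (simp add: dq_mon sub_mon)
qed (simp_all add: dq_add dq_scale sub_add sub_scale distrib_left mult.left_commute right_diff_distrib)

text \<open>Twisted Leibniz rule: as a difference of two homomorphisms, divided by x_i - y_i, \<open>dq i\<close> is a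
  derivation that acts on \<open>f\<close> and \<open>g\<close> on different sides.\<close>

lemma dq_mult:
  assumes "i \<in> {1..n}"
  shows "dq i (f * g) = dq i f * sub i g + sub (i - 1) f * dq i g"
proof (induction f rule: mon_induct)
  case (mon l)
  show ?case
  proof (induction g rule: mon_induct)
    case (mon m)
    have s: "{1..i} = insert i {1..i - 1}" "{1..<i} = {1..i - 1}" "{i - 1<..n} = insert i {i<..n}"
      using assms by auto
    define A where "A l = (\<Prod>j\<in>{1..i - 1}. yvar j ^ l j :: 's env)" for l
    define B where "B l = (\<Prod>j\<in>{i<..n}. xvar j ^ l j)" for l
    have A: "A (\<lambda>i. l i + m i) = A l * A m" and B: "B (\<lambda>i. l i + m i) = B l * B m"
      by (simp_all add: A_def B_def power_add prod.distrib)
    have sp: "sub_mon i m = yvar i ^ m i * A m * B m"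
    proof -
      have "i \<notin> {1..i - 1}" using assms by auto
      then show ?thesis unfolding sub_mon_def s(1) A_def B_def by (subst prod.insert) auto
    qed
    have sm: "sub_mon (i - 1) l = A l * (xvar i ^ l i * B l)"
      unfolding sub_mon_def s(3) A_def B_def by (subst prod.insert) auto
    have d: "dq_mon i l = A l * powdiff (xvar i) (yvar i) (l i) * B l" for l
      unfolding dq_mon_def s(2) A_def B_def ..
    have "dq_mon i (\<lambda>i. l i + m i) = dq_mon i l * sub_mon i m + sub_mon (i - 1) l * dq_mon i m"
      unfolding d sp sm A B powdiff_add by (simp add: algebra_simps)
    then show ?case using assms sub_mon[OF le_trans[OF diff_le_self], of i 1 l] by (simp add: dq_mon sub_mon flip: mon_add)
  next
    case (scale c x)
    have "mon l * sS c x = sS c (mon l * x)" by (metis scale_mult mult.commute)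
    then show ?case using scale by (simp add: dq_scale sub_scale algebra_simps)
  qed (simp add: dq_add sub_add algebra_simps)
next
  case (scale c x)
  have "dq i (sS c x * g) = lft (sc c) * dq i (x * g)"
    by (simp only: scale_mult[symmetric] dq_scale)
  then show ?case unfolding scale by (simp add: dq_scale sub_scale algebra_simps)
qed (simp add: dq_add sub_add algebra_simps)

lemma dq_one: "i \<in> {1..n} \<Longrightarrow> dq i 1 = 0"
  using dq_mon[of i "\<lambda>_. 0"] by (simp add: mon_0 dq_mon_def)

lemma dq_var:
  assumes "i \<in> {1..n}" "j \<in> {1..n}"
  shows "dq j (\<iota> (v i)) = (if j = i then 1 else 0)"
proof -
  let ?m = "\<lambda>j. if j = i then 1 else 0 :: nat"
  have "dq j (\<iota> (v i)) = dq_mon j ?m"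
    using dq_mon[OF assms(2), of ?m] by (simp add: mon_unit[OF assms(1)])
  moreover have "dq_mon i ?m = 1"
    unfolding dq_mon_def by (simp add: prod.neutral)
  ultimately show ?thesis by (auto simp: dq_mon_def)
qed

section \<open>Restriction to the diagonal\<close>

text \<open>The multiplication map S^e \<rightarrow> S, which sets y_i = x_i.\<close>

definition diag :: "'s env \<Rightarrow> 's" where
  "diag r = (\<Sum>m\<in>Poly_Mapping.keys r. Poly_Mapping.lookup r m * mon (Poly_Mapping.lookup m))"

lemma diag_add: "diag (r + s) = diag r + diag s"
  unfolding diag_def
  by (rule keys_sum_add[where f = "\<lambda>m a. a * mon (Poly_Mapping.lookup m)"]) (simp_all add: distrib_right)

lemma diag_single: "diag (Poly_Mapping.single m a) = a * mon (Poly_Mapping.lookup m)"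
  unfolding diag_def by (rule keys_sum_single[where f = "\<lambda>m a. a * mon (Poly_Mapping.lookup m)"]) simp

lemma diag_lft: "diag (lft a) = a"
  using mon_0 by (simp add: diag_single lookup_zero[abs_def])

lemma diag_1: "diag 1 = 1"
  using diag_lft[of 1] by simp

lemma diag_0 [simp]: "diag 0 = 0"
  by (simp add: diag_def)

lemma diag_mult: "diag (r * s) = diag r * diag s"
proof (induction r rule: poly_mapping_add_induct)
  case (single m a)
  show ?case
  proof (induction s rule: poly_mapping_add_induct)
    case (single k b)
    have "mon (Poly_Mapping.lookup (m + k)) = mon (Poly_Mapping.lookup m) * mon (Poly_Mapping.lookup k)"
      by (simp add: lookup_add[abs_def] flip: mon_add)
    then show ?case by (simp add: mult_single diag_single ac_simps)
  qed (simp_all add: diag_add distrib_left)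
qed (simp_all add: diag_add distrib_right)

lemma diag_power: "diag (r ^ k) = diag r ^ k"
  by (induction k) (simp_all add: diag_1 diag_mult)

lemma diag_prod: "diag (prod f I) = (\<Prod>i\<in>I. diag (f i))"
  by (induction I rule: infinite_finite_induct) (simp_all add: diag_1 diag_mult)

lemma diag_yvar: "i \<in> {1..n} \<Longrightarrow> diag (yvar i) = \<iota> (v i)"
proof -
  assume i: "i \<in> {1..n}"
  have "Poly_Mapping.lookup (Poly_Mapping.single i 1) = (\<lambda>j. if j = i then 1 else 0 :: nat)"
    by (auto simp: lookup_single)
  then show ?thesis using mon_unit[OF i] by (simp add: diag_single)
qed

lemma diag_powdiff: "diag (powdiff r s a) = powdiff (diag r) (diag s) a"
  by (induction a) (simp_all add: diag_add diag_mult diag_power)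

lemma diag_dq_mon:
  assumes "i \<in> {1..n}"
  shows "diag (dq i (mon l)) = of_nat (l i) * mon (l(i := l i - 1))"
proof -
  have "diag (dq i (mon l)) = (\<Prod>j\<in>{1..<i}. \<iota> (v j) ^ l j) *
      (of_nat (l i) * \<iota> (v i) ^ (l i - 1)) * (\<Prod>j\<in>{i<..n}. \<iota> (v j) ^ l j)"
    using assms
    by (auto simp: dq_mon dq_mon_def diag_mult diag_prod diag_power diag_yvar diag_lft diag_powdiff
        powdiff_diag intro!: arg_cong2[where f = "(*)"] prod.cong)
  also have "\<dots> = of_nat (l i) * mon (l(i := l i - 1))"
  proof -
    have s: "{1..n} = insert i ({1..<i} \<union> {i<..n})" using assms by auto
    have "mon (l(i := l i - 1)) = \<iota> (v i) ^ (l i - 1) *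
        ((\<Prod>j\<in>{1..<i}. \<iota> (v j) ^ l j) * (\<Prod>j\<in>{i<..n}. \<iota> (v j) ^ l j))"
      unfolding vmonom_def s
      by (subst prod.insert, simp, simp, subst prod.union_disjoint)
         (auto intro!: arg_cong2[where f = "(*)"] prod.cong)
    then show ?thesis by (simp add: ac_simps)
  qed
  finally show ?thesis .
qed

text \<open>On the diagonal, x^(a-1) + x^(a-2) y + ... + y^(a-1) becomes a x^(a-1). The derivative is the only
  linear map with these values because the monomials span.\<close>

lemma pdiff_eq:
  assumes i: "i \<in> {1..n}"
  shows "pdiff sS \<iota> v n i f = diag (dq i f)"
proof -
  let ?P = "\<lambda>D. Vector_Spaces.linear sS sS D \<and>
             (\<forall>l. D (mon l) = of_nat (l i) * mon (l(i := l i - 1)))"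
  have P: "?P (\<lambda>f. diag (dq i f))"
  proof
    show "Vector_Spaces.linear sS sS (\<lambda>f. diag (dq i f))"
      by unfold_locales (simp_all add: dq_add diag_add dq_scale diag_mult diag_lft flip: scale_sc)
    show "\<forall>l. diag (dq i (mon l)) = of_nat (l i) * mon (l(i := l i - 1))"
      using diag_dq_mon[OF i] by blast
  qed
  have "D = (\<lambda>f. diag (dq i f))" if D: "?P D" for D
  proof
    interpret D: Vector_Spaces.linear sS sS D using D by simp
    interpret E: Vector_Spaces.linear sS sS "\<lambda>f. diag (dq i f)" using P by simp
    fix f show "D f = diag (dq i f)"
    proof (induction f rule: mon_induct)
      case (mon l)
      then show ?case using D P by simp
    qed (simp_all add: D.add D.scale E.add E.scale)
  qed
  then have "pdiff sS \<iota> v n i = (\<lambda>f. diag (dq i f))"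
    unfolding pdiff_def by (intro the_equality P) blast
  then show ?thesis by simp
qed

end


section \<open>The bar complex in all degrees\<close>

context sym_basis
begin

text \<open>The empty list, which is no tensor, is killed so that the operators below can take the value 0 on it.\<close>

definition bar_rels :: "('s list \<Rightarrow>\<^sub>0 int) set" where
  "bar_rels = {frag_of []} \<union> (\<Union>q. tpow_rels sS q)"

abbreviation eqB (infix \<open>\<approx>B\<close> 50) where "u \<approx>B w \<equiv> eqm bar_rels u w"

lemma B_add: "frag_of (A @ (x + y) # C) \<approx>B frag_of (A @ x # C) + frag_of (A @ y # C)"
proof (rule eqm_base)
  have "frag_of ((A @ x # C)[length A := x + y]) - frag_of ((A @ x # C)[length A := x]) -
      frag_of ((A @ x # C)[length A := y]) \<in> tpow_rels sS (length (A @ x # C))"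
    unfolding tpow_rels_def
    by (rule UnI1, rule CollectI, (rule exI)+, rule conjI, rule refl) simp
  then show "frag_of (A @ (x + y) # C) - (frag_of (A @ x # C) + frag_of (A @ y # C)) \<in> bar_rels"
    by (auto simp: bar_rels_def diff_diff_eq)
qed

lemma B_nil: "frag_of [] \<approx>B 0"
  by (rule eqm_base) (simp add: bar_rels_def)

lemma B_move:
  assumes "i < length xs" "j < length xs"
  shows "frag_of (xs[i := sS c (xs ! i)]) \<approx>B frag_of (xs[j := sS c (xs ! j)])"
proof (rule eqm_base)
  have "frag_of (xs[i := sS c (xs ! i)]) - frag_of (xs[j := sS c (xs ! j)]) \<in> tpow_rels sS (length xs)"
    unfolding tpow_rels_def using assms by blast
  then show "frag_of (xs[i := sS c (xs ! i)]) - frag_of (xs[j := sS c (xs ! j)]) \<in> bar_rels"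
    by (auto simp: bar_rels_def)
qed

lemma resp_tpow:
  assumes add: "\<And>A x y C. length (A @ x # C) = q \<Longrightarrow>
      eqm N (g (A @ (x + y) # C)) (g (A @ x # C) + g (A @ y # C))"
    and scl: "\<And>A x C c. length (A @ x # C) = q \<Longrightarrow> eqm N (g (A @ sS c x # C)) (scl c (g (A @ x # C)))"
  shows "resp (tpow_rels sS q) N g"
  unfolding resp_def
proof
  fix r assume "r \<in> tpow_rels sS q"
  then consider
      (1) xs i x y where "length xs = q" "i < q"
      "r = frag_of (xs[i := x + y]) - frag_of (xs[i := x]) - frag_of (xs[i := y])"
    | (2) xs i j c where "length xs = q" "i < q" "j < q"
      "r = frag_of (xs[i := sS c (xs ! i)]) - frag_of (xs[j := sS c (xs ! j)])"
    unfolding tpow_rels_def by blast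
  then show "eqm N (frag_extend g r) 0"
  proof cases
    case 1
    then show ?thesis
      using add[of "take i xs" x "drop (Suc i) xs" y]
      by (simp add: upd_conv_take_nth_drop frag_extend_diff frag_extend_add diff_diff_eq eqm_diff_zero)
  next
    case 2
    have "eqm N (g (xs[k := sS c (xs ! k)])) (scl c (g xs))" if "k < q" for k
      using scl[of "take k xs" "xs ! k" "drop (Suc k) xs" c] that 2(1)
      by (simp add: upd_conv_take_nth_drop id_take_nth_drop[symmetric])
    from this[OF 2(2)] this[OF 2(3)] have "eqm N (g (xs[i := sS c (xs ! i)])) (g (xs[j := sS c (xs ! j)]))"
      by (blast intro: eqm_trans eqm_sym)
    then show ?thesis by (simp add: 2 frag_extend_diff eqm_diff_zero)
  qed
qed

text \<open>Since a scalar may sit in any slot, it suffices that \<open>g\<close> turns a scalar in any slot into one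
  and the same operator \<open>scl c\<close>.\<close>

lemma resp_bar:
  assumes nil: "eqm N (g []) 0"
    and add: "\<And>A x y C. eqm N (g (A @ (x + y) # C)) (g (A @ x # C) + g (A @ y # C))"
    and scl: "\<And>A x C c. eqm N (g (A @ sS c x # C)) (scl c (g (A @ x # C)))"
  shows "resp bar_rels N g"
  using nil resp_tpow[of _ N g scl, OF add scl] by (auto simp: resp_def bar_rels_def)

text \<open>The operators \<open>aL\<close> and \<open>aR\<close> are the actions of S on the outer factors, \<open>cn x\<close> is x \<otimes> -, and
  \<open>bd\<close> is the bar differential in recursive form. By \<open>bd_cn\<close>, \<open>cn 1\<close> contracts the bar resolution. Suffix g
  marks the values on generators.\<close>

definition aLg :: "'s \<Rightarrow> 's list \<Rightarrow> 's list \<Rightarrow>\<^sub>0 int" where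
  "aLg a xs = (case xs of [] \<Rightarrow> 0 | x # r \<Rightarrow> frag_of ((a * x) # r))"

definition aRg :: "'s \<Rightarrow> 's list \<Rightarrow> 's list \<Rightarrow>\<^sub>0 int" where
  "aRg b xs = (if xs = [] then 0 else frag_of (butlast xs @ [last xs * b]))"

definition cng :: "'s \<Rightarrow> 's list \<Rightarrow> 's list \<Rightarrow>\<^sub>0 int" where
  "cng x xs = (if xs = [] then 0 else frag_of (x # xs))"

abbreviation "aL a \<equiv> frag_extend (aLg a)"
abbreviation "aR b \<equiv> frag_extend (aRg b)"
abbreviation "cn x \<equiv> frag_extend (cng x)"

fun bdg :: "'s list \<Rightarrow> 's list \<Rightarrow>\<^sub>0 int" where
  "bdg [] = 0"
| "bdg [x] = 0"
| "bdg (x # y # r) = frag_of ((x * y) # r) - cn x (bdg (y # r))"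

abbreviation "bd \<equiv> frag_extend bdg"

lemmas frag_lin = frag_extend_add frag_extend_diff frag_extend_minus

lemma gen_simps [simp]: "aLg a [] = 0" "aRg a [] = 0" "cng a [] = 0"
  "aLg a (x # r) = frag_of ((a * x) # r)" "aRg b (r @ [y]) = frag_of (r @ [y * b])"
  "aRg b [y] = frag_of [y * b]" "aRg b (x # y # r) = cn x (aRg b (y # r))"
  "cng a (x # r) = frag_of (a # x # r)"
  by (simp_all add: aLg_def aRg_def cng_def)

lemma aL_aL: "aL a (aL b u) = aL (a * b) u"
proof (induction u rule: frag_induct)
  case (one xs)
  show ?case by (cases xs) (simp_all add: mult.assoc)
qed (simp_all add: frag_lin)

lemma aL_cn: "aL a (cn x u) = cn (a * x) u"
proof (induction u rule: frag_induct)
  case (one xs)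
  show ?case by (cases xs) simp_all
qed (simp_all add: frag_lin)

lemma aR_cn: "aR b (cn x u) = cn x (aR b u)"
proof (induction u rule: frag_induct)
  case (one xs)
  show ?case by (cases xs) simp_all
qed (simp_all add: frag_lin)

lemma frag_Cons: "r \<noteq> [] \<Longrightarrow> frag_of (x # r) = cn x (frag_of r)"
  by (cases r) simp_all

lemma list_ops_induct:
  assumes "P []" "\<And>x. P [x]" "\<And>x r. r \<noteq> [] \<Longrightarrow> P r \<Longrightarrow> P (x # r)"
  shows "P xs"
proof (induction xs)
  case (Cons x r)
  then show ?case using assms by (cases "r = []") auto
qed (rule assms)

lemma aR_aR: "aR a (aR b u) = aR (a * b) u"
proof (induction u rule: frag_induct)
  case (one xs)
  show ?case
  proof (induction xs rule: list_ops_induct)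
    case (3 x r)
    then show ?case by (simp add: frag_Cons aR_cn del: frag_extend_of)
  qed (simp_all add: ac_simps)
qed (simp_all add: frag_lin)

lemma aL_aR: "aL a (aR b u) = aR b (aL a u)"
proof (induction u rule: frag_induct)
  case (one xs)
  show ?case
  proof (induction xs rule: list_ops_induct)
    case (3 x r)
    then show ?case by (simp add: frag_Cons aR_cn aL_cn del: frag_extend_of)
  qed (simp_all add: ac_simps)
qed (simp_all add: frag_lin)

lemma bd_cn: "bd (cn x u) = aL x u - cn x (bd u)"
proof (induction u rule: frag_induct)
  case (one xs)
  show ?case by (cases xs) simp_all
qed (simp_all add: frag_lin)

lemma bd_aL: "bd (aL a u) = aL a (bd u)"
proof (induction u rule: frag_induct)
  case (one xs)
  show ?case by (induction xs rule: list_ops_induct)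
    (simp_all add: frag_Cons aL_cn bd_cn aL_aL frag_lin del: frag_extend_of, simp_all)
qed (simp_all add: frag_lin)

lemma bd_aR: "bd (aR b u) = aR b (bd u)"
proof (induction u rule: frag_induct)
  case (one xs)
  show ?case by (induction xs rule: list_ops_induct)
    (simp_all add: frag_Cons aR_cn bd_cn aL_aR frag_lin del: frag_extend_of, simp_all)
qed (simp_all add: frag_lin)

lemma bd_bd: "bd (bd u) = 0"
proof (induction u rule: frag_induct)
  case (one xs)
  show ?case by (induction xs rule: list_ops_induct)
    (simp_all add: frag_Cons bd_aL bd_cn frag_lin del: frag_extend_of, simp_all)
qed (simp_all add: frag_lin)

lemma B_scale: "frag_of (A @ sS c x # C) \<approx>B aL (sc c) (frag_of (A @ x # C))"
proof (cases A)
  case Nil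
  then show ?thesis by (simp flip: scale_sc)
next
  case (Cons a A')
  then show ?thesis
    using B_move[of "length A" "A @ x # C" 0 c] by (simp flip: scale_sc)
qed

lemma resp_cn: "resp bar_rels bar_rels (cng z)"
proof (rule resp_bar[where scl = "\<lambda>c. aL (sc c)"])
  fix A C x y c
  show "cng z (A @ (x + y) # C) \<approx>B cng z (A @ x # C) + cng z (A @ y # C)"
    using B_add[of "z # A" x y C] by (simp add: cng_def)
  show "cng z (A @ sS c x # C) \<approx>B aL (sc c) (cng z (A @ x # C))"
    using B_scale[of "z # A" c x C] by (simp add: cng_def)
qed simp

lemma resp_aL: "resp bar_rels bar_rels (aLg a)"
proof (rule resp_bar[where scl = "\<lambda>c. aL (sc c)"])
  fix A C x y c
  show "aLg a (A @ (x + y) # C) \<approx>B aLg a (A @ x # C) + aLg a (A @ y # C)"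
    using B_add[of "[]" "a * x" "a * y" C] B_add[of "(a * hd A) # tl A" x y C]
    by (cases A) (simp_all add: distrib_left)
  show "aLg a (A @ sS c x # C) \<approx>B aL (sc c) (aLg a (A @ x # C))"
  proof (cases A)
    case Nil
    have "a * sS c x = sc c * (a * x)" by (simp add: scale_sc[of c x] ac_simps)
    then show ?thesis using Nil by simp
  next
    case (Cons b A')
    then show ?thesis using B_scale[of "(a * b) # A'" c x C] by simp
  qed
qed simp

lemma resp_aR: "resp bar_rels bar_rels (aRg b)"
proof (rule resp_bar[where scl = "\<lambda>c. aL (sc c)"])
  fix A C x y c
  show "aRg b (A @ (x + y) # C) \<approx>B aRg b (A @ x # C) + aRg b (A @ y # C)"
    using B_add[of A "x * b" "y * b" "[]"] B_add[of A x y "butlast C @ [last C * b]"]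
    by (cases "C = []") (simp_all add: aRg_def butlast_append distrib_right)
  show "aRg b (A @ sS c x # C) \<approx>B aL (sc c) (aRg b (A @ x # C))"
  proof (cases "C = []")
    case True
    have "sS c x * b = sS c (x * b)" by (simp add: scale_mult)
    then show ?thesis using True B_scale[of A c "x * b" "[]"] by (simp add: aRg_def butlast_append)
  next
    case False
    then show ?thesis using B_scale[of A c x "butlast C @ [last C * b]"]
      by (simp add: aRg_def butlast_append)
  qed
qed simp

lemmas aL_cong = resp_eqm[OF resp_aL] and aR_cong = resp_eqm[OF resp_aR] and cn_cong = resp_eqm[OF resp_cn]

lemma aL_param: "aL (a + a') u \<approx>B aL a u + aL a' u"
proof -
  have "aLg (a + a') xs \<approx>B aLg a xs + aLg a' xs" for xs
    using B_add[of "[]" "a * hd xs" "a' * hd xs" "tl xs"] by (cases xs) (simp_all add: distrib_right)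
  then show ?thesis unfolding frag_extend_add_fun[symmetric] by (rule frag_extend_eqm)
qed

lemma aR_param: "aR (a + a') u \<approx>B aR a u + aR a' u"
proof -
  have "aRg (a + a') xs \<approx>B aRg a xs + aRg a' xs" for xs
    using B_add[of "butlast xs" "last xs * a" "last xs * a'" "[]"]
    by (cases "xs = []") (simp_all add: aRg_def distrib_left)
  then show ?thesis unfolding frag_extend_add_fun[symmetric] by (rule frag_extend_eqm)
qed

lemma cn_param: "cn (a + a') u \<approx>B cn a u + cn a' u"
proof -
  have "cng (a + a') xs \<approx>B cng a xs + cng a' xs" for xs
    using B_add[of "[]" a a' xs] by (cases xs) simp_all
  then show ?thesis unfolding frag_extend_add_fun[symmetric] by (rule frag_extend_eqm)
qed

lemma aR_sc: "aR (sc c) u \<approx>B aL (sc c) u"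
proof -
  have "aRg (sc c) xs \<approx>B aLg (sc c) xs" for xs
  proof (cases xs rule: rev_cases)
    case (snoc ys x)
    have "x * sc c = sS c x" by (simp add: scale_sc[of c x] mult.commute)
    then show ?thesis using snoc B_scale[of ys c x "[]"] by simp
  qed simp
  then show ?thesis by (rule frag_extend_eqm)
qed

lemma cn_aL_sc: "cn x (aL (sc c) u) \<approx>B aL (sc c) (cn x u)"
proof -
  have "frag_extend (cng x) (aLg (sc c) xs) \<approx>B aL (sc c) (cng x xs)" for xs
  proof (cases xs)
    case (Cons y r)
    then show ?thesis using B_scale[of "[x]" c y r] by (simp flip: scale_sc[of c y])
  qed simp
  then show ?thesis unfolding frag_extend_extend by (rule frag_extend_eqm)
qed

lemma aL_1: "aL 1 u \<approx>B u" and aR_1: "aR 1 u \<approx>B u"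
proof -
  have "aLg 1 xs \<approx>B frag_of xs" for xs
    using eqm_sym[OF B_nil] by (cases xs) simp_all
  then have "aL 1 u \<approx>B frag_extend frag_of u" by (rule frag_extend_eqm)
  then show "aL 1 u \<approx>B u" by simp
  have "aRg 1 xs \<approx>B frag_of xs" for xs
    using eqm_sym[OF B_nil] by (cases xs rule: rev_cases) simp_all
  then have "aR 1 u \<approx>B frag_extend frag_of u" by (rule frag_extend_eqm)
  then show "aR 1 u \<approx>B u" by simp
qed

lemma bdg_Cons: "bdg (x # r) = (if r = [] then 0 else aL x (frag_of r) - cn x (bdg r))"
  by (cases r) simp_all

lemma resp_bd: "resp bar_rels bar_rels bdg"
proof (rule resp_bar[where scl = "\<lambda>c. aL (sc c)"])
  fix A C x y c
  show "bdg (A @ (x + y) # C) \<approx>B bdg (A @ x # C) + bdg (A @ y # C)"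
  proof (induction A)
    case Nil
    have "aL (x + y) (frag_of C) - cn (x + y) (bdg C) \<approx>B
      (aL x (frag_of C) + aL y (frag_of C)) - (cn x (bdg C) + cn y (bdg C))"
      by (intro eqm_diff aL_param cn_param)
    then show ?case by (simp add: bdg_Cons algebra_simps del: frag_extend_of)
  next
    case (Cons a A)
    have "aL a (frag_of (A @ (x + y) # C)) \<approx>B aL a (frag_of (A @ x # C) + frag_of (A @ y # C))"
      by (intro aL_cong B_add)
    moreover have "cn a (bdg (A @ (x + y) # C)) \<approx>B cn a (bdg (A @ x # C) + bdg (A @ y # C))"
      by (intro cn_cong Cons)
    ultimately have "aL a (frag_of (A @ (x + y) # C)) - cn a (bdg (A @ (x + y) # C)) \<approx>B
      aL a (frag_of (A @ x # C) + frag_of (A @ y # C)) - cn a (bdg (A @ x # C) + bdg (A @ y # C))"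
      by (rule eqm_diff)
    then show ?case by (simp add: bdg_Cons frag_lin algebra_simps del: frag_extend_of)
  qed
  show "bdg (A @ sS c x # C) \<approx>B aL (sc c) (bdg (A @ x # C))"
  proof (induction A)
    case Nil
    show ?case by (simp add: bdg_Cons frag_lin aL_aL aL_cn del: frag_extend_of flip: scale_sc)
  next
    case (Cons a A)
    have "aL a (frag_of (A @ sS c x # C)) \<approx>B aL a (aL (sc c) (frag_of (A @ x # C)))"
      by (intro aL_cong B_scale)
    moreover have "cn a (bdg (A @ sS c x # C)) \<approx>B cn a (aL (sc c) (bdg (A @ x # C)))"
      by (intro cn_cong Cons)
    then have "cn a (bdg (A @ sS c x # C)) \<approx>B aL (sc c) (cn a (bdg (A @ x # C)))"
      using cn_aL_sc by (rule eqm_trans)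
    ultimately have "aL a (frag_of (A @ sS c x # C)) - cn a (bdg (A @ sS c x # C)) \<approx>B
      aL a (aL (sc c) (frag_of (A @ x # C))) - aL (sc c) (cn a (bdg (A @ x # C)))"
      by (rule eqm_diff)
    then show ?case by (simp add: bdg_Cons frag_lin aL_aL mult.commute del: frag_extend_of)
  qed
qed simp

section \<open>The Koszul complex in all degrees\<close>

text \<open>Generators without exactly two tensor factors are killed, so that only those of the form
  a \<otimes> b \<otimes> w_1 \<and> ... \<and> w_p matter.\<close>

definition kos_rels :: "('s list \<times> 'v list \<Rightarrow>\<^sub>0 int) set" where
  "kos_rels = {frag_of (xs, ws) | xs ws. length xs \<noteq> 2} \<union> (\<Union>p. tens_ext_rels sV sS 2 p)"

abbreviation eqK (infix \<open>\<approx>K\<close> 50) where "u \<approx>K w \<equiv> eqm kos_rels u w"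

lemma tens_ext_rels_kos_relsD: "r \<in> tens_ext_rels sV sS 2 p \<Longrightarrow> r \<in> kos_rels"
  by (auto simp: kos_rels_def)

lemma K_bad: "length xs \<noteq> 2 \<Longrightarrow> frag_of (xs, ws) \<approx>K 0"
  by (rule eqm_base) (auto simp: kos_rels_def)

lemma tens_ext_rels_addX:
  "i < length xs \<Longrightarrow> frag_of (xs[i := x + y], ws) - frag_of (xs[i := x], ws) - frag_of (xs[i := y], ws)
    \<in> tens_ext_rels sV sS (length xs) (length ws)"
  unfolding tens_ext_rels_def
  by (rule UnI1, rule UnI1, rule UnI1, rule UnI1)
     (rule CollectI, (rule exI)+, (rule conjI, rule refl), simp)

lemma tens_ext_rels_addW:
  "frag_of (xs, A @ (w + w') # C) - frag_of (xs, A @ w # C) - frag_of (xs, A @ w' # C)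
    \<in> tens_ext_rels sV sS (length xs) (length (A @ w # C))"
proof -
  let ?ws = "A @ w # C"
  have "frag_of (xs, ?ws[length A := w + w']) - frag_of (xs, ?ws[length A := w]) -
      frag_of (xs, ?ws[length A := w']) \<in> tens_ext_rels sV sS (length xs) (length ?ws)"
    unfolding tens_ext_rels_def
    by (rule UnI1, rule UnI1, rule UnI1, rule UnI2) (rule CollectI, (rule exI)+, (rule conjI, rule refl), simp)
  then show ?thesis by simp
qed

lemma tens_ext_rels_scaleX:
  "i < length xs \<Longrightarrow> j < length xs \<Longrightarrow>
    frag_of (xs[i := sS c (xs ! i)], ws) - frag_of (xs[j := sS c (xs ! j)], ws)
    \<in> tens_ext_rels sV sS (length xs) (length ws)"
  unfolding tens_ext_rels_def
  by (rule UnI1, rule UnI1, rule UnI2) (rule CollectI, (rule exI)+, (rule conjI, rule refl), simp)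

lemma tens_ext_rels_scaleW:
  assumes "i < length xs"
  shows "frag_of (xs[i := sS c (xs ! i)], A @ w # C) - frag_of (xs, A @ sV c w # C)
    \<in> tens_ext_rels sV sS (length xs) (length (A @ w # C))"
proof -
  let ?ws = "A @ w # C"
  have "frag_of (xs[i := sS c (xs ! i)], ?ws) - frag_of (xs, ?ws[length A := sV c (?ws ! length A)])
      \<in> tens_ext_rels sV sS (length xs) (length ?ws)"
    unfolding tens_ext_rels_def
    by (rule UnI1, rule UnI2) (rule CollectI, (rule exI)+, (rule conjI, rule refl), simp add: assms)
  then show ?thesis by simp
qed

lemma tens_ext_rels_alt:
  "frag_of (xs, A @ w # B @ w # C) \<in> tens_ext_rels sV sS (length xs) (length (A @ w # B @ w # C))"
proof -
  let ?ws = "A @ w # B @ w # C"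
  have "length A < length A + 1 + length B" "length A + 1 + length B < length ?ws"
      "?ws ! length A = ?ws ! (length A + 1 + length B)"
    by (simp_all add: nth_append)
  then have ex: "\<exists>i j. i < j \<and> j < length ?ws \<and> ?ws ! i = ?ws ! j" by blast
  show ?thesis
    unfolding tens_ext_rels_def
    by (rule UnI2, rule CollectI, (rule exI)+, rule conjI, rule refl) (use ex in simp)
qed

lemma tens_ext_rels_cases:
  assumes "r \<in> tens_ext_rels sV sS q p"
  obtains (1) xs ws i x y where
      "r = frag_of (xs[i := x + y], ws) - frag_of (xs[i := x], ws) - frag_of (xs[i := y], ws)"
      "length xs = q" "length ws = p" "i < q"
    | (2) xs ws i x y where
      "r = frag_of (xs, ws[i := x + y]) - frag_of (xs, ws[i := x]) - frag_of (xs, ws[i := y])"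
      "length xs = q" "length ws = p" "i < p"
    | (3) xs ws i j c where
      "r = frag_of (xs[i := sS c (xs ! i)], ws) - frag_of (xs[j := sS c (xs ! j)], ws)"
      "length xs = q" "length ws = p" "i < q" "j < q"
    | (4) xs ws i j c where
      "r = frag_of (xs[i := sS c (xs ! i)], ws) - frag_of (xs, ws[j := sV c (ws ! j)])"
      "length xs = q" "length ws = p" "i < q" "j < p"
    | (5) xs A w B C where "r = frag_of (xs, A @ w # B @ w # C)" "length xs = q" "length (A @ w # B @ w # C) = p"
  using assms unfolding tens_ext_rels_def
proof (elim UnE CollectE exE conjE)
  fix xs ws i j
  assume r: "r = frag_of (xs, ws)" "length xs = q" "length ws = p" and ij: "i < j" "j < p" "ws ! i = ws ! j"
  define B where "B = take (j - Suc i) (drop (Suc i) ws)"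
  have "drop (Suc i) ws = B @ ws ! j # drop (Suc j) ws"
    using id_take_nth_drop[of "j - Suc i" "drop (Suc i) ws"] r ij by (simp add: B_def)
  then have ws: "ws = take i ws @ ws ! i # B @ ws ! i # drop (Suc j) ws"
    using id_take_nth_drop[of i ws] r ij by simp
  show thesis
  proof (rule 5)
    show "r = frag_of (xs, take i ws @ ws ! i # B @ ws ! i # drop (Suc j) ws)"
      using r(1) arg_cong[OF ws, of "\<lambda>ws. frag_of (xs, ws)"] by (rule trans)
    show "length (take i ws @ ws ! i # B @ ws ! i # drop (Suc j) ws) = p"
      using arg_cong[OF ws, of length] r(3) by (rule trans[OF sym])
  qed fact
qed ((rule 1, assumption+) | (rule 2, assumption+) | (rule 3, assumption+) | (rule 4, assumption+))+

lemma K_addL: "frag_of ([a + a', b], ws) \<approx>K frag_of ([a, b], ws) + frag_of ([a', b], ws)"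
  using tens_ext_rels_addX[of 0 "[a, b]" a a' ws]
  by (intro eqm_base tens_ext_rels_kos_relsD) (simp add: diff_diff_eq numeral_2_eq_2)

lemma K_addR: "frag_of ([a, b + b'], ws) \<approx>K frag_of ([a, b], ws) + frag_of ([a, b'], ws)"
  using tens_ext_rels_addX[of 1 "[a, b]" b b' ws]
  by (intro eqm_base tens_ext_rels_kos_relsD) (simp add: diff_diff_eq numeral_2_eq_2 One_nat_def)

lemma K_addW: "frag_of ([a, b], A @ (w + w') # C) \<approx>K frag_of ([a, b], A @ w # C) + frag_of ([a, b], A @ w' # C)"
  using tens_ext_rels_addW[of "[a, b]" A w w' C]
  by (intro eqm_base tens_ext_rels_kos_relsD) (simp add: diff_diff_eq numeral_2_eq_2)

lemma K_scaleR: "frag_of ([a, sS c b], ws) \<approx>K frag_of ([sS c a, b], ws)"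
  using tens_ext_rels_scaleX[of 1 "[a, b]" 0 c ws]
  by (intro eqm_base tens_ext_rels_kos_relsD) (simp add: numeral_2_eq_2 One_nat_def)

lemma K_scaleW: "frag_of ([a, b], A @ sV c w # C) \<approx>K frag_of ([sS c a, b], A @ w # C)"
  using tens_ext_rels_scaleW[of 0 "[a, b]" c A w C]
  by (intro eqm_sym[OF eqm_base] tens_ext_rels_kos_relsD) (simp add: numeral_2_eq_2)

lemma K_alt: "frag_of ([a, b], A @ w # B @ w # C) \<approx>K 0"
  using tens_ext_rels_alt[of "[a, b]" A w B C]
  by (intro eqm_base tens_ext_rels_kos_relsD) (simp add: numeral_2_eq_2)

lemma kos_rels_cases:
  assumes "r \<in> kos_rels"
  obtains (bad) xs ws where "r = frag_of (xs, ws)" "length xs \<noteq> 2"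
    | (rel) p where "r \<in> tens_ext_rels sV sS 2 p"
  using assms by (auto simp: kos_rels_def)

lemma resp_kos:
  assumes bad: "\<And>xs ws. length xs \<noteq> 2 \<Longrightarrow> eqm N (g (xs, ws)) 0"
    and addL: "\<And>a a' b ws. eqm N (g ([a + a', b], ws)) (g ([a, b], ws) + g ([a', b], ws))"
    and addR: "\<And>a b b' ws. eqm N (g ([a, b + b'], ws)) (g ([a, b], ws) + g ([a, b'], ws))"
    and addW: "\<And>a b A w w' C. eqm N (g ([a, b], A @ (w + w') # C)) (g ([a, b], A @ w # C) + g ([a, b], A @ w' # C))"
    and sclR: "\<And>a b c ws. eqm N (g ([a, sS c b], ws)) (g ([sS c a, b], ws))"
    and sclW: "\<And>a b A w C c. eqm N (g ([a, b], A @ sV c w # C)) (g ([sS c a, b], A @ w # C))"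
    and alt: "\<And>a b A w B C. eqm N (g ([a, b], A @ w # B @ w # C)) 0"
  shows "resp kos_rels N g"
  unfolding resp_def
proof
  have two: "\<exists>a b. xs = [a, b]" if "length xs = 2" for xs :: "'s list"
    using that by (auto simp: length_Suc_conv numeral_2_eq_2)
  have sX: "eqm N (g (xs[i := sS c (xs ! i)], ws)) (g (xs[0 := sS c (xs ! 0)], ws))"
    if xs: "length xs = 2" "i < 2" for xs i c ws
  proof -
    obtain a b where "xs = [a, b]" using two xs by blast
    moreover have "i = 0 \<or> i = Suc 0" using xs by auto
    ultimately show ?thesis using sclR by auto
  qed
  have sW: "eqm N (g (xs, ws[j := sV c (ws ! j)])) (g (xs[0 := sS c (xs ! 0)], ws))"
    if xs: "length xs = 2" "j < length ws" for xs j c ws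
  proof -
    obtain a b where "xs = [a, b]" using two xs by blast
    then show ?thesis
      using sclW[of a b "take j ws" c "ws ! j" "drop (Suc j) ws"] xs
      by (simp add: upd_conv_take_nth_drop id_take_nth_drop[symmetric])
  qed
  have main: "eqm N (frag_extend g r) 0" if "r \<in> tens_ext_rels sV sS 2 p" for r p
    using that
  proof (cases rule: tens_ext_rels_cases)
    case (1 xs ws i x y)
    obtain a b where "xs = [a, b]" using two 1 by blast
    moreover have "i = 0 \<or> i = Suc 0" using 1 by auto
    ultimately show ?thesis
      using addL[of x y b ws] addR[of a x y ws]
      by (auto simp: 1 frag_extend_diff frag_extend_add diff_diff_eq eqm_diff_zero)
  next
    case (2 xs ws i x y)
    obtain a b where "xs = [a, b]" using two 2 by blast
    then show ?thesis using addW[of a b "take i ws" x y "drop (Suc i) ws"] 2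
      by (simp add: upd_conv_take_nth_drop frag_extend_diff frag_extend_add diff_diff_eq eqm_diff_zero)
  next
    case (3 xs ws i j c)
    have "eqm N (g (xs[i := sS c (xs ! i)], ws)) (g (xs[j := sS c (xs ! j)], ws))"
      using 3 by (intro eqm_trans[OF sX eqm_sym[OF sX]]) auto
    then show ?thesis by (simp add: 3 frag_extend_diff eqm_diff_zero)
  next
    case (4 xs ws i j c)
    have "eqm N (g (xs[i := sS c (xs ! i)], ws)) (g (xs, ws[j := sV c (ws ! j)]))"
      using 4 by (intro eqm_trans[OF sX eqm_sym[OF sW]]) auto
    then show ?thesis by (simp add: 4 frag_extend_diff eqm_diff_zero)
  next
    case (5 xs A w B C)
    obtain a b where "xs = [a, b]" using two 5 by blast
    then show ?thesis by (simp add: 5 alt)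
  qed
  fix r assume "r \<in> kos_rels"
  then show "eqm N (frag_extend g r) 0"
    by (cases rule: kos_rels_cases) (simp_all add: bad main)
qed

text \<open>The operators \<open>kL\<close> and \<open>kR\<close> are the actions of the two factors of S^e, \<open>W w\<close> is w \<and> -, and
  \<open>kbd\<close> is the Koszul differential in recursive form, an antiderivation with respect to \<open>W\<close>.\<close>

definition kLg :: "'s \<Rightarrow> 's list \<times> 'v list \<Rightarrow> 's list \<times> 'v list \<Rightarrow>\<^sub>0 int" where
  "kLg a = (\<lambda>(xs, ws). if length xs = 2 then frag_of ([a * xs ! 0, xs ! 1], ws) else 0)"

definition kRg :: "'s \<Rightarrow> 's list \<times> 'v list \<Rightarrow> 's list \<times> 'v list \<Rightarrow>\<^sub>0 int" where
  "kRg b = (\<lambda>(xs, ws). if length xs = 2 then frag_of ([xs ! 0, xs ! 1 * b], ws) else 0)"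

definition Wg :: "'v \<Rightarrow> 's list \<times> 'v list \<Rightarrow> 's list \<times> 'v list \<Rightarrow>\<^sub>0 int" where
  "Wg w = (\<lambda>(xs, ws). frag_of (xs, w # ws))"

abbreviation "kL a \<equiv> frag_extend (kLg a)"
abbreviation "kR b \<equiv> frag_extend (kRg b)"
abbreviation "W w \<equiv> frag_extend (Wg w)"

primrec kd :: "'s \<Rightarrow> 's \<Rightarrow> 'v list \<Rightarrow> 's list \<times> 'v list \<Rightarrow>\<^sub>0 int" where
  "kd a b [] = 0"
| "kd a b (w # ws) = frag_of ([a * \<iota> w, b], ws) - frag_of ([a, \<iota> w * b], ws) - W w (kd a b ws)"

definition kbdg :: "'s list \<times> 'v list \<Rightarrow> 's list \<times> 'v list \<Rightarrow>\<^sub>0 int" where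
  "kbdg = (\<lambda>(xs, ws). if length xs = 2 then kd (xs ! 0) (xs ! 1) ws else 0)"

abbreviation "kbd \<equiv> frag_extend kbdg"

lemma kgen_simps [simp]: "kLg a ([x, y], ws) = frag_of ([a * x, y], ws)"
  "kRg b ([x, y], ws) = frag_of ([x, y * b], ws)" "Wg w (xs, ws) = frag_of (xs, w # ws)"
  "kbdg ([x, y], ws) = kd x y ws"
  "length xs \<noteq> 2 \<Longrightarrow> kLg a (xs, ws) = 0" "length xs \<noteq> 2 \<Longrightarrow> kRg a (xs, ws) = 0"
  "length xs \<noteq> 2 \<Longrightarrow> kbdg (xs, ws) = 0"
  by (simp_all add: kLg_def kRg_def Wg_def kbdg_def One_nat_def)

lemma kos_gen_cases:
  obtains (good) a b ws where "z = ([a, b], ws)" | (bad) xs ws where "z = (xs, ws)" "length xs \<noteq> 2"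
proof (cases z)
  case (Pair xs ws)
  show thesis
  proof (cases "length xs = 2")
    case True
    then obtain a b where "xs = [a, b]" by (auto simp: length_Suc_conv numeral_2_eq_2)
    then show thesis using good Pair by blast
  qed (use bad Pair in blast)
qed

lemma kos_eqI:
  assumes "\<And>a b ws. frag_extend f (frag_of ([a, b], ws)) = frag_extend g (frag_of ([a, b], ws))"
    and "\<And>xs ws. length xs \<noteq> 2 \<Longrightarrow> f (xs, ws) = g (xs, ws)"
  shows "frag_extend f u = frag_extend g u"
proof -
  have "f = g"
  proof
    fix z show "f z = g z" using assms by (cases z rule: kos_gen_cases) auto
  qed
  then show ?thesis by simp
qed

lemma kL_kL: "kL a (kL b u) = kL (a * b) u"
  and kR_kR: "kR a (kR b u) = kR (a * b) u"
  and kL_kR: "kL a (kR b u) = kR b (kL a u)"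
  and kL_W: "kL a (W w u) = W w (kL a u)"
  and kR_W: "kR a (W w u) = W w (kR a u)"
  unfolding frag_extend_extend by (rule kos_eqI; simp add: ac_simps)+

lemma kbd_W: "kbd (W w u) = kL (\<iota> w) u - kR (\<iota> w) u - W w (kbd u)"
  unfolding frag_extend_extend frag_extend_diff_fun[symmetric]
  by (rule kos_eqI) (simp_all add: mult.commute)

lemma frag_kCons: "frag_of (xs, w # ws) = W w (frag_of (xs, ws))"
  by simp

lemma kbd_kL: "kbd (kL a u) = kL a (kbd u)"
proof (induction u rule: frag_induct)
  case (one z)
  show ?case
  proof (cases z rule: kos_gen_cases)
    case (good x y ws)
    have "kbd (kL a (frag_of ([x, y], ws))) = kL a (kbd (frag_of ([x, y], ws)))"
    proof (induction ws)
      case (Cons w ws)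
      have "kL a (kR (\<iota> w) u) = kR (\<iota> w) (kL a u)" "kL a (kL (\<iota> w) u) = kL (\<iota> w) (kL a u)" for u
        by (simp_all add: kL_kR kL_kL mult.commute)
      then show ?case using Cons by (simp only: frag_kCons kL_W kbd_W frag_lin)
    qed simp
    then show ?thesis using good by simp
  qed simp
qed (simp_all add: frag_lin)

lemma kbd_kR: "kbd (kR a u) = kR a (kbd u)"
proof (induction u rule: frag_induct)
  case (one z)
  show ?case
  proof (cases z rule: kos_gen_cases)
    case (good x y ws)
    have "kbd (kR a (frag_of ([x, y], ws))) = kR a (kbd (frag_of ([x, y], ws)))"
    proof (induction ws)
      case (Cons w ws)
      have "kR a (kR (\<iota> w) u) = kR (\<iota> w) (kR a u)" for u
        by (simp_all add: kR_kR mult.commute)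
      then show ?case using Cons by (simp only: frag_kCons kR_W kbd_W frag_lin kL_kR)
    qed simp
    then show ?thesis using good by simp
  qed simp
qed (simp_all add: frag_lin)

lemma kbd_kbd: "kbd (kbd u) = 0"
proof (induction u rule: frag_induct)
  case (one z)
  show ?case
  proof (cases z rule: kos_gen_cases)
    case (good x y ws)
    have "kbd (kbd (frag_of ([x, y], ws))) = 0"
    proof (induction ws)
      case (Cons w ws)
      then show ?case
        by (simp only: frag_kCons kbd_W frag_lin kbd_kL kbd_kR) simp
    qed simp
    then show ?thesis using good by simp
  qed simp
qed (simp_all add: frag_lin)

lemma sS_mult: "sS c a * b = sS c (a * b)" "a * sS c b = sS c (a * b)"
  using scale_mult[of c a b] scale_mult[of c b a] by (simp_all add: mult.commute)

lemma resp_W: "resp kos_rels kos_rels (Wg z)"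
proof (rule resp_kos)
  fix a b A C w w' and c :: 'k
  show "Wg z ([a, b], A @ (w + w') # C) \<approx>K Wg z ([a, b], A @ w # C) + Wg z ([a, b], A @ w' # C)"
    using K_addW[of a b "z # A" w w' C] by simp
  show "Wg z ([a, b], A @ sV c w # C) \<approx>K Wg z ([sS c a, b], A @ w # C)"
    using K_scaleW[of a b "z # A" c w C] by simp
next
  fix a b A w B C show "Wg z ([a, b], A @ w # B @ w # C) \<approx>K 0"
    using K_alt[of a b "z # A" w B C] by simp
next
  fix a a' b b' ws and c :: 'k
  show "Wg z ([a + a', b], ws) \<approx>K Wg z ([a, b], ws) + Wg z ([a', b], ws)"
    unfolding kgen_simps by (rule K_addL)
  show "Wg z ([a, b + b'], ws) \<approx>K Wg z ([a, b], ws) + Wg z ([a, b'], ws)"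
    unfolding kgen_simps by (rule K_addR)
  show "Wg z ([a, sS c b], ws) \<approx>K Wg z ([sS c a, b], ws)"
    unfolding kgen_simps by (rule K_scaleR)
next
  fix xs :: "'s list" and ws assume "length xs \<noteq> 2"
  then show "Wg z (xs, ws) \<approx>K 0" unfolding kgen_simps by (rule K_bad)
qed

lemma resp_kL: "resp kos_rels kos_rels (kLg z)"
proof (rule resp_kos)
  fix a a' b b' w w' A B C ws and c :: 'k
  show "kLg z ([a + a', b], ws) \<approx>K kLg z ([a, b], ws) + kLg z ([a', b], ws)"
    unfolding kgen_simps distrib_left by (rule K_addL)
  show "kLg z ([a, b + b'], ws) \<approx>K kLg z ([a, b], ws) + kLg z ([a, b'], ws)"
    unfolding kgen_simps distrib_left by (rule K_addR)
  show "kLg z ([a, sS c b], ws) \<approx>K kLg z ([sS c a, b], ws)"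
    unfolding kgen_simps sS_mult by (rule K_scaleR)
  show "kLg z ([a, b], A @ (w + w') # C) \<approx>K kLg z ([a, b], A @ w # C) + kLg z ([a, b], A @ w' # C)"
    unfolding kgen_simps by (rule K_addW)
  show "kLg z ([a, b], A @ sV c w # C) \<approx>K kLg z ([sS c a, b], A @ w # C)"
    unfolding kgen_simps sS_mult by (rule K_scaleW)
  show "kLg z ([a, b], A @ w # B @ w # C) \<approx>K 0"
    unfolding kgen_simps by (rule K_alt)
qed simp

lemma resp_kR: "resp kos_rels kos_rels (kRg z)"
proof (rule resp_kos)
  fix a a' b b' w w' A B C ws and c :: 'k
  show "kRg z ([a + a', b], ws) \<approx>K kRg z ([a, b], ws) + kRg z ([a', b], ws)"
    unfolding kgen_simps distrib_right by (rule K_addL)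
  show "kRg z ([a, b + b'], ws) \<approx>K kRg z ([a, b], ws) + kRg z ([a, b'], ws)"
    unfolding kgen_simps distrib_right by (rule K_addR)
  show "kRg z ([a, sS c b], ws) \<approx>K kRg z ([sS c a, b], ws)"
    unfolding kgen_simps sS_mult by (rule K_scaleR)
  show "kRg z ([a, b], A @ (w + w') # C) \<approx>K kRg z ([a, b], A @ w # C) + kRg z ([a, b], A @ w' # C)"
    unfolding kgen_simps by (rule K_addW)
  show "kRg z ([a, b], A @ sV c w # C) \<approx>K kRg z ([sS c a, b], A @ w # C)"
    unfolding kgen_simps sS_mult by (rule K_scaleW)
  show "kRg z ([a, b], A @ w # B @ w # C) \<approx>K 0"
    unfolding kgen_simps by (rule K_alt)
qed simp

lemmas kL_cong = resp_eqm[OF resp_kL] and kR_cong = resp_eqm[OF resp_kR] and W_cong = resp_eqm[OF resp_W]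

lemma kos_eqmI:
  assumes "\<And>a b ws. eqm N (f ([a, b], ws)) (g ([a, b], ws))"
    and "\<And>xs ws. length xs \<noteq> 2 \<Longrightarrow> eqm N (f (xs, ws)) (g (xs, ws))"
  shows "eqm N (frag_extend f u) (frag_extend g u)"
proof (rule frag_extend_eqm)
  fix z show "eqm N (f z) (g z)" using assms by (cases z rule: kos_gen_cases) auto
qed

lemma kL_param: "kL (a + a') u \<approx>K kL a u + kL a' u"
  unfolding frag_extend_add_fun[symmetric] by (rule kos_eqmI) (simp_all add: distrib_right K_addL)

lemma kR_param: "kR (a + a') u \<approx>K kR a u + kR a' u"
  unfolding frag_extend_add_fun[symmetric] by (rule kos_eqmI) (simp_all add: distrib_left K_addR)

lemma W_param: "W (w + w') u \<approx>K W w u + W w' u"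
  unfolding frag_extend_add_fun[symmetric]
proof (rule kos_eqmI)
  fix a b ws show "Wg (w + w') ([a, b], ws) \<approx>K Wg w ([a, b], ws) + Wg w' ([a, b], ws)"
    using K_addW[of a b "[]"] by simp
next
  fix xs :: "'s list" and ws assume "length xs \<noteq> 2"
  then have "frag_of (xs, (w + w') # ws) \<approx>K 0 + 0"
    and "frag_of (xs, w # ws) + frag_of (xs, w' # ws) \<approx>K 0 + 0"
    using eqm_add[OF K_bad[of xs "w # ws"] K_bad[of xs "w' # ws"]] K_bad[of xs "(w + w') # ws"] by simp_all
  then show "Wg (w + w') (xs, ws) \<approx>K Wg w (xs, ws) + Wg w' (xs, ws)"
    using eqm_trans eqm_sym by (simp only: kgen_simps) blast
qed

lemma W_scale: "W (sV c w) u \<approx>K kL (sc c) (W w u)"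
  unfolding frag_extend_extend
proof (rule kos_eqmI)
  fix a b ws show "Wg (sV c w) ([a, b], ws) \<approx>K kL (sc c) (Wg w ([a, b], ws))"
    using K_scaleW[of a b "[]" c w ws] by (simp flip: scale_sc)
qed (simp add: K_bad)

lemma kR_sc: "kR (sc c) u \<approx>K kL (sc c) u"
proof (rule kos_eqmI)
  fix a b ws show "kRg (sc c) ([a, b], ws) \<approx>K kLg (sc c) ([a, b], ws)"
    using K_scaleR[of a c b ws] by (simp add: mult.commute[of b] flip: scale_sc)
qed simp

lemma kL_1: "kL 1 u \<approx>K u" and kR_1: "kR 1 u \<approx>K u"
proof -
  have "kL 1 u \<approx>K frag_extend frag_of u" "kR 1 u \<approx>K frag_extend frag_of u"
    by (rule kos_eqmI; simp add: eqm_sym K_bad)+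
  then show "kL 1 u \<approx>K u" "kR 1 u \<approx>K u" by simp_all
qed

lemma W_W: "W w (W w u) \<approx>K 0"
proof -
  have "frag_extend (\<lambda>z. W w (Wg w z)) u \<approx>K frag_extend (\<lambda>_. 0) u"
  proof (rule kos_eqmI)
    fix a b ws show "W w (Wg w ([a, b], ws)) \<approx>K 0"
      using K_alt[of a b "[]" w "[]" ws] by simp
  qed (simp add: K_bad)
  then show ?thesis by (simp add: frag_extend_extend frag_extend_eq_0)
qed

text \<open>Polarisation of w \<and> w = 0.\<close>

lemma W_anti: "W x (W y u) \<approx>K - W y (W x u)"
proof -
  have "W (x + y) (W (x + y) u) \<approx>K W (x + y) (W x u + W y u)"
    by (intro W_cong W_param)
  also have "\<dots> \<approx>K (W x (W x u + W y u)) + (W y (W x u + W y u))"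
    by (rule W_param)
  also have "\<dots> = (W x (W x u) + W x (W y u)) + (W y (W x u) + W y (W y u))"
    by (simp add: frag_lin)
  also have "\<dots> \<approx>K (0 + W x (W y u)) + (W y (W x u) + 0)"
    by (intro eqm_add W_W eqm_refl)
  finally have "W (x + y) (W (x + y) u) \<approx>K W x (W y u) + W y (W x u)" by simp
  then have "W x (W y u) + W y (W x u) \<approx>K 0"
    using W_W by (blast intro: eqm_sym eqm_trans)
  then show ?thesis by (simp add: eqm_def)
qed

text \<open>The delicate relation is the vanishing on repeated vectors: the two terms that remove one copy
  cancel, since the remaining copy moves past the vectors in between.\<close>

lemma resp_kbd: "resp kos_rels kos_rels kbdg"
proof (rule resp_kos)
  fix a a' b b' ws and c :: 'k
  have L: "kd a b ws = kL a (kd 1 b ws)" for a b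
    using kbd_kL[of a "frag_of ([1, b], ws)"] by simp
  have R: "kd a b ws = kR b (kd a 1 ws)" for a b
    using kbd_kR[of b "frag_of ([a, 1], ws)"] by simp
  show "kbdg ([a + a', b], ws) \<approx>K kbdg ([a, b], ws) + kbdg ([a', b], ws)"
    using kL_param[of a a' "kd 1 b ws"] L[of a b] L[of a' b] L[of "a + a'" b] by simp
  show "kbdg ([a, b + b'], ws) \<approx>K kbdg ([a, b], ws) + kbdg ([a, b'], ws)"
    using kR_param[of b b' "kd a 1 ws"] R[of a b] R[of a b'] R[of a "b + b'"] by simp
  have "kd a (sS c b) ws = kR (sc c) (kd a b ws)"
    using R[of a "sS c b"] R[of a b] by (simp add: kR_kR flip: scale_sc)
  moreover have "kd (sS c a) b ws = kL (sc c) (kd a b ws)"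
    using L[of "sS c a" b] L[of a b] by (simp add: kL_kL flip: scale_sc)
  ultimately show "kbdg ([a, sS c b], ws) \<approx>K kbdg ([sS c a, b], ws)"
    using kR_sc by simp
next
  fix a b :: 's and A C :: "'v list" and w w' :: 'v
  let ?f = "\<lambda>ws. frag_of ([a, b], ws)"
  have "kbd (?f (A @ (w + w') # C)) \<approx>K kbd (?f (A @ w # C)) + kbd (?f (A @ w' # C))"
  proof (induction A)
    case Nil
    have "kL (\<iota> (w + w')) (?f C) - kR (\<iota> (w + w')) (?f C) - W (w + w') (kbd (?f C)) \<approx>K
      (kL (\<iota> w) (?f C) + kL (\<iota> w') (?f C)) - (kR (\<iota> w) (?f C) + kR (\<iota> w') (?f C)) -
      (W w (kbd (?f C)) + W w' (kbd (?f C)))"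
      unfolding add by (intro eqm_diff kL_param kR_param W_param)
    then show ?case unfolding append_Nil frag_kCons kbd_W by (simp add: algebra_simps del: frag_extend_of)
  next
    case (Cons x A)
    note B = K_addW[of a b A w w' C]
    have "kL (\<iota> x) (?f (A @ (w + w') # C)) - kR (\<iota> x) (?f (A @ (w + w') # C)) - W x (kbd (?f (A @ (w + w') # C))) \<approx>K
      kL (\<iota> x) (?f (A @ w # C) + ?f (A @ w' # C)) - kR (\<iota> x) (?f (A @ w # C) + ?f (A @ w' # C)) -
      W x (kbd (?f (A @ w # C)) + kbd (?f (A @ w' # C)))"
      by (intro eqm_diff kL_cong kR_cong W_cong B Cons)
    then show ?case
      unfolding append_Cons frag_kCons kbd_W by (simp add: frag_lin algebra_simps del: frag_extend_of)
  qed
  then show "kbdg ([a, b], A @ (w + w') # C) \<approx>K kbdg ([a, b], A @ w # C) + kbdg ([a, b], A @ w' # C)"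
    by simp
next
  fix a b :: 's and A C :: "'v list" and w :: 'v and c :: 'k
  let ?f = "\<lambda>ws. frag_of ([a, b], ws)"
  have "kbd (?f (A @ sV c w # C)) \<approx>K kL (sc c) (kbd (?f (A @ w # C)))"
  proof (induction A)
    case Nil
    have "kR (sS c (\<iota> w)) (?f C) = kR (sc c) (kR (\<iota> w) (?f C))" "kL (sS c (\<iota> w)) (?f C) = kL (sc c) (kL (\<iota> w) (?f C))"
      by (simp_all only: kR_kR kL_kL scale_sc[of c "\<iota> w"])
    then have "kL (\<iota> (sV c w)) (?f C) - kR (\<iota> (sV c w)) (?f C) - W (sV c w) (kbd (?f C)) \<approx>K
      kL (sc c) (kL (\<iota> w) (?f C)) - kL (sc c) (kR (\<iota> w) (?f C)) - kL (sc c) (W w (kbd (?f C)))"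
      unfolding scale by (intro eqm_diff) (simp_all only: eqm_refl kR_sc W_scale)
    then show ?case unfolding append_Nil frag_kCons kbd_W frag_lin .
  next
    case (Cons x A)
    have B: "?f (A @ sV c w # C) \<approx>K kL (sc c) (?f (A @ w # C))"
      using K_scaleW[of a b A c w C] by (simp flip: scale_sc)
    have "kL (\<iota> x) (?f (A @ sV c w # C)) - kR (\<iota> x) (?f (A @ sV c w # C)) - W x (kbd (?f (A @ sV c w # C))) \<approx>K
      kL (\<iota> x) (kL (sc c) (?f (A @ w # C))) - kR (\<iota> x) (kL (sc c) (?f (A @ w # C))) -
      W x (kL (sc c) (kbd (?f (A @ w # C))))"
      by (intro eqm_diff kL_cong kR_cong W_cong B Cons)
    also have "\<dots> = kL (sc c) (kbd (?f (x # A @ w # C)))"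
      unfolding frag_kCons kbd_W frag_lin kL_W kL_kL kL_kR by (simp only: mult.commute)
    finally show ?case unfolding append_Cons frag_kCons kbd_W .
  qed
  moreover have "kL (sc c) (kbd (?f (A @ w # C))) = kbdg ([sS c a, b], A @ w # C)"
    by (simp add: kbd_kL[symmetric] del: kgen_simps(4) frag_extend_of) (simp flip: scale_sc)
  ultimately show "kbdg ([a, b], A @ sV c w # C) \<approx>K kbdg ([sS c a, b], A @ w # C)"
    by simp
next
  fix a b :: 's and A B C :: "'v list" and w :: 'v
  let ?f = "\<lambda>ws. frag_of ([a, b], ws)"
  \<comment> \<open>Wedging the boundary with w kills every term that still contains w, so only the term
    that removes w contributes, and the sign is absorbed by moving the new w to the old place.\<close>
  have wd: "W w (kbd (?f (B @ w # C))) \<approx>K kL (\<iota> w) (?f (B @ w # C)) - kR (\<iota> w) (?f (B @ w # C))"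
  proof (induction B)
    case Nil
    have "W w (kL (\<iota> w) (?f C) - kR (\<iota> w) (?f C)) - W w (W w (kbd (?f C))) \<approx>K
        W w (kL (\<iota> w) (?f C) - kR (\<iota> w) (?f C)) - 0"
      by (intro eqm_diff W_W eqm_refl)
    then show ?case unfolding append_Nil frag_kCons kbd_W frag_lin kL_W kR_W by simp
  next
    case (Cons x B)
    let ?u = "?f (B @ w # C)"
    have "W w (?u) \<approx>K 0" using K_alt[of a b "[]" w B C] by simp
    then have z: "W w (kL (\<iota> x) ?u) \<approx>K 0" "W w (kR (\<iota> x) ?u) \<approx>K 0"
      using kL_cong[of "W w ?u" 0 "\<iota> x"] kR_cong[of "W w ?u" 0 "\<iota> x"] unfolding kL_W kR_W by simp_all
    have "W w (W x (kbd ?u)) \<approx>K - W x (W w (kbd ?u))" by (rule W_anti)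
    also have "\<dots> \<approx>K - W x (kL (\<iota> w) ?u - kR (\<iota> w) ?u)"
      by (intro eqm_uminus W_cong Cons)
    finally have "W w (kL (\<iota> x) ?u) - W w (kR (\<iota> x) ?u) - W w (W x (kbd ?u)) \<approx>K
      0 - 0 - (- W x (kL (\<iota> w) ?u - kR (\<iota> w) ?u))"
      by (intro eqm_diff z)
    then show ?case unfolding append_Cons frag_kCons kbd_W frag_lin kL_W kR_W by simp
  qed
  have "kbd (?f (A @ w # B @ w # C)) \<approx>K 0"
  proof (induction A)
    case Nil
    have "kL (\<iota> w) (?f (B @ w # C)) - kR (\<iota> w) (?f (B @ w # C)) - W w (kbd (?f (B @ w # C))) \<approx>K 
       (kL (\<iota> w) (?f (B @ w # C)) - kR (\<iota> w) (?f (B @ w # C))) - (kL (\<iota> w) (?f (B @ w # C)) - kR (\<iota> w) (?f (B @ w # C)))"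
      by (intro eqm_diff wd eqm_refl)
    then show ?case unfolding append_Nil frag_kCons kbd_W by simp
  next
    case (Cons x A)
    have "kL (\<iota> x) (?f (A @ w # B @ w # C)) - kR (\<iota> x) (?f (A @ w # B @ w # C)) - W x (kbd (?f (A @ w # B @ w # C))) \<approx>K
        kL (\<iota> x) 0 - kR (\<iota> x) 0 - W x 0"
      by (intro eqm_diff kL_cong kR_cong W_cong K_alt Cons)
    then show ?case unfolding append_Cons frag_kCons kbd_W by simp
  qed
  then show "kbdg ([a, b], A @ w # B @ w # C) \<approx>K 0" by simp
qed simp

lemmas kbd_cong = resp_eqm[OF resp_kbd]

end


section \<open>The chain map Psi\<close>

lemma sum_telescope_greaterThanAtMost:
  fixes g :: "nat \<Rightarrow> 'a::ab_group_add"
  assumes "t \<le> n" shows "(\<Sum>i\<in>{t<..n}. g (i - 1) - g i) = g t - g n"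
  using assms
proof (induction n rule: dec_induct)
  case (step m)
  have "{t<..Suc m} = insert (Suc m) {t<..m}" using step by auto
  then show ?case using step by simp
qed simp

context sym_basis
begin

text \<open>The action of the model of S^e on Koszul chains. On formal combinations it is an action only modulo
  the relations (\<open>ract_add\<close>, \<open>ract_mult\<close>).\<close>

definition ract :: "'s env \<Rightarrow> ('s list \<times> 'v list \<Rightarrow>\<^sub>0 int) \<Rightarrow> ('s list \<times> 'v list \<Rightarrow>\<^sub>0 int)" where
  "ract r u = (\<Sum>m\<in>Poly_Mapping.keys r. kL (Poly_Mapping.lookup r m) (kR (mon (Poly_Mapping.lookup m)) u))"

lemma ract_0 [simp]: "ract r 0 = 0" "ract 0 u = 0"
  by (simp_all add: ract_def)

lemma ract_plus: "ract r (u + w) = ract r u + ract r w"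
  and ract_minus: "ract r (u - w) = ract r u - ract r w"
  by (simp_all add: ract_def frag_lin sum.distrib sum_subtractf)

lemma ract_sum: "ract r (sum f I) = (\<Sum>i\<in>I. ract r (f i))"
  by (induction I rule: infinite_finite_induct) (simp_all add: ract_plus)

lemma ract_cong: "u \<approx>K w \<Longrightarrow> ract r u \<approx>K ract r w"
  unfolding ract_def by (intro eqm_sum kL_cong kR_cong)

lemma kbd_ract: "kbd (ract r u) = ract r (kbd u)"
  and W_ract: "W w (ract r u) = ract r (W w u)"
  by (simp_all add: ract_def frag_extend_sum' kbd_kL kbd_kR kL_W kR_W)

lemma kL_ract: "kL a (ract r u) = ract r (kL a u)"
proof -
  have "kL a (kL b (kR c u)) = kL b (kR c (kL a u))" for b c
    by (simp add: kL_kL kL_kR mult.commute flip: kL_kR)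
  then show ?thesis by (simp add: ract_def frag_extend_sum')
qed

lemma kR_ract: "kR a (ract r u) = ract r (kR a u)"
proof -
  have "kR a (kL b (kR c u)) = kL b (kR c (kR a u))" for b c
    by (simp add: kL_kR[symmetric] kR_kR mult.commute)
  then show ?thesis by (simp add: ract_def frag_extend_sum')
qed

lemma kL_0: "kL 0 u \<approx>K 0"
  using kL_param[of 0 0 u] by (simp add: eqm_def) (metis gensub_uminus minus_minus)

lemma ract_superset:
  assumes "finite A" "Poly_Mapping.keys r \<subseteq> A"
  shows "ract r u \<approx>K (\<Sum>m\<in>A. kL (Poly_Mapping.lookup r m) (kR (mon (Poly_Mapping.lookup m)) u))"
proof -
  let ?f = "\<lambda>m. kL (Poly_Mapping.lookup r m) (kR (mon (Poly_Mapping.lookup m)) u)"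
  have "sum ?f (A - Poly_Mapping.keys r) \<approx>K (\<Sum>m\<in>A - Poly_Mapping.keys r. 0)"
    by (rule eqm_sum) (auto simp: in_keys_iff kL_0)
  then have "ract r u + 0 \<approx>K sum ?f (Poly_Mapping.keys r) + sum ?f (A - Poly_Mapping.keys r)"
    unfolding ract_def by (intro eqm_add eqm_refl) (simp add: eqm_sym)
  also have "\<dots> = sum ?f A"
    using sum.subset_diff[OF assms(2,1), of ?f] by (simp add: add.commute)
  finally show ?thesis by simp
qed

lemma ract_add: "ract (r + s) u \<approx>K ract r u + ract s u"
proof -
  let ?A = "Poly_Mapping.keys r \<union> Poly_Mapping.keys s"
  let ?f = "\<lambda>r m. kL (Poly_Mapping.lookup r m) (kR (mon (Poly_Mapping.lookup m)) u)"
  have "ract (r + s) u \<approx>K sum (?f (r + s)) ?A"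
    by (rule ract_superset) (auto simp: keys_add)
  also have "\<dots> \<approx>K (\<Sum>m\<in>?A. ?f r m + ?f s m)"
    unfolding lookup_add by (intro eqm_sum kL_param)
  also have "\<dots> = sum (?f r) ?A + sum (?f s) ?A" by (rule sum.distrib)
  also have "\<dots> \<approx>K ract r u + ract s u"
    by (intro eqm_add eqm_sym[OF ract_superset]) auto
  finally show ?thesis .
qed

lemma ract_diff: "ract (r - s) u \<approx>K ract r u - ract s u"
proof -
  have "ract (r - s) u + ract s u \<approx>K ract r u"
    using ract_add[of "r - s" s u] by (simp add: eqm_sym)
  then have "ract (r - s) u + ract s u - ract s u \<approx>K ract r u - ract s u"
    by (intro eqm_diff eqm_refl)
  then show ?thesis by simp
qed

lemma ract_single: "ract (Poly_Mapping.single m a) u \<approx>K kL a (kR (mon (Poly_Mapping.lookup m)) u)"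
  by (cases "a = 0") (simp_all add: ract_def eqm_sym kL_0)

lemma ract_mult: "ract (r * s) u \<approx>K ract r (ract s u)"
proof (induction r rule: poly_mapping_add_induct)
  case (single m a)
  show ?case
  proof (induction s rule: poly_mapping_add_induct)
    case (single k b)
    have "mon (Poly_Mapping.lookup (m + k)) = mon (Poly_Mapping.lookup m) * mon (Poly_Mapping.lookup k)"
      by (simp add: lookup_add[abs_def] flip: mon_add)
    then have "ract (Poly_Mapping.single m a * Poly_Mapping.single k b) u \<approx>K
        kL (a * b) (kR (mon (Poly_Mapping.lookup m) * mon (Poly_Mapping.lookup k)) u)"
      using ract_single[of "m + k" "a * b" u] by (simp add: mult_single)
    also have "\<dots> = kL a (kR (mon (Poly_Mapping.lookup m)) (kL b (kR (mon (Poly_Mapping.lookup k)) u)))"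
      by (simp add: kL_kR kR_kR kL_kL flip: kL_kL kR_kR)
    also have "\<dots> \<approx>K kL a (kR (mon (Poly_Mapping.lookup m)) (ract (Poly_Mapping.single k b) u))"
      by (intro kL_cong kR_cong eqm_sym[OF ract_single])
    also have "\<dots> \<approx>K ract (Poly_Mapping.single m a) (ract (Poly_Mapping.single k b) u)"
      by (rule eqm_sym[OF ract_single])
    finally show ?case .
  next
    case (add F G)
    let ?m = "Poly_Mapping.single m a"
    have "ract (?m * (F + G)) u \<approx>K ract (?m * F) u + ract (?m * G) u"
      unfolding distrib_left by (rule ract_add)
    also have "\<dots> \<approx>K ract ?m (ract F u) + ract ?m (ract G u)" by (intro eqm_add add)
    also have "\<dots> = ract ?m (ract F u + ract G u)" by (simp add: ract_plus)
    also have "\<dots> \<approx>K ract ?m (ract (F + G) u)" by (intro ract_cong eqm_sym[OF ract_add])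
    finally show ?case .
  qed simp
next
  case (add F G)
  have "ract ((F + G) * s) u \<approx>K ract (F * s) u + ract (G * s) u"
    unfolding distrib_right by (rule ract_add)
  also have "\<dots> \<approx>K ract F (ract s u) + ract G (ract s u)" by (intro eqm_add add)
  also have "\<dots> \<approx>K ract (F + G) (ract s u)" by (rule eqm_sym[OF ract_add])
  finally show ?case .
qed simp

lemma ract_lft: "ract (lft a) u \<approx>K kL a u"
proof -
  have "ract (lft a) u \<approx>K kL a (kR 1 u)"
    using ract_single[of 0 a u] mon_0 by (simp add: lookup_zero[abs_def])
  also have "\<dots> \<approx>K kL a u" by (intro kL_cong kR_1)
  finally show ?thesis .
qed

lemma ract_yhom: "ract (yhom f) u \<approx>K kR f u"
proof (induction f rule: mon_induct)
  case (mon l)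
  have "mon (Poly_Mapping.lookup (restr l)) = mon l" by (rule mon_cong) (simp add: lookup_restr)
  then have "ract (yhom (mon l)) u \<approx>K kL 1 (kR (mon l) u)"
    using ract_single[of "restr l" 1 u] by (simp add: yhom_mon_single)
  also have "\<dots> \<approx>K kR (mon l) u" by (rule kL_1)
  finally show ?case .
next
  case (add x y)
  have "ract (yhom (x + y)) u \<approx>K ract (yhom x) u + ract (yhom y) u"
    unfolding yhom_add by (rule ract_add)
  also have "\<dots> \<approx>K kR x u + kR y u" by (intro eqm_add add)
  also have "\<dots> \<approx>K kR (x + y) u" by (rule eqm_sym[OF kR_param])
  finally show ?case .
next
  case (scale c x)
  have "ract (yhom (sS c x)) u \<approx>K ract (lft (sc c)) (ract (yhom x) u)"
    unfolding yhom_scale by (rule ract_mult)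
  also have "\<dots> \<approx>K ract (lft (sc c)) (kR x u)" by (intro ract_cong scale)
  also have "\<dots> \<approx>K kL (sc c) (kR x u)" by (rule ract_lft)
  also have "\<dots> \<approx>K kR (sc c) (kR x u)" by (rule eqm_sym[OF kR_sc])
  also have "\<dots> = kR (sS c x) u" by (simp add: kR_kR scale_sc[of c x])
  finally show ?case .
qed

lemma ract_var_diff:
  assumes "i \<in> {1..n}"
  shows "kL (\<iota> (v i)) u - kR (\<iota> (v i)) u \<approx>K ract (xvar i - yvar i) u"
proof -
  have "ract (yvar i) u \<approx>K kR (\<iota> (v i)) u"
    using ract_yhom[of "\<iota> (v i)" u] assms by (simp add: yhom_vec yvec_basis)
  then have "ract (xvar i) u - ract (yvar i) u \<approx>K kL (\<iota> (v i)) u - kR (\<iota> (v i)) u"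
    by (intro eqm_diff ract_lft)
  with ract_diff have "ract (xvar i - yvar i) u \<approx>K kL (\<iota> (v i)) u - kR (\<iota> (v i)) u"
    by (rule eqm_trans)
  then show ?thesis by (rule eqm_sym)
qed

text \<open>The closed form of \<open>\<Psi>\<close>, one index at a time: \<open>Plg t\<close> sums over the index sequences whose first
  index exceeds \<open>t\<close>. Its list lacks the left factor; the last entry is the right factor.\<close>

fun Plg :: "nat \<Rightarrow> 's list \<Rightarrow> 's list \<times> 'v list \<Rightarrow>\<^sub>0 int" where
  "Plg t [] = 0"
| "Plg t [b] = frag_of ([1, b], [])"
| "Plg t (f # y # ys) = (\<Sum>i\<in>{t<..n}. ract (dq i f) (W (v i) (Plg i (y # ys))))"

abbreviation "Pl t \<equiv> frag_extend (Plg t)"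

definition psig :: "'s list \<Rightarrow> 's list \<times> 'v list \<Rightarrow>\<^sub>0 int" where
  "psig xs = (case xs of [] \<Rightarrow> 0 | a # ys \<Rightarrow> kL a (Plg 0 ys))"

abbreviation "psi \<equiv> frag_extend psig"

lemma psig_simps [simp]: "psig [] = 0" "psig (a # ys) = kL a (Plg 0 ys)"
  by (simp_all add: psig_def)

lemma Plg_Cons: "ys \<noteq> [] \<Longrightarrow> Plg t (f # ys) = (\<Sum>i\<in>{t<..n}. ract (dq i f) (W (v i) (Plg i ys)))"
  by (cases ys) simp_all

lemma Pl_cn: "Pl t (cn f u) = (\<Sum>i\<in>{t<..n}. ract (dq i f) (W (v i) (Pl i u)))"
proof (induction u rule: frag_induct)
  case (one xs)
  show ?case by (cases xs) simp_all
qed (simp_all add: frag_lin ract_minus sum_subtractf)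

lemma psi_cn: "psi (cn a u) = kL a (Pl 0 u)"
proof (induction u rule: frag_induct)
  case (one xs)
  show ?case by (cases xs) simp_all
qed (simp_all add: frag_lin)

lemma Pl_aR: "Pl t (aR b u) = kR b (Pl t u)"
proof (induction u arbitrary: t rule: frag_induct)
  case (one xs)
  show ?case
  proof (induction xs arbitrary: t rule: list_ops_induct)
    case (3 x r)
    then show ?case
      by (simp add: frag_Cons aR_cn Pl_cn frag_extend_sum' kR_ract kR_W del: frag_extend_of)
  qed simp_all
qed (simp_all add: frag_lin)

lemma psi_aL: "psi (aL a u) = kL a (psi u)"
proof (induction u rule: frag_induct)
  case (one xs)
  show ?case by (cases xs) (simp_all add: kL_kL)
qed (simp_all add: frag_lin)

lemma psi_aR: "psi (aR b u) = kR b (psi u)"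
proof (induction u rule: frag_induct)
  case (one xs)
  show ?case
  proof (induction xs rule: list_ops_induct)
    case (3 x r)
    have "psi (aR b (cn x (frag_of r))) = kR b (psi (cn x (frag_of r)))"
      by (simp only: aR_cn psi_cn Pl_aR kL_kR)
    then show ?case by (simp only: frag_Cons[OF 3(1)])
  qed simp_all
qed (simp_all add: frag_lin)

lemma Plg_add: "Plg t (A @ (x + y) # C) \<approx>K Plg t (A @ x # C) + Plg t (A @ y # C)"
proof (induction A arbitrary: t)
  case Nil
  show ?case
  proof (cases "C = []")
    case True
    then show ?thesis using K_addR[of 1 x y "[]"] by simp
  next
    case False
    then show ?thesis
      by (simp add: Plg_Cons dq_add sum.distrib[symmetric]) (intro eqm_sum ract_add)
  qed
next
  case (Cons a A)
  have "(\<Sum>i\<in>{t<..n}. ract (dq i a) (W (v i) (Plg i (A @ (x + y) # C)))) \<approx>K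
    (\<Sum>i\<in>{t<..n}. ract (dq i a) (W (v i) (Plg i (A @ x # C) + Plg i (A @ y # C))))"
    by (intro eqm_sum ract_cong W_cong Cons)
  then show ?case by (simp add: Plg_Cons frag_lin ract_plus sum.distrib)
qed

lemma Plg_scale: "Plg t (A @ sS c x # C) \<approx>K kL (sc c) (Plg t (A @ x # C))"
proof (induction A arbitrary: t)
  case Nil
  show ?case
  proof (cases "C = []")
    case True
    then show ?thesis using K_scaleR[of 1 c x "[]"] by simp
  next
    case False
    have "ract (lft (sc c) * r) u \<approx>K kL (sc c) (ract r u)" for r u
      using ract_mult ract_lft by (rule eqm_trans)
    then show ?thesis using False
      by (simp add: Plg_Cons dq_scale frag_extend_sum') (intro eqm_sum)
  qed
next
  case (Cons a A)
  have "(\<Sum>i\<in>{t<..n}. ract (dq i a) (W (v i) (Plg i (A @ sS c x # C)))) \<approx>K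
    (\<Sum>i\<in>{t<..n}. ract (dq i a) (W (v i) (kL (sc c) (Plg i (A @ x # C)))))"
    by (intro eqm_sum ract_cong W_cong Cons)
  also have "\<dots> = kL (sc c) (\<Sum>i\<in>{t<..n}. ract (dq i a) (W (v i) (Plg i (A @ x # C))))"
    by (simp add: frag_extend_sum' kL_ract kL_W)
  finally show ?case by (simp add: Plg_Cons)
qed

lemma resp_Pl: "resp bar_rels kos_rels (Plg t)"
  by (rule resp_bar[where scl = "\<lambda>c. kL (sc c)"]) (simp_all add: Plg_add Plg_scale)

lemma resp_psi: "resp bar_rels kos_rels psig"
proof (rule resp_bar[where scl = "\<lambda>c. kL (sc c)"])
  fix A C x y and c :: 'k
  show "psig (A @ (x + y) # C) \<approx>K psig (A @ x # C) + psig (A @ y # C)"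
  proof (cases A)
    case (Cons a A')
    have "kL a (Plg 0 (A' @ (x + y) # C)) \<approx>K kL a (Plg 0 (A' @ x # C) + Plg 0 (A' @ y # C))"
      by (intro kL_cong Plg_add)
    then show ?thesis using Cons by (simp add: frag_lin)
  qed (simp add: kL_param)
  show "psig (A @ sS c x # C) \<approx>K kL (sc c) (psig (A @ x # C))"
  proof (cases A)
    case Nil
    then show ?thesis by (simp add: kL_kL flip: scale_sc)
  next
    case (Cons a A')
    have "kL a (Plg 0 (A' @ sS c x # C)) \<approx>K kL a (kL (sc c) (Plg 0 (A' @ x # C)))"
      by (intro kL_cong Plg_scale)
    then show ?thesis using Cons by (simp add: kL_kL mult.commute)
  qed
qed simp

lemmas Pl_cong = resp_eqm[OF resp_Pl]

text \<open>The differential removes the vector of the first index i or a later one. Removing the first leaves the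
  factor (x_i - y_i) D_i f, a difference of consecutive substitutions. Abel summation over i shifts this
  difference onto the remaining sum, which starts at i; what comes out of it combines with the
  induction hypothesis by the Leibniz rule into the term with f and its right neighbour multiplied.\<close>

lemma kbd_Plg:
  assumes "t \<le> n"
  shows "kbd (Plg t xs) \<approx>K (case xs of [] \<Rightarrow> 0 | f # ys \<Rightarrow> ract (sub t f) (Plg t ys)) - Pl t (bdg xs)"
  using assms
proof (induction xs arbitrary: t rule: list_ops_induct)
  case (3 f ys)
  let ?P = "\<lambda>i. Plg i ys"
  let ?X = "\<lambda>i. ract (dq i f) (W (v i) (Pl i (bdg ys)))"
  define g where "g i = ract (sub i f) (?P i)" for i
  have first: "ract (dq i f) (kL (\<iota> (v i)) u - kR (\<iota> (v i)) u) \<approx>K ract (sub (i - 1) f) u - ract (sub i f) u"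
    if "i \<in> {t<..n}" for i u
  proof -
    have i: "i \<in> {1..n}" using that by auto
    have "ract (dq i f) (kL (\<iota> (v i)) u - kR (\<iota> (v i)) u) \<approx>K ract (dq i f) (ract (xvar i - yvar i) u)"
      by (intro ract_cong ract_var_diff i)
    also have "\<dots> \<approx>K ract (dq i f * (xvar i - yvar i)) u" by (rule eqm_sym[OF ract_mult])
    also have "\<dots> = ract (sub (i - 1) f - sub i f) u"
      using dq_telescope[OF i, of f] by (simp add: mult.commute)
    also have "\<dots> \<approx>K ract (sub (i - 1) f) u - ract (sub i f) u" by (rule ract_diff)
    finally show ?thesis .
  qed
  have expand: "kbd (Plg t (f # ys)) = (\<Sum>i\<in>{t<..n}.
      ract (dq i f) (kL (\<iota> (v i)) (?P i) - kR (\<iota> (v i)) (?P i)) - ract (dq i f) (W (v i) (kbd (?P i))))"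
    using 3(1) by (simp add: Plg_Cons frag_extend_sum' kbd_ract kbd_W ract_minus)
  have bdf: "bdg (f # ys) = aL f (frag_of ys) - cn f (bdg ys)" using 3(1) by (simp add: bdg_Cons)
  have PX: "Pl t (cn f (bdg ys)) = (\<Sum>i\<in>{t<..n}. ?X i)" by (simp add: Pl_cn)
  show ?case
  proof (cases "tl ys = []")
    case True
    then obtain b where ys: "ys = [b]" using 3(1) by (cases ys) auto
    have "kbd (Plg t (f # ys)) \<approx>K (\<Sum>i\<in>{t<..n}. (g (i - 1) - g i) - 0)"
      unfolding expand
    proof (intro eqm_sum eqm_diff)
      fix i assume "i \<in> {t<..n}"
      then show "ract (dq i f) (kL (\<iota> (v i)) (?P i) - kR (\<iota> (v i)) (?P i)) \<approx>K g (i - 1) - g i"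
        using first[of i "?P i"] by (simp add: g_def ys)
    qed (simp add: ys)
    also have "\<dots> = g t - ract (yhom f) (?P t)"
      using sum_telescope_greaterThanAtMost[OF 3(3), of g] by (simp add: g_def sub_last ys)
    also have "\<dots> \<approx>K g t - kR f (?P t)" by (intro eqm_diff eqm_refl ract_yhom)
    finally show ?thesis by (simp add: ys g_def mult.commute)
  next
    case False
    then obtain h r where ys: "ys = h # r" "r \<noteq> []" using 3(1) by (cases ys) auto
    let ?Y = "\<lambda>i. ract (dq i (f * h)) (W (v i) (Plg i r))"
    have trm: "ract (dq i f) (kL (\<iota> (v i)) (?P i) - kR (\<iota> (v i)) (?P i)) - ract (dq i f) (W (v i) (kbd (?P i)))
      \<approx>K (g (i - 1) - g i) - ?Y i + ?X i" if i: "i \<in> {t<..n}" for i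
    proof -
      let ?Q = "W (v i) (Plg i r)"
      have i1: "i \<in> {1..n}" using i by auto
      have "{i - 1<..n} = insert i {i<..n}" using i by auto
      then have "?P (i - 1) = ract (dq i h) ?Q + ?P i" using ys by (simp add: Plg_Cons)
      then have Pi: "ract (sub (i - 1) f) (?P i) = g (i - 1) - ract (sub (i - 1) f) (ract (dq i h) ?Q)"
        by (simp add: g_def ract_plus)
      have "ract (dq i f) (W (v i) (kbd (?P i))) \<approx>K
          ract (dq i f) (W (v i) (ract (sub i h) (Plg i r) - Pl i (bdg ys)))"
        using 3(2)[of i] i ys by (intro ract_cong W_cong) simp
      also have "\<dots> = ract (dq i f) (ract (sub i h) ?Q) - ?X i"
        by (simp add: frag_lin W_ract ract_minus)
      finally have B: "ract (dq i f) (W (v i) (kbd (?P i))) \<approx>K ract (dq i f) (ract (sub i h) ?Q) - ?X i" .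
      \<comment> \<open>One summand arises from shifting the difference onto the next sum, the other one is the
        leading term of the induction hypothesis.\<close>
      have Y: "?Y i = ract (sub (i - 1) f * dq i h + dq i f * sub i h) ?Q"
        by (simp add: dq_mult[OF i1] add.commute)
      have C: "?Y i \<approx>K ract (sub (i - 1) f) (ract (dq i h) ?Q) + ract (dq i f) (ract (sub i h) ?Q)"
        unfolding Y by (rule eqm_trans[OF ract_add eqm_add[OF ract_mult ract_mult]])
      have "ract (dq i f) (kL (\<iota> (v i)) (?P i) - kR (\<iota> (v i)) (?P i)) - ract (dq i f) (W (v i) (kbd (?P i)))
        \<approx>K (ract (sub (i - 1) f) (?P i) - ract (sub i f) (?P i)) - (ract (dq i f) (ract (sub i h) ?Q) - ?X i)"
        by (intro eqm_diff first[OF i] B)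
      also have "\<dots> = (g (i - 1) - g i) -
          (ract (sub (i - 1) f) (ract (dq i h) ?Q) + ract (dq i f) (ract (sub i h) ?Q)) + ?X i"
        by (simp add: Pi g_def)
      also have "\<dots> \<approx>K (g (i - 1) - g i) - ?Y i + ?X i"
        by (intro eqm_add eqm_diff eqm_refl eqm_sym[OF C])
      finally show ?thesis .
    qed
    have "kbd (Plg t (f # ys)) \<approx>K (\<Sum>i\<in>{t<..n}. (g (i - 1) - g i) - ?Y i + ?X i)"
      unfolding expand by (intro eqm_sum trm)
    also have "\<dots> = g t - g n - Plg t ((f * h) # r) + (\<Sum>i\<in>{t<..n}. ?X i)"
      using sum_telescope_greaterThanAtMost[OF 3(3), of g] ys(2)
      by (simp add: sum.distrib sum_subtractf Plg_Cons)
    also have "\<dots> = ract (sub t f) (?P t) - (Plg t ((f * h) # r) - (\<Sum>i\<in>{t<..n}. ?X i))"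
    proof -
      have "g n = 0" using ys by (simp add: g_def Plg_Cons)
      then show ?thesis by (simp add: g_def)
    qed
    also have "\<dots> = ract (sub t f) (?P t) - Pl t (bdg (f # ys))"
      unfolding bdf frag_lin PX by (simp add: ys)
    finally show ?thesis by simp
  qed
qed simp_all

lemma kbd_psi: "kbd (psi u) \<approx>K psi (bd u)"
proof -
  have "kbd (psig xs) \<approx>K psi (bdg xs)" for xs
  proof (cases xs)
    case (Cons a ys)
    have "kbd (psig xs) \<approx>K kL a ((case ys of [] \<Rightarrow> 0 | f # r \<Rightarrow> ract (sub 0 f) (Plg 0 r)) - Pl 0 (bdg ys))"
      using Cons by (simp only: psig_simps kbd_kL) (intro kL_cong kbd_Plg le0)
    also have "\<dots> \<approx>K psi (bdg xs)"
    proof (cases ys)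
      case Nil
      then show ?thesis by (simp add: Cons)
    next
      case (Cons f r)
      have "kL a (ract (lft f) (Plg 0 r) - Pl 0 (bdg ys)) \<approx>K kL a (kL f (Plg 0 r) - Pl 0 (bdg ys))"
        by (intro kL_cong eqm_diff ract_lft eqm_refl)
      then show ?thesis
        using Cons \<open>xs = a # ys\<close> by (simp add: sub_first frag_lin kL_kL psi_cn)
    qed
    finally show ?thesis .
  qed simp
  then show ?thesis unfolding frag_extend_extend by (intro frag_extend_eqm)
qed

section \<open>Wedges of increasing basis vectors span\<close>

definition incr_wedges :: "nat \<Rightarrow> ('s list \<times> 'v list \<Rightarrow>\<^sub>0 int) set" where
  "incr_wedges t = {frag_of ([a, b], map v is) | a b is. set is \<subseteq> {t<..n} \<and> sorted_wrt (<) is}"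

lemma incr_wedgesI: "set is \<subseteq> {t<..n} \<Longrightarrow> sorted_wrt (<) is \<Longrightarrow> frag_of ([a, b], map v is) \<in> gensub (kos_rels \<union> incr_wedges t)"
  by (rule gensub.base) (auto simp: incr_wedges_def)

lemma gensub_eqK:
  assumes "u \<approx>K w" "w \<in> gensub (kos_rels \<union> S)" shows "u \<in> gensub (kos_rels \<union> S)"
proof -
  have "eqm (kos_rels \<union> S) u w" using assms(1) by (rule eqm_mono) (auto intro: gensub.base)
  then have "u - w \<in> gensub (kos_rels \<union> S)" by (simp add: eqm_def)
  from gensub_add[OF this assms(2)] show ?thesis by simp
qed

lemma gensub_map:
  assumes "resp kos_rels kos_rels g" "\<And>r. r \<in> S \<Longrightarrow> frag_extend g r \<in> gensub (kos_rels \<union> S')"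
    and "u \<in> gensub (kos_rels \<union> S)"
  shows "frag_extend g u \<in> gensub (kos_rels \<union> S')"
  using assms(3)
proof induction
  case (base x)
  show ?case
  proof (cases "x \<in> S")
    case False
    then have "frag_extend g x \<approx>K 0" using base assms(1) by (auto simp: resp_def)
    then show ?thesis by (rule gensub_eqK) (rule gensub.zero)
  qed (rule assms(2))
qed (auto simp: frag_extend_diff intro: gensub.intros)

text \<open>Insertion sort with signs.\<close>

lemma W_sorted:
  assumes "i \<in> {t<..n}" "set is \<subseteq> {t<..n}" "sorted_wrt (<) is"
  shows "W (v i) (frag_of ([a, b], map v is)) \<in> gensub (kos_rels \<union> incr_wedges t)"
  using assms
proof (induction "is" arbitrary: t)
  case Nil
  then show ?case using incr_wedgesI[of "[i]" t a b] by simp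
next
  case (Cons j js)
  let ?f = "frag_of ([a, b], map v js)"
  consider "i < j" | "i = j" | "j < i" by linarith
  then show ?case
  proof cases
    case 1
    then show ?thesis using incr_wedgesI[of "i # j # js" t a b] Cons.prems by fastforce
  next
    case 2
    then have "W (v i) (frag_of ([a, b], map v (j # js))) \<approx>K 0"
      using K_alt[of a b "[]" "v i" "[]"] by simp
    then show ?thesis by (rule gensub_eqK) (rule gensub.zero)
  next
    case 3
    have "W (v i) ?f \<in> gensub (kos_rels \<union> incr_wedges j)"
      using Cons.prems 3 by (intro Cons.IH) auto
    then have "W (v j) (W (v i) ?f) \<in> gensub (kos_rels \<union> incr_wedges t)"
    proof (rule gensub_map[OF resp_W, rotated])
      fix r assume "r \<in> incr_wedges j"
      then obtain a b ks where r: "r = frag_of ([a, b], map v ks)" "set ks \<subseteq> {j<..n}" "sorted_wrt (<) ks"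
        by (auto simp: incr_wedges_def)
      then show "W (v j) r \<in> gensub (kos_rels \<union> incr_wedges t)"
        using incr_wedgesI[of "j # ks" t a b] Cons.prems by fastforce
    qed
    then have "- W (v j) (W (v i) ?f) \<in> gensub (kos_rels \<union> incr_wedges t)" by (rule gensub_uminus)
    from gensub_eqK[OF W_anti this] show ?thesis by simp
  qed
qed

lemma W_incr_wedges:
  assumes "u \<in> gensub (kos_rels \<union> incr_wedges 0)" shows "W w u \<in> gensub (kos_rels \<union> incr_wedges 0)"
proof -
  let ?G = "gensub (kos_rels \<union> incr_wedges 0)"
  have W0: "W 0 u \<approx>K 0" for u
    using W_param[of 0 0 u] by (simp add: eqm_def) (metis gensub_uminus minus_minus)
  have kL: "kL a u \<in> ?G" if "u \<in> ?G" for a u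
    using that
  proof (rule gensub_map[OF resp_kL, rotated])
    fix r assume "r \<in> incr_wedges 0"
    then obtain b c ks where "r = frag_of ([b, c], map v ks)" "set ks \<subseteq> {0<..n}" "sorted_wrt (<) ks"
      unfolding incr_wedges_def by blast
    then show "kL a r \<in> ?G" using incr_wedgesI by simp
  qed
  have b: "W (v i) u \<in> ?G" if "i \<in> {1..n}" "u \<in> ?G" for i u
    using that(2)
  proof (rule gensub_map[OF resp_W, rotated])
    fix r assume "r \<in> incr_wedges 0"
    then show "W (v i) r \<in> ?G" using that(1) W_sorted[of i 0] by (fastforce simp: incr_wedges_def)
  qed
  have "w \<in> vs1.span (v ` {1..n})" using span by simp
  then show ?thesis
  proof (induction rule: vs1.span_induct_alt)
    case base
    show ?case by (rule gensub_eqK[OF W0 gensub.zero])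
  next
    case (step c x y)
    then obtain i where i: "i \<in> {1..n}" "x = v i" by blast
    have "W (sV c x + y) u \<approx>K kL (sc c) (W x u) + W y u"
      by (rule eqm_trans[OF W_param]) (intro eqm_add W_scale eqm_refl)
    moreover have "kL (sc c) (W x u) + W y u \<in> ?G"
      using i b assms step by (intro gensub_add kL) auto
    ultimately show ?case by (rule gensub_eqK)
  qed
qed

lemma kos_span: "u \<in> gensub (kos_rels \<union> incr_wedges 0)"
proof (induction u rule: frag_induct)
  case (one z)
  show ?case
  proof (cases z rule: kos_gen_cases)
    case (good a b ws)
    have "frag_of ([a, b], ws) \<in> gensub (kos_rels \<union> incr_wedges 0)"
    proof (induction ws)
      case Nil
      then show ?case using incr_wedgesI[of "[]" 0 a b] by simp
    next
      case (Cons w ws)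
      then show ?case using W_incr_wedges[of _ w] by fastforce
    qed
    then show ?thesis by (simp add: good)
  next
    case (bad xs ws)
    then show ?thesis by (auto simp: kos_rels_def intro!: gensub.base)
  qed
qed (auto intro: gensub.intros)

text \<open>Both maps respect the relations, and modulo these every chain is a combination of increasing wedges
  of basis vectors with coefficients in S^e.\<close>

lemma kos_eqm_basis:
  assumes "resp kos_rels N f" "resp kos_rels N g"
    and "\<And>a b is. set is \<subseteq> {1..n} \<Longrightarrow> sorted_wrt (<) is \<Longrightarrow> eqm N (f ([a, b], map v is)) (g ([a, b], map v is))"
  shows "eqm N (frag_extend f u) (frag_extend g u)"
proof -
  have "u \<in> gensub (kos_rels \<union> incr_wedges 0)" by (rule kos_span)
  then have "eqm N (frag_extend f u - frag_extend g u) 0"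
  proof induction
    case (base r)
    then show ?case
    proof
      assume "r \<in> kos_rels"
      then have "eqm N (frag_extend f r) 0" "eqm N (frag_extend g r) 0"
        using assms(1,2) by (auto simp: resp_def)
      then show ?thesis using eqm_diff by fastforce
    next
      have "{0<..n} = {1..n}" by auto
      moreover assume "r \<in> incr_wedges 0"
      ultimately show ?thesis using assms(3) by (auto simp: incr_wedges_def eqm_diff_zero)
    qed
  next
    case (diff x y)
    then show ?case using eqm_diff by (fastforce simp: frag_extend_diff algebra_simps)
  qed simp
  then show ?thesis by (simp add: eqm_diff_zero)
qed

end


lemma resp_diff: "resp R N f \<Longrightarrow> resp R N g \<Longrightarrow> resp R N (\<lambda>x. f x - g x)"
  unfolding resp_def frag_extend_diff_fun using eqm_diff by fastforce

lemma resp_id: "resp R R frag_of"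
  by (simp add: resp_def eqm_zero_iff gensub.base)

context sym_basis
begin

section \<open>Homogeneous elements\<close>

lemma tpow_gens_iff [simp]: "xs \<in> tpow_gens q \<longleftrightarrow> length xs = q"
  by (simp add: tpow_gens_def)

lemma tens_ext_gens_iff [simp]: "(xs, ws) \<in> tens_ext_gens q p \<longleftrightarrow> length xs = q \<and> length ws = p"
  by (simp add: tens_ext_gens_def)

lemma tpow_on:
  assumes "u \<in> frags_on (tpow_gens q)"
  shows aL_on: "aL a u \<in> frags_on (tpow_gens q)"
    and aR_on: "aR a u \<in> frags_on (tpow_gens q)"
    and cn_on: "cn x u \<in> frags_on (tpow_gens (Suc q))"
  by (rule frags_on_extend[OF assms]; auto simp: aLg_def aRg_def cng_def split: list.splits)+

lemma bdg_on: "length xs = Suc q \<Longrightarrow> bdg xs \<in> frags_on (tpow_gens q)"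
proof (induction xs arbitrary: q rule: list_ops_induct)
  case (3 x r)
  then obtain k where k: "q = Suc k" by (cases q) auto
  then show ?case using 3 by (simp add: bdg_Cons frags_on_diff aL_on cn_on del: frag_extend_of)
qed auto

lemma bd_on: "u \<in> frags_on (tpow_gens (Suc q)) \<Longrightarrow> bd u \<in> frags_on (tpow_gens q)"
  by (erule frags_on_extend) (simp add: bdg_on)

lemma kos_on:
  assumes "u \<in> frags_on (tens_ext_gens 2 p)"
  shows kL_on: "kL a u \<in> frags_on (tens_ext_gens 2 p)"
    and kR_on: "kR a u \<in> frags_on (tens_ext_gens 2 p)"
    and W_on: "W w u \<in> frags_on (tens_ext_gens 2 (Suc p))"
  by (rule frags_on_extend[OF assms]; auto simp: kLg_def kRg_def Wg_def)+

lemma kd_on: "length ws = Suc p \<Longrightarrow> kd a b ws \<in> frags_on (tens_ext_gens 2 p)"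
proof (induction ws arbitrary: p)
  case (Cons w ws)
  show ?case
  proof (cases p)
    case 0
    then show ?thesis using Cons by (simp add: frags_on_diff)
  next
    case (Suc k)
    then show ?thesis using Cons by (simp add: frags_on_diff W_on)
  qed
qed simp

lemma kbdg_on: "z \<in> tens_ext_gens 2 (Suc p) \<Longrightarrow> kbdg z \<in> frags_on (tens_ext_gens 2 p)"
  by (cases z rule: kos_gen_cases) (auto simp: kd_on)

lemma ract_on: "u \<in> frags_on (tens_ext_gens 2 p) \<Longrightarrow> ract r u \<in> frags_on (tens_ext_gens 2 p)"
  unfolding ract_def by (intro frags_on_sum kL_on kR_on)

lemma Plg_on: "length xs = Suc p \<Longrightarrow> Plg t xs \<in> frags_on (tens_ext_gens 2 p)"
proof (induction xs arbitrary: t p rule: list_ops_induct)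
  case (3 x r)
  then obtain k where k: "p = Suc k" by (cases p) auto
  then show ?case using 3 by (simp add: Plg_Cons frags_on_sum ract_on W_on)
qed auto

lemma psig_on: "xs \<in> tpow_gens (p + 2) \<Longrightarrow> psig xs \<in> frags_on (tens_ext_gens 2 p)"
  by (cases xs) (auto simp: kL_on Plg_on)

lemma psi_on: "u \<in> frags_on (tpow_gens (p + 2)) \<Longrightarrow> psi u \<in> frags_on (tens_ext_gens 2 p)"
  by (erule frags_on_extend) (rule psig_on)

section \<open>The comparison map back to the bar complex\<close>

text \<open>The chain map \<open>\<Phi>\<close>: an S^e-linear map is determined by its values on 1 \<otimes> 1 \<otimes> w, and there the
  required boundary \<open>\<Phi>(kbd(1 \<otimes> 1 \<otimes> w))\<close> is lifted along the contraction \<open>cn 1\<close>.\<close>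

primrec phi :: "nat \<Rightarrow> 's list \<times> 'v list \<Rightarrow> 's list \<Rightarrow>\<^sub>0 int" where
  "phi 0 z = (if length (fst z) = 2 \<and> snd z = [] then frag_of (fst z) else 0)"
| "phi (Suc p) z = (if length (fst z) = 2
     then aL (fst z ! 0) (aR (fst z ! 1) (cn 1 (frag_extend (phi p) (kd 1 1 (snd z))))) else 0)"

abbreviation "Ph p \<equiv> frag_extend (phi p)"

text \<open>The value on 1 \<otimes> 1 \<otimes> w without the leading 1 that the contraction puts in front.\<close>

definition phi_core :: "nat \<Rightarrow> 'v list \<Rightarrow> 's list \<Rightarrow>\<^sub>0 int" where
  "phi_core p ws = (case p of 0 \<Rightarrow> if ws = [] then frag_of [1] else 0 | Suc q \<Rightarrow> Ph q (kd 1 1 ws))"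

lemma phi_eq: "phi p ([a, b], ws) = aL a (aR b (cn 1 (phi_core p ws)))"
  by (cases p) (simp_all add: phi_core_def One_nat_def)

lemma phi_bad: "length xs \<noteq> 2 \<Longrightarrow> phi p (xs, ws) = 0"
  by (cases p) simp_all

lemma Ph_kL: "Ph p (kL a u) = aL a (Ph p u)"
  unfolding frag_extend_extend by (rule kos_eqI) (simp_all add: phi_eq phi_bad aL_aL)

lemma Ph_kR: "Ph p (kR a u) = aR a (Ph p u)"
  unfolding frag_extend_extend
  by (rule kos_eqI) (simp_all add: phi_eq phi_bad aL_aR[symmetric] aR_aR mult.commute)

text \<open>An S^e-linear map that is alternating and multilinear in w on the generators 1 \<otimes> 1 \<otimes> w
  respects all relations. In the recursion these properties come from those of the previous map.\<close>

lemma resp_phi: "resp kos_rels bar_rels (phi p)"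
proof (induction p)
  have free: "resp kos_rels bar_rels g"
    if g: "\<And>a b ws. g ([a, b], ws) = aL a (aR b (H ws))" and bad: "\<And>xs ws. length xs \<noteq> 2 \<Longrightarrow> g (xs, ws) = 0"
      and add: "\<And>A w w' C. H (A @ (w + w') # C) \<approx>B H (A @ w # C) + H (A @ w' # C)"
      and scl: "\<And>A w C c. H (A @ sV c w # C) \<approx>B aL (sc c) (H (A @ w # C))"
      and alt: "\<And>A w B C. H (A @ w # B @ w # C) \<approx>B 0"
    for g :: "'s list \<times> 'v list \<Rightarrow> 's list \<Rightarrow>\<^sub>0 int" and H
  proof (rule resp_kos)
    fix a a' b b' :: 's and ws w w' A B C and c :: 'k
    show "g ([a + a', b], ws) \<approx>B g ([a, b], ws) + g ([a', b], ws)"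
      unfolding g by (rule aL_param)
    show "g ([a, b + b'], ws) \<approx>B g ([a, b], ws) + g ([a, b'], ws)"
      unfolding g frag_extend_add[symmetric] by (intro aL_cong aR_param)
    show "g ([a, b], A @ (w + w') # C) \<approx>B g ([a, b], A @ w # C) + g ([a, b], A @ w' # C)"
      unfolding g frag_extend_add[symmetric] by (intro aL_cong aR_cong add)
    have "aL a (aR (sS c b) (H ws)) = aL a (aR (sc c) (aR b (H ws)))"
      by (simp add: aR_aR flip: scale_sc)
    also have "\<dots> \<approx>B aL a (aL (sc c) (aR b (H ws)))" by (intro aL_cong aR_sc)
    also have "\<dots> = aL (sS c a) (aR b (H ws))"
      by (simp add: aL_aL scale_sc[of c a] mult.commute)
    finally show "g ([a, sS c b], ws) \<approx>B g ([sS c a, b], ws)" unfolding g .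
    have "aL a (aR b (H (A @ sV c w # C))) \<approx>B aL a (aR b (aL (sc c) (H (A @ w # C))))"
      by (intro aL_cong aR_cong scl)
    also have "\<dots> = aL (sS c a) (aR b (H (A @ w # C)))"
      by (simp add: aL_aL scale_sc[of c a] mult.commute flip: aL_aR)
    finally show "g ([a, b], A @ sV c w # C) \<approx>B g ([sS c a, b], A @ w # C)" unfolding g .
    show "g ([a, b], A @ w # B @ w # C) \<approx>B 0"
      unfolding g using aL_cong[OF aR_cong[OF alt]] by simp
  qed (simp add: bad)
  {
    case 0
    show ?case by (rule free[where H = "\<lambda>ws. cn 1 (phi_core 0 ws)"])
      (simp_all add: phi_eq phi_bad phi_core_def del: phi.simps)
  next
    case (Suc p)
    note Pc = resp_eqm[OF Suc]
    let ?f = "\<lambda>ws. frag_of ([1, 1], ws) :: 's list \<times> 'v list \<Rightarrow>\<^sub>0 int"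
    have H: "cn 1 (phi_core (Suc p) ws) = cn 1 (Ph p (kbd (?f ws)))" for ws
      by (simp add: phi_core_def)
    show ?case
    proof (rule free[where H = "\<lambda>ws. cn 1 (phi_core (Suc p) ws)"])
      fix A B C w w' and c :: 'k
      show "cn 1 (phi_core (Suc p) (A @ (w + w') # C)) \<approx>B
          cn 1 (phi_core (Suc p) (A @ w # C)) + cn 1 (phi_core (Suc p) (A @ w' # C))"
        unfolding H frag_extend_add[symmetric] by (intro cn_cong Pc kbd_cong K_addW)
      have "?f (A @ sV c w # C) \<approx>K kL (sc c) (?f (A @ w # C))"
        using K_scaleW[of 1 1 A c w C] by simp
      then have "cn 1 (Ph p (kbd (?f (A @ sV c w # C)))) \<approx>B cn 1 (Ph p (kbd (kL (sc c) (?f (A @ w # C)))))"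
        by (intro cn_cong Pc kbd_cong)
      also have "\<dots> = cn 1 (aL (sc c) (Ph p (kbd (?f (A @ w # C)))))"
        by (simp only: kbd_kL Ph_kL)
      also have "\<dots> \<approx>B aL (sc c) (cn 1 (Ph p (kbd (?f (A @ w # C)))))" by (rule cn_aL_sc)
      finally show "cn 1 (phi_core (Suc p) (A @ sV c w # C)) \<approx>B aL (sc c) (cn 1 (phi_core (Suc p) (A @ w # C)))"
        unfolding H .
      show "cn 1 (phi_core (Suc p) (A @ w # B @ w # C)) \<approx>B 0"
        unfolding H using cn_cong[OF Pc[OF kbd_cong[OF K_alt]]] by simp
    qed (simp_all add: phi_eq phi_bad del: phi.simps)
  }
qed

lemmas Ph_cong = resp_eqm[OF resp_phi]

lemma kd_split: "kd a b ws = kL a (kR b (kd 1 1 ws))"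
  using kbd_kL[of a "kR b (frag_of ([1, 1], ws))"] kbd_kR[of b "frag_of ([1, 1], ws)"] by simp

text \<open>\<open>cn 1\<close> lifts cycles to chains with the given boundary; the chain that is lifted is a cycle by the
  previous degree and d d = 0.\<close>

lemma bd_Ph: "bd (Ph (Suc p) u) \<approx>B Ph p (kbd u)"
proof (induction p arbitrary: u)
  have step: "bd (Ph (Suc p) u) \<approx>B Ph p (kbd u)" if z: "\<And>ws. bd (Ph p (kd 1 1 ws)) \<approx>B 0" for p u
    unfolding frag_extend_extend
  proof (rule kos_eqmI)
    fix a b ws
    let ?X = "Ph p (kd 1 1 ws)"
    have "bd (phi (Suc p) ([a, b], ws)) = aL a (aR b (aL 1 ?X - cn 1 (bd ?X)))"
      by (simp add: phi_eq phi_core_def bd_aL bd_aR bd_cn del: phi.simps)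
    also have "\<dots> \<approx>B aL a (aR b (?X - cn 1 0))"
      by (intro aL_cong aR_cong eqm_diff aL_1 cn_cong z)
    also have "\<dots> = Ph p (kbdg ([a, b], ws))"
      by (simp add: Ph_kL[symmetric] Ph_kR[symmetric] kd_split[of a b])
    finally show "bd (phi (Suc p) ([a, b], ws)) \<approx>B Ph p (kbdg ([a, b], ws))" .
  qed (simp add: phi_bad del: phi.simps)
  {
    case 0
    have W0: "Ph 0 (W w u) = 0" for w u
      unfolding frag_extend_extend by (rule frag_extend_eq_0) (auto simp: Wg_def)
    have "bd (Ph 0 (kd 1 1 ws)) = 0" for ws
    proof (cases ws)
      case (Cons w ws')
      then show ?thesis by (cases ws') (simp_all add: frag_lin W0)
    qed simp
    then show ?case by (intro step) simp
  next
    case (Suc p)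
    show ?case
    proof (rule step)
      fix ws
      have "bd (Ph (Suc p) (kbd (frag_of ([1, 1], ws)))) \<approx>B Ph p (kbd (kbd (frag_of ([1, 1], ws))))"
        by (rule Suc)
      then show "bd (Ph (Suc p) (kd 1 1 ws)) \<approx>B 0" by (simp add: kbd_kbd del: frag_extend_of kgen_simps) simp
    qed
  }
qed

lemma phi_degree: "length ws \<noteq> p \<Longrightarrow> phi p (xs, ws) = 0"
proof (induction p arbitrary: xs ws)
  case (Suc p)
  have "Ph p (kd 1 1 ws) = 0"
  proof (cases "length ws")
    case 0
    then show ?thesis by simp
  next
    case (Suc q)
    have "kd 1 1 ws \<in> frags_on (tens_ext_gens 2 q)" by (rule kd_on[OF Suc])
    then show ?thesis
      using Suc Suc.prems Suc.IH
      by (intro frag_extend_eq_0) (fastforce simp: frags_on_def tens_ext_gens_def)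
  qed
  then show ?case by simp
qed simp

lemma phi_on: "z \<in> tens_ext_gens 2 p \<Longrightarrow> phi p z \<in> frags_on (tpow_gens (p + 2))"
proof (induction p arbitrary: z)
  case (Suc p)
  have "kd 1 1 (snd z) \<in> frags_on (tens_ext_gens 2 p)"
    using Suc.prems by (cases z) (auto simp: kd_on)
  then have "Ph p (kd 1 1 (snd z)) \<in> frags_on (tpow_gens (p + 2))"
    by (rule frags_on_extend) (rule Suc.IH)
  then show ?case by (simp add: aL_on aR_on cn_on)
qed (auto simp: tens_ext_gens_def)

lemma kd_sum: "kd a b ws = (\<Sum>i<length ws. frag_cmul ((-1) ^ i)
   (frag_of ([a * \<iota> (ws ! i), b], take i ws @ drop (i + 1) ws) -
    frag_of ([a, \<iota> (ws ! i) * b], take i ws @ drop (i + 1) ws)))"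
proof (induction ws)
  case (Cons w ws)
  have W: "W w (frag_cmul k u) = frag_cmul k (W w u)" for k u by (rule frag_extend_cmul)
  have neg: "frag_cmul ((-1) ^ Suc i) u = - frag_cmul ((-1) ^ i) u" for i and u :: "'z \<Rightarrow>\<^sub>0 int"
    by simp
  show ?case
    unfolding length_Cons sum.lessThan_Suc_shift
    by (simp add: Cons.IH frag_extend_sum' W frag_lin neg sum_negf One_nat_def del: minus_frag_cmul power_Suc)
qed simp

lemma ract_1: "ract 1 u \<approx>K u"
proof -
  have "ract (lft 1) u \<approx>K kL 1 u" by (rule ract_lft)
  also have "\<dots> \<approx>K u" by (rule kL_1)
  finally show ?thesis by simp
qed

lemma Pl_cn_var:
  assumes "j \<in> {1..n}"
  shows "Pl t (cn (\<iota> (v j)) u) \<approx>K (if t < j then W (v j) (Pl j u) else 0)"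
proof -
  let ?f = "\<lambda>i. W (v i) (Pl i u)"
  have "Pl t (cn (\<iota> (v j)) u) = (\<Sum>i\<in>{t<..n}. if i = j then ract 1 (?f j) else 0)"
    unfolding Pl_cn by (rule sum.cong) (use assms in \<open>auto simp: dq_var\<close>)
  also have "\<dots> = (if t < j then ract 1 (?f j) else 0)" using assms by simp
  also have "\<dots> \<approx>K (if t < j then ?f j else 0)" by (simp add: ract_1)
  finally show ?thesis .
qed

lemma Pl_cn_1: "Pl t (cn 1 u) = 0"
  unfolding Pl_cn by (rule sum.neutral) (auto simp: dq_one)

lemma frag_cmul_eqm_sum:
  assumes "\<And>i. i \<in> I \<Longrightarrow> eqm N (f i) (g i)"
  shows "eqm N (\<Sum>i\<in>I. frag_cmul (c i) (f i)) (\<Sum>i\<in>I. frag_cmul (c i) (g i))"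
  by (intro eqm_sum eqm_frag_cmul assms)

lemma phi_1: "phi p ([1, 1], ws) \<approx>B cn 1 (phi_core p ws)"
  unfolding phi_eq by (rule eqm_trans[OF aL_1 aR_1])

text \<open>Expanding \<open>\<Phi>\<close> gives one term for every position of the increasing wedge to be removed. A leading
  tensor factor v_i under \<open>\<Psi>\<close> selects the index i for the first vector and forces all later indices to be
  larger, so only the term that removes the first vector survives.\<close>

lemma Pl_phi_core:
  assumes "length is = p" "set is \<subseteq> {1..n}" "sorted_wrt (<) is"
  shows "Pl t (phi_core p (map v is)) \<approx>K (if is = [] \<or> t < hd is then frag_of ([1, 1], map v is) else 0)"
  using assms
proof (induction p arbitrary: t "is")
  case 0
  then show ?case by (simp add: phi_core_def)
next
  case (Suc p)
  let ?ws = "map v is"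
  let ?r = "\<lambda>m. take m is @ drop (m + 1) is"
  have r: "take m ?ws @ drop (m + 1) ?ws = map v (?r m)" for m
    by (simp add: take_map drop_map)
  have wm: "?ws ! m = v (is ! m)" if "m < Suc p" for m using that Suc.prems by simp
  have core: "phi_core (Suc p) ?ws = (\<Sum>m<Suc p. frag_cmul ((-1) ^ m)
     (aL (\<iota> (v (is ! m))) (phi p ([1, 1], map v (?r m))) - aR (\<iota> (v (is ! m))) (phi p ([1, 1], map v (?r m)))))"
  proof -
    have L: "Ph p (frag_of ([w, 1], ws)) = aL w (phi p ([1, 1], ws))"
      and R: "Ph p (frag_of ([1, w], ws)) = aR w (phi p ([1, 1], ws))" for w :: 's and ws :: "'v list"
      using Ph_kL[of p w "frag_of ([1, 1], ws)"] Ph_kR[of p w "frag_of ([1, 1], ws)"] by simp_all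
    have "phi_core (Suc p) ?ws = (\<Sum>m<Suc p. frag_cmul ((-1) ^ m)
       (Ph p (frag_of ([\<iota> (?ws ! m), 1], map v (?r m))) - Ph p (frag_of ([1, \<iota> (?ws ! m)], map v (?r m)))))"
      unfolding phi_core_def nat.case kd_sum r
      using Suc.prems(1) by (simp add: frag_extend_sum' frag_extend_cmul frag_lin del: frag_extend_of sum.lessThan_Suc)
    also have "\<dots> = (\<Sum>m<Suc p. frag_cmul ((-1) ^ m)
       (aL (\<iota> (v (is ! m))) (phi p ([1, 1], map v (?r m))) - aR (\<iota> (v (is ! m))) (phi p ([1, 1], map v (?r m)))))"
      by (rule sum.cong) (simp_all only: lessThan_iff wm L R)
    finally show ?thesis .
  qed
  have trm: "Pl t (aL (\<iota> (v (is ! m))) (phi p ([1, 1], map v (?r m))) -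
      aR (\<iota> (v (is ! m))) (phi p ([1, 1], map v (?r m)))) \<approx>K
      (if m = 0 then if t < hd is then frag_of ([1, 1], ?ws) else 0 else 0)" if m: "m < Suc p" for m
  proof -
    have "is ! m \<in> set is" using Suc.prems(1) m by simp
    then have im: "is ! m \<in> {1..n}" using Suc.prems(2) by blast
    let ?i = "is ! m" and ?c = "phi_core p (map v (?r m))"
    have lr: "length (?r m) = p" using Suc.prems m by simp
    have sr: "set (?r m) \<subseteq> {1..n}"
      using Suc.prems(2) set_take_subset[of m "is"] set_drop_subset[of "m + 1" "is"] by auto
    have so: "sorted_wrt (<) (?r m)"
    proof -
      have "is = take m is @ is ! m # drop (Suc m) is"
        using m Suc.prems(1) by (intro id_take_nth_drop) simp
      then have "sorted_wrt (<) (take m is @ is ! m # drop (Suc m) is)" using Suc.prems(3) by simp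
      then show ?thesis by (simp add: sorted_wrt_append flip: Suc_eq_plus1)
    qed
    have "Pl t (aL (\<iota> (v ?i)) (phi p ([1, 1], map v (?r m))) - aR (\<iota> (v ?i)) (phi p ([1, 1], map v (?r m)))) \<approx>K
       Pl t (aL (\<iota> (v ?i)) (cn 1 ?c) - aR (\<iota> (v ?i)) (cn 1 ?c))"
      by (intro Pl_cong eqm_diff aL_cong aR_cong phi_1)
    \<comment> \<open>The right action leaves the leading 1 in place, and difference quotients of 1 vanish.\<close>
    also have "\<dots> = Pl t (cn (\<iota> (v ?i)) ?c)"
      by (simp add: frag_lin aL_cn aR_cn Pl_cn_1)
    also have "\<dots> \<approx>K (if t < ?i then W (v ?i) (Pl ?i ?c) else 0)" by (rule Pl_cn_var[OF im])
    also have "\<dots> \<approx>K (if t < ?i then W (v ?i) (if ?r m = [] \<or> ?i < hd (?r m) then frag_of ([1, 1], map v (?r m)) else 0) else 0)"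
      using W_cong[OF Suc.IH[OF lr sr so, of ?i], of "v ?i"] by simp
    also have "\<dots> = (if m = 0 then if t < hd is then frag_of ([1, 1], ?ws) else 0 else 0)"
    proof -
      obtain i js where is_eq: "is = i # js" using Suc.prems by (cases "is") auto
      show ?thesis
      proof (cases m)
        case 0
        have "js = [] \<or> i < hd js" using Suc.prems(3) by (cases js) (auto simp: is_eq)
        then show ?thesis using 0 by (simp add: is_eq One_nat_def)
      next
        case (Suc k)
        have "k < length js" using m Suc Suc.prems(1) by (simp add: is_eq)
        then have "i < is ! m" using Suc.prems(3) Suc by (simp add: is_eq)
        moreover have "?r m = i # (take k js @ drop (Suc k) js)" by (simp add: is_eq Suc One_nat_def)
        ultimately show ?thesis using Suc by simp
      qed
    qed
    finally show ?thesis .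
  qed
  have ne: "is \<noteq> []" using Suc.prems by auto
  have "Pl t (phi_core (Suc p) ?ws) \<approx>K (\<Sum>m<Suc p. frag_cmul ((-1) ^ m)
      (if m = 0 then if t < hd is then frag_of ([1, 1], ?ws) else 0 else 0))"
    unfolding core frag_extend_sum' frag_extend_cmul
    by (intro frag_cmul_eqm_sum trm) simp
  also have "\<dots> = (\<Sum>m<Suc p. if m = 0 then if t < hd is then frag_of ([1, 1], ?ws) else 0 else 0)"
    by (rule sum.cong) auto
  also have "\<dots> = (if is = [] \<or> t < hd is then frag_of ([1, 1], ?ws) else 0)"
    using ne by (simp add: sum.delta del: sum.lessThan_Suc)
  finally show ?case .
qed

lemma psi_phi_basis:
  assumes "set is \<subseteq> {1..n}" "sorted_wrt (<) is" "length is = p"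
  shows "psi (phi p ([a, b], map v is)) \<approx>K frag_of ([a, b], map v is)"
proof -
  have "psi (phi p ([a, b], map v is)) = kL a (kR b (kL 1 (Pl 0 (phi_core p (map v is)))))"
    by (simp add: phi_eq psi_aL psi_aR psi_cn)
  also have "\<dots> \<approx>K kL a (kR b (kL 1 (frag_of ([1, 1], map v is))))"
  proof -
    have "is = [] \<or> 0 < hd is" using assms(1) by (cases "is") auto
    then show ?thesis
      using Pl_phi_core[OF assms(3,1,2), of 0] by (intro kL_cong kR_cong) simp
  qed
  finally show ?thesis by simp
qed

text \<open>The two sides are compared as maps on chains of all degrees, hence the cut-off \<open>g\<close> on the right-hand
  side: \<open>\<Phi>\<close> in degree \<open>p\<close> vanishes on the other degrees.\<close>

lemma psi_Ph:
  assumes "u \<in> frags_on (tens_ext_gens 2 p)"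
  shows "psi (Ph p u) \<approx>K u"
proof -
  define g where "g z = (if length (snd z) = p then frag_of z else 0)" for z :: "'s list \<times> 'v list"
  have g: "resp kos_rels kos_rels g"
    by (rule resp_kos) (auto simp: g_def K_bad K_addL K_addR K_addW K_scaleR K_scaleW K_alt)
  have "frag_extend (\<lambda>z. psi (phi p z)) u \<approx>K frag_extend g u"
  proof (rule kos_eqm_basis[OF resp_comp[OF resp_phi resp_psi] g])
    fix a b "is" assume "set is \<subseteq> {1..n}" "sorted_wrt (<) is"
    then show "psi (phi p ([a, b], map v is)) \<approx>K g ([a, b], map v is)"
      using psi_phi_basis[of "is" p a b] phi_degree[of "map v is" p "[a, b]"] by (auto simp: g_def)
  qed
  moreover have "frag_extend g u = frag_extend frag_of u"
    by (rule frag_extend_eq_on[OF assms]) (auto simp: g_def tens_ext_gens_def)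
  ultimately show ?thesis by (simp add: frag_extend_extend)
qed

section \<open>The homotopy on the bar complex\<close>

text \<open>The homotopy: on 1 \<otimes> m \<otimes> 1 the contraction is applied to \<open>\<Phi> \<Psi>\<close> minus the identity minus the
  previous homotopy after the differential, which is a cycle. In degree 0 it vanishes, as \<open>\<Phi>\<close> and
  \<open>\<Psi>\<close> are inverse there.\<close>

primrec htpy :: "nat \<Rightarrow> 's list \<Rightarrow> 's list \<Rightarrow>\<^sub>0 int" where
  "htpy 0 xs = 0"
| "htpy (Suc p) xs = (if 2 \<le> length xs then
     aL (hd xs) (aR (last xs) (cn 1 (Ph (Suc p) (psig (1 # butlast (tl xs) @ [1])) -
       frag_of (1 # butlast (tl xs) @ [1]) - frag_extend (htpy p) (bdg (1 # butlast (tl xs) @ [1]))))) else 0)"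

abbreviation "Htpy p \<equiv> frag_extend (htpy p)"

definition defect :: "nat \<Rightarrow> 's list \<Rightarrow> 's list \<Rightarrow>\<^sub>0 int" where
  "defect p xs = Ph (Suc p) (psig xs) - frag_of xs - Htpy p (bdg xs)"

lemma defect_extend: "frag_extend (defect p) u = Ph (Suc p) (psi u) - u - Htpy p (bd u)"
  by (simp add: defect_def[abs_def] frag_extend_diff_fun frag_extend_extend)

lemma htpy_eq: "htpy (Suc p) (a # m @ [b]) = aL a (aR b (cn 1 (defect p (1 # m @ [1]))))"
  by (simp add: defect_def)

lemma htpy_short: "length xs < 2 \<Longrightarrow> htpy p xs = 0"
  by (cases p) simp_all

lemma bar_gen_cases:
  obtains (good) a m b where "xs = a # m @ [b]" | (bad) "length xs < 2"
proof (cases "length xs < 2")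
  case False
  then obtain a r where "xs = a # r" "r \<noteq> []" by (cases xs) (auto simp: Suc_lessI)
  then show thesis using good by (metis append_butlast_last_id)
qed (rule bad)

lemma Htpy_aL: "Htpy p (aL a u) = aL a (Htpy p u)"
proof (cases p)
  case (Suc q)
  have "Htpy p (aLg a xs) = aL a (htpy p xs)" for xs
  proof (cases xs rule: bar_gen_cases)
    case (good x m b)
    then show ?thesis using Suc by (simp add: htpy_eq aL_aL del: htpy.simps)
  next
    case bad
    then show ?thesis by (cases xs) (simp_all add: htpy_short del: htpy.simps)
  qed
  then show ?thesis by (simp add: frag_extend_extend)
qed (simp add: frag_extend_eq_0)

lemma Htpy_aR: "Htpy p (aR b u) = aR b (Htpy p u)"
proof (cases p)
  case (Suc q)
  have "Htpy p (aRg b xs) = aR b (htpy p xs)" for xs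
  proof (cases xs rule: bar_gen_cases)
    case (good x m c)
    have "aRg b xs = frag_of (x # m @ [c * b])" using good by (simp add: aRg_def)
    then show ?thesis using Suc good
      by (simp add: htpy_eq aR_aR mult.commute del: htpy.simps flip: aL_aR)
  next
    case bad
    then show ?thesis by (cases xs) (simp_all add: htpy_short aRg_def del: htpy.simps)
  qed
  then show ?thesis by (simp add: frag_extend_extend)
qed (simp add: frag_extend_eq_0)

lemma defect_aL: "frag_extend (defect p) (aL a u) = aL a (frag_extend (defect p) u)"
  by (simp add: defect_extend frag_lin psi_aL Ph_kL bd_aL Htpy_aL)

lemma defect_aR: "frag_extend (defect p) (aR a u) = aR a (frag_extend (defect p) u)"
  by (simp add: defect_extend frag_lin psi_aR Ph_kR bd_aR Htpy_aR)

text \<open>The bar analogue of the criterion for S^e-linear maps: in the outer factors \<open>g\<close> is linear by its form.\<close>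

lemma resp_bar_free:
  assumes g: "\<And>a m b. g (a # m @ [b]) = aL a (aR b (H m))" and short: "\<And>xs. length xs < 2 \<Longrightarrow> g xs = 0"
    and add: "\<And>A x y C. H (A @ (x + y) # C) \<approx>B H (A @ x # C) + H (A @ y # C)"
    and scl: "\<And>A x C c. H (A @ sS c x # C) \<approx>B aL (sc c) (H (A @ x # C))"
  shows "resp bar_rels bar_rels g"
proof (rule resp_bar[where scl = "\<lambda>c. aL (sc c)"])
  fix A C :: "'s list" and x y :: 's and c :: 'k
  consider "A = []" "C = []" | D b where "A = []" "C = D @ [b]" | a D where "A = a # D" "C = []"
    | a D E b where "A = a # D" "C = E @ [b]"
    by (metis list.exhaust rev_exhaust)
  then show "g (A @ (x + y) # C) \<approx>B g (A @ x # C) + g (A @ y # C)"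
  proof cases
    case 2
    then show ?thesis by (simp add: g aL_param)
  next
    case 3
    have "aL a (aR (x + y) (H D)) \<approx>B aL a (aR x (H D) + aR y (H D))" by (intro aL_cong aR_param)
    then show ?thesis using 3 by (simp add: g frag_lin)
  next
    case 4
    have "aL a (aR b (H (D @ (x + y) # E))) \<approx>B aL a (aR b (H (D @ x # E) + H (D @ y # E)))"
      by (intro aL_cong aR_cong add)
    then show ?thesis using 4 g[of a "D @ (x + y) # E" b] g[of a "D @ x # E" b] g[of a "D @ y # E" b]
      by (simp add: frag_lin)
  qed (simp add: short)
  consider "A = []" "C = []" | D b where "A = []" "C = D @ [b]" | a D where "A = a # D" "C = []"
    | a D E b where "A = a # D" "C = E @ [b]"
    by (metis list.exhaust rev_exhaust)
  then show "g (A @ sS c x # C) \<approx>B aL (sc c) (g (A @ x # C))"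
  proof cases
    case 2
    then show ?thesis by (simp add: g aL_aL flip: scale_sc)
  next
    case 3
    have "aL a (aR (sS c x) (H D)) = aL a (aR (sc c) (aR x (H D)))" by (simp add: aR_aR flip: scale_sc)
    also have "\<dots> \<approx>B aL a (aL (sc c) (aR x (H D)))" by (intro aL_cong aR_sc)
    finally show ?thesis using 3 by (simp add: g aL_aL mult.commute)
  next
    case 4
    have "aL a (aR b (H (D @ sS c x # E))) \<approx>B aL a (aR b (aL (sc c) (H (D @ x # E))))"
      by (intro aL_cong aR_cong scl)
    also have "\<dots> = aL (sc c) (aL a (aR b (H (D @ x # E))))"
      by (simp add: aL_aL mult.commute flip: aL_aR)
    finally show ?thesis using 4 g[of a "D @ sS c x # E" b] g[of a "D @ x # E" b] by simp
  qed (simp add: short)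
qed (simp add: short)

lemma resp_htpy: "resp bar_rels bar_rels (htpy p)"
proof (induction p)
  case 0
  show ?case by (simp add: resp_def frag_extend_eq_0)
next
  case (Suc p)
  have "resp bar_rels bar_rels (defect p)"
    unfolding defect_def[abs_def] by (intro resp_diff resp_id resp_comp[OF resp_psi resp_phi] resp_comp[OF resp_bd Suc])
  note gc = resp_eqm[OF this]
  show ?case
  proof (rule resp_bar_free[OF htpy_eq htpy_short])
    fix A C x y and c :: 'k
    have "frag_of (1 # A @ (x + y) # C @ [1]) \<approx>B frag_of (1 # A @ x # C @ [1]) + frag_of (1 # A @ y # C @ [1])"
      using B_add[of "1 # A" x y "C @ [1]"] by (simp only: append_Cons)
    from cn_cong[OF gc[OF this], of 1]
    show "cn 1 (defect p (1 # (A @ (x + y) # C) @ [1])) \<approx>B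
        cn 1 (defect p (1 # (A @ x # C) @ [1])) + cn 1 (defect p (1 # (A @ y # C) @ [1]))"
      by (simp only: frag_lin frag_extend_of append_assoc append_Cons)
    have "frag_of (1 # A @ sS c x # C @ [1]) \<approx>B aL (sc c) (frag_of (1 # A @ x # C @ [1]))"
      using B_scale[of "1 # A" c x "C @ [1]"] by (simp only: append_Cons)
    from cn_cong[OF gc[OF this], of 1]
    have "cn 1 (frag_extend (defect p) (frag_of (1 # A @ sS c x # C @ [1]))) \<approx>B
        cn 1 (frag_extend (defect p) (aL (sc c) (frag_of (1 # A @ x # C @ [1]))))" .
    also have "\<dots> = cn 1 (aL (sc c) (frag_extend (defect p) (frag_of (1 # A @ x # C @ [1]))))"
      by (simp only: defect_aL)
    also have "\<dots> \<approx>B aL (sc c) (cn 1 (frag_extend (defect p) (frag_of (1 # A @ x # C @ [1]))))"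
      by (rule cn_aL_sc)
    finally show "cn 1 (defect p (1 # (A @ sS c x # C) @ [1])) \<approx>B aL (sc c) (cn 1 (defect p (1 # (A @ x # C) @ [1])))"
      by (simp only: frag_extend_of append_assoc append_Cons)
  qed
qed

lemma Ph_psi_0:
  assumes "u \<in> frags_on (tpow_gens 2)" shows "Ph 0 (psi u) = u"
proof -
  have "frag_extend (\<lambda>xs. Ph 0 (psig xs)) u = frag_extend frag_of u"
  proof (rule frag_extend_eq_on[OF assms])
    fix xs :: "'s list" assume "xs \<in> tpow_gens 2"
    then obtain a b where "xs = [a, b]" by (auto simp: length_Suc_conv numeral_2_eq_2)
    then show "Ph 0 (psig xs) = frag_of xs" by simp
  qed
  then show ?thesis by (simp add: frag_extend_extend)
qed

text \<open>The contraction turns the defect \<open>defect p\<close> into a chain with this boundary as soon as the defect is a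
  cycle. For the latter the statement one degree lower is applied to boundaries; in the lowest degree
  it holds because \<open>\<Phi>\<close> and \<open>\<Psi>\<close> are inverse in degree 0.\<close>

lemma homotopy:
  assumes "u \<in> frags_on (tpow_gens (p + 3))"
  shows "Ph (Suc p) (psi u) - u - Htpy p (bd u) \<approx>B bd (Htpy (Suc p) u)"
  using assms
proof (induction p arbitrary: u)
  have main: "Ph (Suc p) (psi u) - u - Htpy p (bd u) \<approx>B bd (Htpy (Suc p) u)"
    if u: "u \<in> frags_on (tpow_gens (p + 3))"
      and z: "\<And>w. w \<in> frags_on (tpow_gens (p + 2)) \<Longrightarrow> bd w = 0 \<Longrightarrow> Ph p (psi w) - w - bd (Htpy p w) \<approx>B 0"
    for p u
  proof -
    have "frag_extend (defect p) u \<approx>B frag_extend (\<lambda>xs. bd (htpy (Suc p) xs)) u"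
    proof (rule frag_extend_eqm_on[OF u])
      fix xs :: "'s list" assume xs: "xs \<in> tpow_gens (p + 3)"
      then obtain a m b where x: "xs = a # m @ [b]" by (cases xs rule: bar_gen_cases) auto
      let ?f = "frag_of (1 # m @ [1]) :: 's list \<Rightarrow>\<^sub>0 int"
      have fon: "?f \<in> frags_on (tpow_gens (Suc (p + 2)))" using xs x by simp
      let ?g = "frag_extend (defect p) ?f"
      have "bd ?g = bd (Ph (Suc p) (psi ?f)) - bd ?f - bd (Htpy p (bd ?f))"
        by (simp only: defect_extend frag_lin)
      also have "\<dots> \<approx>B Ph p (psi (bd ?f)) - bd ?f - bd (Htpy p (bd ?f))"
        by (intro eqm_diff eqm_refl eqm_trans[OF bd_Ph] Ph_cong kbd_psi)
      also have "\<dots> \<approx>B 0" using bd_on[OF fon] by (intro z bd_bd)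
      finally have g0: "bd ?g \<approx>B 0" .
      have "bd (htpy (Suc p) xs) = aL a (aR b (aL 1 ?g - cn 1 (bd ?g)))"
        by (simp add: x htpy_eq bd_aL bd_aR bd_cn del: htpy.simps)
      also have "\<dots> \<approx>B aL a (aR b (?g - cn 1 0))"
        by (intro aL_cong aR_cong eqm_diff aL_1 cn_cong g0)
      also have "\<dots> = frag_extend (defect p) (aL a (aR b ?f))" by (simp only: defect_aL defect_aR frag_extend_0 diff_0_right)
      also have "aL a (aR b ?f) = frag_of xs"
        by (simp add: x aRg_def)
      finally show "defect p xs \<approx>B bd (htpy (Suc p) xs)" by (simp add: eqm_sym del: htpy.simps)
    qed
    then show ?thesis by (simp add: defect_extend frag_extend_extend del: htpy.simps)
  qed
  {
    case 0
    have "Htpy 0 w = 0" for w by (simp add: frag_extend_eq_0)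
    then show ?case using 0
      by (intro main) (simp_all add: Ph_psi_0 numeral_2_eq_2[symmetric])
  next
    case (Suc p)
    show ?case
    proof (rule main[OF Suc.prems])
      fix w assume "w \<in> frags_on (tpow_gens (Suc p + 2))" and "bd w = 0"
      then have "Ph (Suc p) (psi w) - w - Htpy p 0 \<approx>B bd (Htpy (Suc p) w)"
        using Suc.IH[of w] by (simp add: numeral_3_eq_3 del: phi.simps htpy.simps)
      then show "Ph (Suc p) (psi w) - w - bd (Htpy (Suc p) w) \<approx>B 0"
        by (simp add: eqm_diff_zero del: htpy.simps phi.simps)
    qed
  }
qed

lemma htpy_on: "xs \<in> tpow_gens (p + 2) \<Longrightarrow> htpy p xs \<in> frags_on (tpow_gens (p + 3))"
proof (induction p arbitrary: xs)
  case (Suc p)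
  then obtain a m b where x: "xs = a # m @ [b]" by (cases xs rule: bar_gen_cases) auto
  let ?f = "1 # m @ [1]"
  have l: "length ?f = Suc (p + 2)" using Suc.prems x by simp
  have "Htpy p (bdg ?f) \<in> frags_on (tpow_gens (p + 3))"
    using bdg_on[OF l] by (rule frags_on_extend) (rule Suc.IH)
  moreover have "psig ?f \<in> frags_on (tens_ext_gens 2 (Suc p))"
    using l by (intro psig_on) simp
  then have "Ph (Suc p) (psig ?f) \<in> frags_on (tpow_gens (Suc p + 2))"
    by (rule frags_on_extend) (rule phi_on)
  ultimately have "defect p ?f \<in> frags_on (tpow_gens (p + 3))"
    unfolding defect_def using l by (intro frags_on_diff) (simp_all add: numeral_3_eq_3 del: phi.simps)
  then show ?case unfolding x htpy_eq
    using cn_on[of _ "p + 3"] by (simp add: aL_on aR_on del: htpy.simps)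
qed simp

end


section \<open>Modules presented by generators and relations\<close>

text \<open>The defining formulas of the complexes address list entries by position and need to be correct only for
  lists of the right length.\<close>

lemma lift_on:
  assumes R: "R \<subseteq> frags_on X" and R': "R' \<subseteq> frags_on Y" and g: "resp R R' g"
    and eq: "\<And>x. x \<in> X \<Longrightarrow> g' x = g x" and u: "u \<in> frags_on X"
  shows "lift Y R' g' (cls X R u) = cls Y R' (frag_extend g u)"
proof -
  have "frag_extend g' w = frag_extend g w" if "w \<in> frags_on X" for w
    using that eq by (rule frag_extend_eq_on)
  then have "resp R R' g'" using g R by (auto simp: resp_def subset_iff)
  from lift_cls[OF R R' this] show ?thesis using frag_extend_eq_on[OF u eq] by simp
qed

lemma comm_group_cong:
  assumes G: "comm_group G" and "carrier M = carrier G" "monoid.mult M = monoid.mult G" "one M = one G"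
  shows "comm_group M"
proof -
  interpret G: comm_group G by fact
  show ?thesis
    by (rule comm_groupI)
       (auto simp: assms(2-4) G.m_ac intro: G.l_inv_ex)
qed

text \<open>An S^e-module given by a presentation, together with a description \<open>A\<close> of its action on formal
  combinations.\<close>

locale frag_mod =
  fixes M :: "('s::comm_ring_1, ('x \<Rightarrow>\<^sub>0 int) set) env_module"
    and X :: "'x set" and R :: "('x \<Rightarrow>\<^sub>0 int) set"
    and A :: "'s \<Rightarrow> 's \<Rightarrow> ('x \<Rightarrow>\<^sub>0 int) \<Rightarrow> ('x \<Rightarrow>\<^sub>0 int)"
  assumes carr: "carrier M = carrier (presented X R)"
    and mlt: "monoid.mult M = monoid.mult (presented X R)"
    and on: "one M = one (presented X R)"
    and R_on: "R \<subseteq> frags_on X"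
    and A_on: "u \<in> frags_on X \<Longrightarrow> A a b u \<in> frags_on X"
    and act_cls: "u \<in> frags_on X \<Longrightarrow> act M a b (cls X R u) = cls X R (A a b u)"
begin

lemma carrierE:
  assumes "x \<in> carrier M" obtains u where "u \<in> frags_on X" "x = cls X R u"
  using assms by (auto simp: carr carrier_presented)

lemma cls_carrier: "u \<in> frags_on X \<Longrightarrow> cls X R u \<in> carrier M"
  by (simp add: carr carrier_presented)

lemma env_mod: "env_mod M"
proof (rule env_mod.intro)
  show "comm_group M" by (rule comm_group_cong[OF comm_group_presented[OF R_on] carr mlt on])
  fix x a b assume "x \<in> carrier M"
  then show "act M a b x \<in> carrier M"
    by (elim carrierE) (simp add: act_cls cls_carrier A_on)
qed

lemma mult_cls: "u \<in> frags_on X \<Longrightarrow> w \<in> frags_on X \<Longrightarrow> cls X R u \<otimes>\<^bsub>M\<^esub> cls X R w = cls X R (u + w)"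
  by (simp add: mlt mult_presented R_on)

lemma cls_eqI: "eqm R u w \<Longrightarrow> cls X R u = cls X R w"
  by (simp add: cls_eq_iff[OF R_on])

end

lemma frag_mod_linear:
  assumes M: "frag_mod M X R A" and N: "frag_mod N Y R' A'"
    and g: "resp R R' g" and g_on: "\<And>x. x \<in> X \<Longrightarrow> g x \<in> frags_on Y"
    and A: "\<And>a b u. u \<in> frags_on X \<Longrightarrow> eqm R' (frag_extend g (A a b u)) (A' a b (frag_extend g u))"
    and f: "\<And>u. u \<in> frags_on X \<Longrightarrow> f (cls X R u) = cls Y R' (frag_extend g u)"
  shows "env_linear M N f"
proof -
  interpret M: frag_mod M X R A by fact
  interpret N: frag_mod N Y R' A' by fact
  have e: "frag_extend g u \<in> frags_on Y" if "u \<in> frags_on X" for u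
    using that g_on by (rule frags_on_extend)
  have "f \<in> hom M N"
  proof (rule homI)
    fix x assume "x \<in> carrier M"
    then show "f x \<in> carrier N" by (elim M.carrierE) (simp add: f N.cls_carrier e)
  next
    fix x y assume "x \<in> carrier M" "y \<in> carrier M"
    then obtain u w where u: "u \<in> frags_on X" "x = cls X R u" and w: "w \<in> frags_on X" "y = cls X R w"
      by (metis M.carrierE)
    then show "f (x \<otimes>\<^bsub>M\<^esub> y) = f x \<otimes>\<^bsub>N\<^esub> f y"
      by (simp add: M.mult_cls f frags_on_add N.mult_cls e frag_extend_add)
  qed
  moreover have "f (act M a b x) = act N a b (f x)" if x: "x \<in> carrier M" for a b x
  proof -
    obtain u where u: "u \<in> frags_on X" "x = cls X R u" using x by (rule M.carrierE)
    then show ?thesis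
      using N.cls_eqI[OF A[OF u(1), of a b]] by (simp add: M.act_cls f M.A_on N.act_cls e)
  qed
  ultimately show ?thesis by (simp add: env_linear_def)
qed

section \<open>Chain homotopy equivalences\<close>

lemma boundaries_Suc: "boundaries C d p = d (Suc p) ` carrier (C (Suc p))"
  by (simp add: boundaries_def One_nat_def)

locale chain_cx =
  fixes C :: "nat \<Rightarrow> 'c monoid" and d :: "nat \<Rightarrow> 'c \<Rightarrow> 'c"
  assumes grp: "comm_group (C p)"
    and d_hom: "d (Suc p) \<in> hom (C (Suc p)) (C p)"
    and d_d: "x \<in> carrier (C (Suc (Suc p))) \<Longrightarrow> d (Suc p) (d (Suc (Suc p)) x) = \<one>\<^bsub>C p\<^esub>"
begin

lemma d_group_hom: "group_hom (C (Suc p)) (C p) (d (Suc p))"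
  using grp d_hom by (simp add: group_hom_def group_hom_axioms_def comm_group.axioms(2))

lemma cycles_subgroup: "subgroup (cycles C d p) (C p)"
proof (cases p)
  case 0
  then show ?thesis using grp[of 0] by (simp add: cycles_def group.subgroup_self comm_group.axioms(2))
next
  case (Suc q)
  then show ?thesis using group_hom.subgroup_kernel[OF d_group_hom[of q]] by (simp add: cycles_def)
qed

lemma boundaries_subgroup: "subgroup (boundaries C d p) (C p)"
  using group_hom.img_is_subgroup[OF d_group_hom[of p]] by (simp add: boundaries_Suc)

lemma boundaries_cycles: "boundaries C d p \<subseteq> cycles C d p"
proof (cases p)
  case 0
  then show ?thesis using hom_in_carrier[OF d_hom[of 0]] by (auto simp: cycles_def boundaries_Suc)
next
  case (Suc q)
  then show ?thesis
    using hom_in_carrier[OF d_hom[of p]] d_d[of _ q] by (auto simp: cycles_def boundaries_Suc kernel_def)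
qed

lemma cyclesI:
  assumes "x \<in> carrier (C p)" "\<And>q. p = Suc q \<Longrightarrow> d (Suc q) x = \<one>\<^bsub>C q\<^esub>"
  shows "x \<in> cycles C d p"
  using assms by (cases p) (auto simp: cycles_def kernel_def)

lemma cyclesD:
  assumes "x \<in> cycles C d p"
  shows "x \<in> carrier (C p)" "p = Suc q \<Longrightarrow> d (Suc q) x = \<one>\<^bsub>C q\<^esub>"
  using assms by (cases p; auto simp: cycles_def kernel_def)+

lemma homology_carrier: "carrier (homology C d p) = (\<lambda>z. boundaries C d p #>\<^bsub>C p\<^esub> z) ` cycles C d p"
  by (auto simp: homology_def FactGroup_def RCOSETS_def r_coset_def)

end

lemma chain_map_cycles:
  assumes C: "chain_cx C d" and D: "chain_cx D e" and f: "\<And>p. f p \<in> hom (C p) (D p)"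
    and fd: "\<And>p x. x \<in> carrier (C (Suc p)) \<Longrightarrow> f p (d (Suc p) x) = e (Suc p) (f (Suc p) x)"
  shows "f p ` cycles C d p \<subseteq> cycles D e p" and "f p ` boundaries C d p \<subseteq> boundaries D e p"
    and "z \<in> carrier (C p) \<Longrightarrow>
      homology_map D e p (f p) (boundaries C d p #>\<^bsub>C p\<^esub> z) = boundaries D e p #>\<^bsub>D p\<^esub> f p z"
proof -
  interpret C: chain_cx C d by fact
  interpret D: chain_cx D e by fact
  have one: "f p \<one>\<^bsub>C p\<^esub> = \<one>\<^bsub>D p\<^esub>" for p
    using f[of p] C.grp D.grp by (intro hom_one) (auto simp: comm_group.axioms(2))
  show "f p ` cycles C d p \<subseteq> cycles D e p"
  proof
    fix y assume "y \<in> f p ` cycles C d p"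
    then obtain x where x: "x \<in> cycles C d p" "y = f p x" by blast
    show "y \<in> cycles D e p"
    proof (rule D.cyclesI)
      show "y \<in> carrier (D p)" using x hom_in_carrier[OF f] C.cyclesD(1) by blast
    next
      fix q assume q: "p = Suc q"
      have "f q (d (Suc q) x) = e (Suc q) (f (Suc q) x)"
        using C.cyclesD(1)[OF x(1)] q by (intro fd) simp
      then show "e (Suc q) y = \<one>\<^bsub>D q\<^esub>" using C.cyclesD(2)[OF x(1) q] one x(2) q by simp
    qed
  qed
  show b: "f p ` boundaries C d p \<subseteq> boundaries D e p"
  proof
    fix y assume "y \<in> f p ` boundaries C d p"
    then obtain x where x: "x \<in> carrier (C (Suc p))" "y = f p (d (Suc p) x)" by (auto simp: boundaries_Suc)
    then have "y = e (Suc p) (f (Suc p) x)" by (simp add: fd)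
    then show "y \<in> boundaries D e p" using hom_in_carrier[OF f x(1)] by (auto simp: boundaries_Suc)
  qed
  assume "z \<in> carrier (C p)"
  then show "homology_map D e p (f p) (boundaries C d p #>\<^bsub>C p\<^esub> z) = boundaries D e p #>\<^bsub>D p\<^esub> f p z"
    unfolding homology_map_def
    by (intro induced_coset[OF C.grp D.grp f D.boundaries_subgroup _ b])
       (auto intro: subgroup.one_closed[OF C.boundaries_subgroup] dest: subgroup.mem_carrier[OF C.boundaries_subgroup])
qed

text \<open>Degree 0 is separate because there is no differential out of it.\<close>

lemma homotopy_equivalence_homology_iso:
  assumes C: "chain_cx C d" and D: "chain_cx D e"
    and f: "\<And>p. f p \<in> hom (C p) (D p)" and g: "\<And>p. g p \<in> hom (D p) (C p)"
    and h: "\<And>p. h p \<in> hom (C p) (C (Suc p))"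
    and fd: "\<And>p x. x \<in> carrier (C (Suc p)) \<Longrightarrow> f p (d (Suc p) x) = e (Suc p) (f (Suc p) x)"
    and gd: "\<And>p x. x \<in> carrier (D (Suc p)) \<Longrightarrow> g p (e (Suc p) x) = d (Suc p) (g (Suc p) x)"
    and fg: "\<And>p y. y \<in> carrier (D p) \<Longrightarrow> f p (g p y) = y"
    and gf0: "\<And>x. x \<in> carrier (C 0) \<Longrightarrow> g 0 (f 0 x) = x \<otimes>\<^bsub>C 0\<^esub> d 1 (h 0 x)"
    and gfS: "\<And>p x. x \<in> carrier (C (Suc p)) \<Longrightarrow> g (Suc p) (f (Suc p) x) =
       x \<otimes>\<^bsub>C (Suc p)\<^esub> (d (Suc (Suc p)) (h (Suc p) x) \<otimes>\<^bsub>C (Suc p)\<^esub> h p (d (Suc p) x))"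
  shows "homology_map D e p (f p) \<in> iso (homology C d p) (homology D e p)"
proof -
  interpret C: chain_cx C d by fact
  interpret D: chain_cx D e by fact
  interpret Cp: comm_group "C p" by (rule C.grp)
  note fc = chain_map_cycles[where C = C and D = D and d = d and e = e and f = f, OF C D f fd]
    and gc = chain_map_cycles[where C = D and D = C and d = e and e = d and f = g, OF D C g gd]
  show ?thesis
    unfolding homology_def homology_map_def
  proof (rule induced_iso[where f = "f p" and G = "C p" and H = "D p" and ZG = "cycles C d p" and ZH = "cycles D e p",
        OF C.grp D.grp f C.cycles_subgroup D.cycles_subgroup C.boundaries_subgroup
        D.boundaries_subgroup C.boundaries_cycles D.boundaries_cycles fc(1) fc(2)])
    fix y assume "y \<in> cycles D e p"
    then have "g p y \<in> cycles C d p" "f p (g p y) = y"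
      using gc(1) fg D.cyclesD(1) by blast+
    then show "\<exists>z\<in>cycles C d p. f p z = y" by blast
  next
    fix z assume z: "z \<in> cycles C d p" and fz: "f p z \<in> boundaries D e p"
    let ?B = "boundaries C d p"
    have zc: "z \<in> carrier (C p)" using z by (rule C.cyclesD(1))
    have "d (Suc p) (h p z) \<in> ?B"
      using hom_in_carrier[OF h zc] by (auto simp: boundaries_Suc)
    moreover have "g p (f p z) \<in> ?B" using fz gc(2) by blast
    moreover have "g p (f p z) = z \<otimes>\<^bsub>C p\<^esub> d (Suc p) (h p z)"
    proof (cases p)
      case 0
      then show ?thesis using gf0 zc by (simp add: One_nat_def)
    next
      case (Suc q)
      have dz: "d (Suc q) z = \<one>\<^bsub>C q\<^esub>" using C.cyclesD(2)[OF z Suc] .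
      have "h q \<one>\<^bsub>C q\<^esub> = \<one>\<^bsub>C (Suc q)\<^esub>"
        using h[of q] C.grp by (intro hom_one) (auto simp: comm_group.axioms(2))
      moreover have "d (Suc p) (h p z) \<in> carrier (C p)"
        using hom_in_carrier[OF C.d_hom hom_in_carrier[OF h zc]] .
      ultimately show ?thesis using gfS[of z q] zc Suc dz Cp.r_one by simp
    qed
    ultimately have 1: "z \<otimes>\<^bsub>C p\<^esub> d (Suc p) (h p z) \<in> ?B" and 2: "d (Suc p) (h p z) \<in> ?B" by simp_all
    have c: "d (Suc p) (h p z) \<in> carrier (C p)"
      using 2 by (rule subgroup.mem_carrier[OF C.boundaries_subgroup])
    have "z \<otimes>\<^bsub>C p\<^esub> d (Suc p) (h p z) \<otimes>\<^bsub>C p\<^esub> inv\<^bsub>C p\<^esub> d (Suc p) (h p z) \<in> ?B"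
      by (rule subgroup.m_closed[OF C.boundaries_subgroup 1 subgroup.m_inv_closed[OF C.boundaries_subgroup 2]])
    then show "z \<in> ?B" using zc c by (simp add: Cp.m_assoc)
  qed
qed

section \<open>The resolutions\<close>

context sym_basis
begin

abbreviation "XB p \<equiv> (tpow_gens (p + 2) :: 's list set)"
abbreviation "RB p \<equiv> tpow_rels sS (p + 2)"
abbreviation "XK p \<equiv> (tens_ext_gens 2 p :: ('s list \<times> 'v list) set)"
abbreviation "RK p \<equiv> tens_ext_rels sV sS 2 p"
abbreviation "bar_cls p \<equiv> cls (XB p) (RB p)"
abbreviation "kos_cls p \<equiv> cls (XK p) (RK p)"

lemma tpow_rels_on: "tpow_rels sS q \<subseteq> frags_on (tpow_gens q)"
proof
  fix r assume "r \<in> tpow_rels sS q"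
  then show "r \<in> frags_on (tpow_gens q)"
    unfolding tpow_rels_def
    by (elim UnE CollectE exE conjE) (simp_all add: frags_on_diff)
qed

lemma tens_ext_rels_on: "tens_ext_rels sV sS q p \<subseteq> frags_on (tens_ext_gens q p)"
proof
  fix r assume "r \<in> tens_ext_rels sV sS q p"
  then show "r \<in> frags_on (tens_ext_gens q p)"
    unfolding tens_ext_rels_def
    by (elim UnE CollectE exE conjE) (simp_all add: frags_on_diff)
qed

text \<open>For q = 0 the empty list is a generator that \<open>\<approx>B\<close> kills without a relation of degree 0.\<close>

lemma projB:
  assumes "u \<approx>B w" "u \<in> frags_on (tpow_gens q)" "w \<in> frags_on (tpow_gens q)" "0 < q"
  shows "eqm (tpow_rels sS q) u w"
proof (rule eqm_project[OF assms(1)])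
  fix r assume "r \<in> bar_rels"
  then consider "r = frag_of []" | q' where "r \<in> tpow_rels sS q'" by (auto simp: bar_rels_def)
  then show "r \<in> tpow_rels sS q \<and> Poly_Mapping.keys r \<subseteq> tpow_gens q \<or> Poly_Mapping.keys r \<inter> tpow_gens q = {}"
  proof cases
    case 1
    then show ?thesis using assms(4) by (auto simp: tpow_gens_def)
  next
    case 2
    then have "Poly_Mapping.keys r \<subseteq> tpow_gens q'" using tpow_rels_on by (auto simp: frags_on_def)
    then show ?thesis using 2 by (cases "q' = q") (auto simp: tpow_gens_def)
  qed
qed (use assms in \<open>simp_all add: frags_on_def\<close>)

lemma projK:
  assumes "u \<approx>K w" "u \<in> frags_on (XK p)" "w \<in> frags_on (XK p)"
  shows "eqm (RK p) u w"
proof (rule eqm_project[OF assms(1)])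
  fix r assume "r \<in> kos_rels"
  then consider xs ws where "length xs \<noteq> 2" "r = frag_of (xs, ws)" | p' where "r \<in> RK p'" by (auto simp: kos_rels_def)
  then show "r \<in> RK p \<and> Poly_Mapping.keys r \<subseteq> XK p \<or> Poly_Mapping.keys r \<inter> XK p = {}"
  proof cases
    case 1
    then show ?thesis by (auto simp: tens_ext_gens_def)
  next
    case 2
    then have "Poly_Mapping.keys r \<subseteq> XK p'" using tens_ext_rels_on by (auto simp: frags_on_def)
    then show ?thesis using 2 by (cases "p' = p") (auto simp: tens_ext_gens_def)
  qed
qed (use assms in \<open>simp_all add: frags_on_def\<close>)

lemma resp_project:
  assumes "resp R N g" "R' \<subseteq> R" "R' \<subseteq> frags_on X" "\<And>x. x \<in> X \<Longrightarrow> g x \<in> frags_on Y"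
    and "\<And>u. eqm N u 0 \<Longrightarrow> u \<in> frags_on Y \<Longrightarrow> eqm N' u 0"
  shows "resp R' N' g"
  unfolding resp_def
proof
  fix r assume r: "r \<in> R'"
  then have "eqm N (frag_extend g r) 0" using assms(1,2) by (auto simp: resp_def)
  moreover have "frag_extend g r \<in> frags_on Y"
    by (rule frags_on_extend[OF _ assms(4)]) (use r assms(3) in auto)
  ultimately show "eqm N' (frag_extend g r) 0" by (rule assms(5))
qed

lemma tpow_rels_bar_rels: "tpow_rels sS q \<subseteq> bar_rels" by (auto simp: bar_rels_def)
lemma tens_ext_rels_kos_rels: "RK p \<subseteq> kos_rels" by (auto simp: kos_rels_def)

lemma resp_projBB:
  assumes "resp bar_rels bar_rels g" "\<And>xs. xs \<in> tpow_gens q \<Longrightarrow> g xs \<in> frags_on (tpow_gens q')" "0 < q'"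
  shows "resp (tpow_rels sS q) (tpow_rels sS q') g"
  by (rule resp_project[OF assms(1) tpow_rels_bar_rels tpow_rels_on assms(2)]) (simp_all add: projB assms(3))

lemma resp_projBK:
  assumes "resp bar_rels kos_rels g" "\<And>xs. xs \<in> tpow_gens q \<Longrightarrow> g xs \<in> frags_on (XK p)"
  shows "resp (tpow_rels sS q) (RK p) g"
  by (rule resp_project[OF assms(1) tpow_rels_bar_rels tpow_rels_on assms(2)]) (simp_all add: projK)

lemma resp_projKB:
  assumes "resp kos_rels bar_rels g" "\<And>z. z \<in> XK p \<Longrightarrow> g z \<in> frags_on (tpow_gens q)" "0 < q"
  shows "resp (RK p) (tpow_rels sS q) g"
  by (rule resp_project[OF assms(1) tens_ext_rels_kos_rels tens_ext_rels_on assms(2)]) (simp_all add: projB assms(3))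

lemma resp_projKK:
  assumes "resp kos_rels kos_rels g" "\<And>z. z \<in> XK p \<Longrightarrow> g z \<in> frags_on (XK p')"
  shows "resp (RK p) (RK p') g"
  by (rule resp_project[OF assms(1) tens_ext_rels_kos_rels tens_ext_rels_on assms(2)]) (simp_all add: projK)

lemma aLR_on: "u \<in> frags_on (tpow_gens q) \<Longrightarrow> aL a (aR b u) \<in> frags_on (tpow_gens q)"
  by (intro aL_on aR_on)

lemma kLR_on: "u \<in> frags_on (XK p) \<Longrightarrow> kL a (kR b u) \<in> frags_on (XK p)"
  by (intro kL_on kR_on)

lemma bar_mod: "frag_mod (bar sS p) (XB p) (RB p) (\<lambda>a b u. aL a (aR b u))"
proof
  show "carrier (bar sS p) = carrier (presented (XB p) (RB p))"
    "monoid.mult (bar sS p) = monoid.mult (presented (XB p) (RB p))"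
    "one (bar sS p) = one (presented (XB p) (RB p))"
    by (simp_all add: bar_def tpow_def monoid.defs env_module.defs)
  show "RB p \<subseteq> frags_on (XB p)" by (rule tpow_rels_on)
  fix u a b assume u: "u \<in> frags_on (XB p)"
  then show "aL a (aR b u) \<in> frags_on (XB p)" by (rule aLR_on)
  have A: "act (bar sS p) a b = lift (XB p) (RB p) (\<lambda>xs. frag_of (xs[0 := a * xs ! 0, p + 1 := xs ! (p + 1) * b]))"
    by (simp add: bar_def monoid.defs env_module.defs)
  have "lift (XB p) (RB p) (\<lambda>xs. frag_of (xs[0 := a * xs ! 0, p + 1 := xs ! (p + 1) * b])) (bar_cls p u) =
    bar_cls p (frag_extend (\<lambda>xs. aL a (aRg b xs)) u)"
  proof (rule lift_on[OF tpow_rels_on tpow_rels_on _ _ u])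
    show "resp (RB p) (RB p) (\<lambda>xs. aL a (aRg b xs))"
    proof (rule resp_projBB[OF resp_comp[OF resp_aR resp_aL]])
      fix xs :: "'s list" assume "xs \<in> XB p"
      then show "aL a (aRg b xs) \<in> frags_on (XB p)" using aLR_on[of "frag_of xs" "p + 2" a b] by simp
    qed simp
    fix xs :: "'s list" assume "xs \<in> XB p"
    then obtain x m y where xs: "xs = x # m @ [y]" "length m = p" by (cases xs rule: bar_gen_cases) auto
    then show "frag_of (xs[0 := a * xs ! 0, p + 1 := xs ! (p + 1) * b]) = aL a (aRg b xs)"
      by (simp add: aRg_def nth_append list_update_append One_nat_def)
  qed
  then show "act (bar sS p) a b (bar_cls p u) = bar_cls p (aL a (aR b u))"
    by (simp add: A frag_extend_extend)
qed

lemma kos_mod: "frag_mod (kos sV sS p) (XK p) (RK p) (\<lambda>a b u. kL a (kR b u))"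
proof
  show "carrier (kos sV sS p) = carrier (presented (XK p) (RK p))"
    "monoid.mult (kos sV sS p) = monoid.mult (presented (XK p) (RK p))"
    "one (kos sV sS p) = one (presented (XK p) (RK p))"
    by (simp_all add: kos_def tens_ext_def monoid.defs env_module.defs)
  show "RK p \<subseteq> frags_on (XK p)" by (rule tens_ext_rels_on)
  fix u a b assume u: "u \<in> frags_on (XK p)"
  then show "kL a (kR b u) \<in> frags_on (XK p)" by (rule kLR_on)
  have A: "act (kos sV sS p) a b = lift (XK p) (RK p) (\<lambda>(xs, ws). frag_of ([a * xs ! 0, xs ! 1 * b], ws))"
    by (simp add: kos_def monoid.defs env_module.defs)
  have "lift (XK p) (RK p) (\<lambda>(xs, ws). frag_of ([a * xs ! 0, xs ! 1 * b], ws)) (kos_cls p u) =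
    kos_cls p (frag_extend (\<lambda>z. kL a (kRg b z)) u)"
  proof (rule lift_on[OF tens_ext_rels_on tens_ext_rels_on _ _ u])
    show "resp (RK p) (RK p) (\<lambda>z. kL a (kRg b z))"
    proof (rule resp_projKK[OF resp_comp[OF resp_kR resp_kL]])
      fix z assume "z \<in> XK p"
      then show "kL a (kRg b z) \<in> frags_on (XK p)" using kLR_on[of "frag_of z" p a b] by simp
    qed
    fix z assume "z \<in> XK p"
    then show "(\<lambda>(xs, ws). frag_of ([a * xs ! 0, xs ! 1 * b], ws)) z = kL a (kRg b z)"
      by (cases z rule: kos_gen_cases) (auto simp: One_nat_def)
  qed
  then show "act (kos sV sS p) a b (kos_cls p u) = kos_cls p (kL a (kR b u))"
    by (simp add: A frag_extend_extend)
qed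

lemma bdg_sum:
  assumes "length xs = Suc (Suc p)"
  shows "bdg xs = (\<Sum>j=0..p. frag_cmul ((-1) ^ j) (frag_of (take j xs @ [xs ! j * xs ! (j + 1)] @ drop (j + 2) xs)))"
  using assms
proof (induction p arbitrary: xs)
  case 0
  then obtain x y where "xs = [x, y]" by (auto simp: length_Suc_conv)
  then show ?case by (simp add: One_nat_def)
next
  case (Suc p)
  then obtain x y r where xs: "xs = x # y # r" by (auto simp: length_Suc_conv)
  have neg: "frag_cmul ((-1) ^ Suc i) u = - frag_cmul ((-1) ^ i) u" for i and u :: "'z \<Rightarrow>\<^sub>0 int"
    by simp
  have "bdg xs = frag_of ((x * y) # r) - cn x (bdg (y # r))" by (simp add: xs)
  also have "bdg (y # r) = (\<Sum>j=0..p. frag_cmul ((-1) ^ j)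
     (frag_of (take j (y # r) @ [(y # r) ! j * (y # r) ! (j + 1)] @ drop (j + 2) (y # r))))"
    using Suc.prems xs by (intro Suc.IH) simp
  also have "cn x \<dots> = (\<Sum>j=0..p. frag_cmul ((-1) ^ j)
     (frag_of (take (Suc j) xs @ [xs ! Suc j * xs ! (Suc j + 1)] @ drop (Suc j + 2) xs)))"
    unfolding frag_extend_sum' frag_extend_cmul
    by (rule sum.cong) (simp_all add: xs cng_def)
  finally show ?case
    unfolding sum.atLeast0_atMost_Suc_shift o_def neg sum_negf by (simp add: xs)
qed

lemma resp_bd_p: "resp (RB (Suc p)) (RB p) bdg" by (rule resp_projBB[OF resp_bd]) (simp_all add: bdg_on)

lemma bar_diff_cls:
  assumes u: "u \<in> frags_on (XB (Suc p))"
  shows "bar_diff sS (Suc p) (bar_cls (Suc p) u) = bar_cls p (bd u)"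
proof -
  have "lift (XB p) (RB p) (\<lambda>xs. \<Sum>j=0..Suc p. frag_cmul ((-1) ^ j)
        (frag_of (take j xs @ [xs ! j * xs ! (j + 1)] @ drop (j + 2) xs))) (bar_cls (Suc p) u) =
      bar_cls p (bd u)"
    by (rule lift_on[OF tpow_rels_on tpow_rels_on resp_bd_p _ u])
       (rule bdg_sum[symmetric], simp)
  then show ?thesis by (simp add: bar_diff_def One_nat_def)
qed

lemma kos_diff_cls:
  assumes u: "u \<in> frags_on (XK (Suc p))"
  shows "kos_diff sV sS \<iota> (Suc p) (kos_cls (Suc p) u) = kos_cls p (kbd u)"
proof -
  have "lift (XK p) (RK p) (\<lambda>(xs, ws). \<Sum>i<Suc p. frag_cmul ((-1) ^ i)
        (frag_of ([xs ! 0 * \<iota> (ws ! i), xs ! 1], take i ws @ drop (i + 1) ws)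
         - frag_of ([xs ! 0, \<iota> (ws ! i) * xs ! 1], take i ws @ drop (i + 1) ws))) (kos_cls (Suc p) u) =
      kos_cls p (kbd u)"
  proof (rule lift_on[OF tens_ext_rels_on tens_ext_rels_on resp_projKK[OF resp_kbd kbdg_on] _ u])
    fix z assume z: "z \<in> XK (Suc p)"
    then show "(\<lambda>(xs, ws). \<Sum>i<Suc p. frag_cmul ((-1) ^ i)
        (frag_of ([xs ! 0 * \<iota> (ws ! i), xs ! 1], take i ws @ drop (i + 1) ws)
         - frag_of ([xs ! 0, \<iota> (ws ! i) * xs ! 1], take i ws @ drop (i + 1) ws))) z = kbdg z"
      by (cases z rule: kos_gen_cases) (simp_all add: kd_sum One_nat_def del: sum.lessThan_Suc)
  qed
  then show ?thesis by (simp add: kos_diff_def)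
qed

definition "PsiL p = lift (XK p) (RK p) psig"
definition "PhiL p = lift (XB p) (RB p) (phi p)"
definition "HtpyL p = lift (XB (Suc p)) (RB (Suc p)) (htpy p)"

lemma htpy_on': "xs \<in> XB p \<Longrightarrow> htpy p xs \<in> frags_on (XB (Suc p))"
  using htpy_on[of xs p] by (simp add: numeral_3_eq_3 del: htpy.simps)

lemma resp_psi_p: "resp (RB p) (RK p) psig" by (rule resp_projBK[OF resp_psi psig_on])
lemma resp_phi_p: "resp (RK p) (RB p) (phi p)" by (rule resp_projKB[OF resp_phi phi_on]) simp_all
lemma resp_htpy_p: "resp (RB p) (RB (Suc p)) (htpy p)" by (rule resp_projBB[OF resp_htpy htpy_on']) simp_all
lemma resp_kbd_p: "resp (RK (Suc p)) (RK p) kbdg" by (rule resp_projKK[OF resp_kbd kbdg_on])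

lemma PsiL_cls: "PsiL p (bar_cls p u) = kos_cls p (psi u)"
  unfolding PsiL_def by (rule lift_cls[OF tpow_rels_on tens_ext_rels_on resp_psi_p])

lemma PhiL_cls: "PhiL p (kos_cls p u) = bar_cls p (Ph p u)"
  unfolding PhiL_def by (rule lift_cls[OF tens_ext_rels_on tpow_rels_on resp_phi_p])

lemma HtpyL_cls: "HtpyL p (bar_cls p u) = bar_cls (Suc p) (Htpy p u)"
  unfolding HtpyL_def by (rule lift_cls[OF tpow_rels_on tpow_rels_on resp_htpy_p])

lemma PhiL_linear: "env_linear (kos sV sS p) (bar sS p) (PhiL p)"
  by (rule frag_mod_linear[OF kos_mod bar_mod resp_phi_p phi_on _ PhiL_cls]) (simp_all add: Ph_kL Ph_kR)

lemma HtpyL_linear: "env_linear (bar sS p) (bar sS (Suc p)) (HtpyL p)"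
  by (rule frag_mod_linear[OF bar_mod bar_mod resp_htpy_p htpy_on' _ HtpyL_cls]) (simp_all add: Htpy_aL Htpy_aR)

lemma bar_diff_linear: "env_linear (bar sS (Suc p)) (bar sS p) (bar_diff sS (Suc p))"
  by (rule frag_mod_linear[OF bar_mod bar_mod resp_bd_p _ _ bar_diff_cls])
     (simp_all add: bdg_on bd_aL bd_aR)

lemma kos_diff_linear: "env_linear (kos sV sS (Suc p)) (kos sV sS p) (kos_diff sV sS \<iota> (Suc p))"
  by (rule frag_mod_linear[OF kos_mod kos_mod resp_kbd_p kbdg_on _ kos_diff_cls])
     (simp_all add: kbd_kL kbd_kR)

end


(* Degrees stay in the form p + 2 in which the definitions have them. *)
declare add_2_eq_Suc [simp del] add_2_eq_Suc' [simp del]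

section \<open>The explicit formula for Psi\<close>

lemma downward_closed_eq_lessThan:
  fixes S :: "nat set"
  assumes "finite S" "\<And>i j. j \<in> S \<Longrightarrow> i < j \<Longrightarrow> i \<in> S"
  shows "S = {..<card S}"
proof (cases "S = {}")
  case False
  have "S = {..Max S}"
  proof
    show "{..Max S} \<subseteq> S"
      using assms(2)[OF Max_in[OF assms(1) False]] Max_in[OF assms(1) False] by (auto simp: le_less)
  qed (use assms(1) in auto)
  moreover from this have "card S = Suc (Max S)" by (metis card_atMost)
  ultimately show ?thesis by (metis lessThan_Suc_atMost)
qed simp

lemma prod_sum_lists:
  fixes g :: "nat \<Rightarrow> nat \<Rightarrow> 'a::comm_semiring_1"
  shows "(\<Prod>j<p. \<Sum>a<L j. g j a) = (\<Sum>as\<in>{as. length as = p \<and> (\<forall>j<p. as ! j < L j)}. \<Prod>j<p. g j (as ! j))"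
proof (induction p)
  case 0
  have "{as :: nat list. length as = 0 \<and> (\<forall>j<0. as ! j < L j)} = {[]}" by auto
  then show ?case by simp
next
  case (Suc p)
  let ?A = "\<lambda>p. {as. length as = p \<and> (\<forall>j<p. as ! j < L j)}"
  have A: "?A (Suc p) = (\<lambda>(as, a). as @ [a]) ` (?A p \<times> {..<L p})"
  proof
    show "?A (Suc p) \<subseteq> (\<lambda>(as, a). as @ [a]) ` (?A p \<times> {..<L p})"
    proof
      fix xs assume xs: "xs \<in> ?A (Suc p)"
      then obtain as a where as: "xs = as @ [a]" by (cases xs rule: rev_cases) auto
      have "as ! j < L j" if "j < p" for j
      proof -
        have "xs ! j < L j" "length as = p" using xs that by (auto simp: as)
        then show ?thesis using that by (simp add: as nth_append)
      qed
      moreover have "a < L p" using xs by (auto simp: as)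
      ultimately show "xs \<in> (\<lambda>(as, a). as @ [a]) ` (?A p \<times> {..<L p})" using xs by (auto simp: as)
    qed
  qed (auto simp: nth_append less_Suc_eq)
  have inj: "inj_on (\<lambda>(as, a). as @ [a]) (?A p \<times> {..<L p})" by (auto simp: inj_on_def)
  have "(\<Sum>as\<in>?A (Suc p). \<Prod>j<Suc p. g j (as ! j)) =
      (\<Sum>(as, a)\<in>?A p \<times> {..<L p}. \<Prod>j<Suc p. g j ((as @ [a]) ! j))"
    unfolding A sum.reindex[OF inj] by (rule sum.cong) auto
  also have "\<dots> = (\<Sum>(as, a)\<in>?A p \<times> {..<L p}. (\<Prod>j<p. g j (as ! j)) * g p a)"
    by (rule sum.cong) (auto simp: nth_append intro!: arg_cong2[where f = "(*)"] prod.cong)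
  also have "\<dots> = (\<Sum>as\<in>?A p. \<Prod>j<p. g j (as ! j)) * (\<Sum>a<L p. g p a)"
    unfolding sum_product sum.cartesian_product by (simp add: split_beta)
  finally show ?case by (simp add: Suc)
qed

context sym_basis
begin

definition incr_from :: "nat \<Rightarrow> nat \<Rightarrow> nat list set" where
  "incr_from t p = {is. length is = p \<and> set is \<subseteq> {t<..n} \<and> sorted_wrt (<) is}"

lemma incr_seqs_eq: "incr_seqs n p = incr_from 0 p"
proof -
  have "{0<..n} = {1..n}" by auto
  then show ?thesis by (simp add: incr_seqs_def incr_from_def)
qed

lemma finite_incr_from: "finite (incr_from t p)"
proof (rule finite_subset)
  show "incr_from t p \<subseteq> {xs. set xs \<subseteq> {t<..n} \<and> length xs = p}" by (auto simp: incr_from_def)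
qed (simp add: finite_lists_length_eq)

lemma incr_from_Suc: "incr_from t (Suc p) = (\<lambda>(i, is). i # is) ` (SIGMA i:{t<..n}. incr_from i p)"
proof
  show "incr_from t (Suc p) \<subseteq> (\<lambda>(i, is). i # is) ` (SIGMA i:{t<..n}. incr_from i p)"
  proof
    fix xs assume xs: "xs \<in> incr_from t (Suc p)"
    then obtain i "is" where "xs = i # is" by (cases xs) (auto simp: incr_from_def)
    then show "xs \<in> (\<lambda>(i, is). i # is) ` (SIGMA i:{t<..n}. incr_from i p)"
      using xs by (force simp: incr_from_def)
  qed
qed (force simp: incr_from_def)

lemma sum_incr_from_Suc: "(\<Sum>is\<in>incr_from t (Suc p). h is) = (\<Sum>i\<in>{t<..n}. \<Sum>is\<in>incr_from i p. h (i # is))"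
proof -
  have inj: "inj_on (\<lambda>(i, is). i # is) (SIGMA i:{t<..n}. incr_from i p)" by (auto simp: inj_on_def)
  show ?thesis
    unfolding incr_from_Suc sum.reindex[OF inj]
    by (subst sum.Sigma) (auto simp: finite_incr_from intro!: sum.cong)
qed

lemma Plg_unroll: "Plg t (F @ [b]) \<approx>K
  (\<Sum>is\<in>incr_from t (length F). ract (\<Prod>j<length F. dq (is ! j) (F ! j)) (frag_of ([1, b], map v is)))"
proof (induction F arbitrary: t)
  case Nil
  have "incr_from t 0 = {[]}" by (auto simp: incr_from_def)
  then show ?case by (simp add: eqm_sym[OF ract_1])
next
  case (Cons f F)
  let ?r = "\<lambda>is F. \<Prod>j<length F. dq (is ! j) (F ! j)"
  have "Plg t (f # F @ [b]) = (\<Sum>i\<in>{t<..n}. ract (dq i f) (W (v i) (Plg i (F @ [b]))))"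
    by (simp add: Plg_Cons)
  also have "\<dots> \<approx>K (\<Sum>i\<in>{t<..n}. ract (dq i f) (W (v i)
      (\<Sum>is\<in>incr_from i (length F). ract (?r is F) (frag_of ([1, b], map v is)))))"
    by (intro eqm_sum ract_cong W_cong Cons)
  also have "\<dots> = (\<Sum>i\<in>{t<..n}. \<Sum>is\<in>incr_from i (length F). ract (dq i f) (ract (?r is F) (frag_of ([1, b], map v (i # is)))))"
    by (simp add: frag_extend_sum' ract_sum W_ract)
  also have "\<dots> \<approx>K (\<Sum>i\<in>{t<..n}. \<Sum>is\<in>incr_from i (length F). ract (dq i f * ?r is F) (frag_of ([1, b], map v (i # is))))"
    by (intro eqm_sum eqm_sym[OF ract_mult])
  also have "\<dots> = (\<Sum>is\<in>incr_from t (length (f # F)). ract (?r is (f # F)) (frag_of ([1, b], map v is)))"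
    by (simp add: sum_incr_from_Suc prod.lessThan_Suc_shift del: prod.lessThan_Suc)
  finally show ?case by simp
qed

lemma psig_expand: "psig (a # F @ [b]) \<approx>K
  (\<Sum>is\<in>incr_seqs n (length F). ract (\<Prod>j<length F. dq (is ! j) (F ! j)) (frag_of ([a, b], map v is)))"
proof -
  have "psig (a # F @ [b]) = kL a (Plg 0 (F @ [b]))" by simp
  also have "\<dots> \<approx>K kL a (\<Sum>is\<in>incr_from 0 (length F). ract (\<Prod>j<length F. dq (is ! j) (F ! j)) (frag_of ([1, b], map v is)))"
    by (intro kL_cong Plg_unroll)
  also have "\<dots> = (\<Sum>is\<in>incr_seqs n (length F). ract (\<Prod>j<length F. dq (is ! j) (F ! j)) (frag_of ([a, b], map v is)))"
    by (simp add: frag_extend_sum' kL_ract incr_seqs_eq)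
  finally show ?thesis .
qed

text \<open>The monomial with exponents \<open>\<alpha>\<close> in the x_k and \<open>\<beta>\<close> in the y_k.\<close>

definition xymon :: "(nat \<Rightarrow> nat) \<Rightarrow> (nat \<Rightarrow> nat) \<Rightarrow> 's env" where
  "xymon \<alpha> \<beta> = Poly_Mapping.single (restr \<beta>) (mon \<alpha>)"

lemma xymon_prod_form: "xymon \<alpha> \<beta> = (\<Prod>k=1..n. xvar k ^ \<alpha> k) * (\<Prod>k=1..n. yvar k ^ \<beta> k)"
  by (simp add: xymon_def mult_single flip: lft_mon yhom_mon add: yhom_mon_single)

lemma xymon_mult: "xymon \<alpha> \<beta> * xymon \<alpha>' \<beta>' = xymon (\<lambda>k. \<alpha> k + \<alpha>' k) (\<lambda>k. \<beta> k + \<beta>' k)"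
  by (simp add: xymon_prod_form power_add prod.distrib ac_simps)

lemma xymon_prod: "finite I \<Longrightarrow> (\<Prod>j\<in>I. xymon (\<alpha> j) (\<beta> j)) = xymon (\<lambda>k. \<Sum>j\<in>I. \<alpha> j k) (\<lambda>k. \<Sum>j\<in>I. \<beta> j k)"
  by (induction I rule: finite_induct) (simp_all add: xymon_mult, simp add: xymon_prod_form)

text \<open>The exponents of x_k and y_k in the term x_i^a y_i^(l_i - 1 - a) of the geometric sum in \<open>dq i (mon l)\<close>.\<close>

definition xexp :: "nat \<Rightarrow> (nat \<Rightarrow> nat) \<Rightarrow> nat \<Rightarrow> nat \<Rightarrow> nat" where
  "xexp i l a k = (if k = i then a else if i < k then l k else 0)"
definition yexp :: "nat \<Rightarrow> (nat \<Rightarrow> nat) \<Rightarrow> nat \<Rightarrow> nat \<Rightarrow> nat" where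
  "yexp i l a k = (if k = i then l i - 1 - a else if k < i then l k else 0)"

lemma dq_mon_expand:
  assumes i: "i \<in> {1..n}"
  shows "dq i (mon l) = (\<Sum>a<l i. xymon (xexp i l a) (yexp i l a))"
proof -
  have s: "{1..n} = insert i ({1..<i} \<union> {i<..n})" using i by auto
  have x: "(\<Prod>k=1..n. xvar k ^ xexp i l a k) = xvar i ^ a * (\<Prod>k\<in>{i<..n}. xvar k ^ l k)" for a
  proof -
    have "(\<Prod>k\<in>{1..<i}. xvar k ^ xexp i l a k) = 1" by (rule prod.neutral) (auto simp: xexp_def)
    moreover have "(\<Prod>k\<in>{i<..n}. xvar k ^ xexp i l a k) = (\<Prod>k\<in>{i<..n}. xvar k ^ l k)"
      by (rule prod.cong) (auto simp: xexp_def)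
    moreover have "xexp i l a i = a" by (simp add: xexp_def)
    ultimately show ?thesis
      unfolding s by (subst prod.insert, simp, simp, subst prod.union_disjoint) auto
  qed
  have y: "(\<Prod>k=1..n. yvar k ^ yexp i l a k :: 's env) = yvar i ^ (l i - 1 - a) * (\<Prod>k\<in>{1..<i}. yvar k ^ l k)" for a
  proof -
    have "(\<Prod>k\<in>{i<..n}. yvar k ^ yexp i l a k :: 's env) = 1" by (rule prod.neutral) (auto simp: yexp_def)
    moreover have "(\<Prod>k\<in>{1..<i}. yvar k ^ yexp i l a k :: 's env) = (\<Prod>k\<in>{1..<i}. yvar k ^ l k)"
      by (rule prod.cong) (auto simp: yexp_def)
    moreover have "yexp i l a i = l i - 1 - a" by (simp add: yexp_def)
    ultimately show ?thesis
      unfolding s by (subst prod.insert, simp, simp, subst prod.union_disjoint) auto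
  qed
  have "dq i (mon l) = (\<Prod>j\<in>{1..<i}. yvar j ^ l j) * (\<Sum>a<l i. xvar i ^ a * yvar i ^ (l i - 1 - a)) * (\<Prod>j\<in>{i<..n}. xvar j ^ l j)"
    by (simp only: dq_mon[OF i] dq_mon_def powdiff_sum)
  also have "\<dots> = (\<Sum>a<l i. xymon (xexp i l a) (yexp i l a))"
    unfolding xymon_prod_form x y sum_distrib_left sum_distrib_right by (simp only: ac_simps)
  finally show ?thesis .
qed

text \<open>As \<open>is\<close> increases, the positions with an index below \<open>k\<close> form an initial segment, and its length
  is the number of factors that contribute their full exponent of x_k.\<close>

lemma sum_xexp:
  assumes "sorted_wrt (<) is"
  shows "(\<Sum>j<length is. xexp (is ! j) (ls ! j) (as ! j) k) = Q_exp ls is as k"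
proof -
  let ?p = "length is" and ?S = "{j. j < length is \<and> is ! j < k}"
  have S: "?S = {..<card ?S}"
  proof (rule downward_closed_eq_lessThan)
    fix i j assume "j \<in> ?S" "i < j"
    then show "i \<in> ?S" using sorted_wrt_nth_less[OF assms, of i j] by auto
  qed simp
  have "xexp (is ! j) (ls ! j) (as ! j) k = (if is ! j = k then as ! j else 0) + (if is ! j < k then (ls ! j) k else 0)" for j
    by (auto simp: xexp_def)
  then have "(\<Sum>j<?p. xexp (is ! j) (ls ! j) (as ! j) k) =
      (\<Sum>j<?p. if is ! j = k then as ! j else 0) + (\<Sum>j<?p. if is ! j < k then (ls ! j) k else 0)"
    by (simp add: sum.distrib)
  also have "(\<Sum>j<?p. if is ! j < k then (ls ! j) k else 0) = (\<Sum>j<card ?S. (ls ! j) k)"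
  proof -
    have "(\<Sum>j<?p. if is ! j < k then (ls ! j) k else 0) = (\<Sum>j\<in>?S. (ls ! j) k)"
      by (rule sum.mono_neutral_cong_right) auto
    then show ?thesis using S by simp
  qed
  also have "(\<Sum>j<?p. if is ! j = k then as ! j else 0) = (if k \<in> set is then as ! card ?S else 0)"
  proof (cases "k \<in> set is")
    case True
    then obtain j0 where j0: "j0 < ?p" "is ! j0 = k" by (metis in_set_conv_nth)
    have cmp: "is ! j < k \<longleftrightarrow> j < j0" "is ! j = k \<longleftrightarrow> j = j0" if "j < ?p" for j
      using sorted_wrt_nth_less[OF assms, of j j0] sorted_wrt_nth_less[OF assms, of j0 j] j0 that
      by (cases j j0 rule: linorder_cases; auto)+
    have "?S = {..<j0}" using cmp(1) j0 by auto
    then have "card ?S = j0" by simp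
    moreover have "(\<Sum>j<?p. if is ! j = k then as ! j else 0) = (\<Sum>j<?p. if j = j0 then as ! j0 else 0)"
      by (rule sum.cong) (auto simp: cmp)
    ultimately show ?thesis using True j0 by simp
  next
    case False
    then have "(\<Sum>j<?p. if is ! j = k then as ! j else 0) = 0" by (intro sum.neutral) (auto simp: in_set_conv_nth)
    then show ?thesis using False by simp
  qed
  finally show ?thesis by (simp add: Q_exp_def Let_def)
qed

lemma sum_yexp:
  assumes "sorted_wrt (<) is" "length ls = length is" "as \<in> a_choices ls is"
  shows "(\<Sum>j<length is. yexp (is ! j) (ls ! j) (as ! j) k) = Qhat_exp ls is as k"
proof -
  let ?p = "length is"
  have "xexp (is ! j) (ls ! j) (as ! j) k + yexp (is ! j) (ls ! j) (as ! j) k + (if is ! j = k then 1 else 0) = (ls ! j) k"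
    if "j < ?p" for j
  proof -
    have "as ! j < (ls ! j) (is ! j)" using assms(3) that by (simp add: a_choices_def)
    then show ?thesis by (auto simp: xexp_def yexp_def)
  qed
  then have "(\<Sum>j<?p. xexp (is ! j) (ls ! j) (as ! j) k + yexp (is ! j) (ls ! j) (as ! j) k + (if is ! j = k then 1 else 0)) =
     (\<Sum>j<?p. (ls ! j) k)"
    by (intro sum.cong) auto
  moreover have "(\<Sum>j<?p. if is ! j = k then 1 else 0) = (if k \<in> set is then 1 else 0 :: nat)"
  proof (cases "k \<in> set is")
    case True
    then obtain j0 where j0: "j0 < ?p" "is ! j0 = k" by (metis in_set_conv_nth)
    have "distinct is" using assms(1) by (simp add: strict_sorted_iff)
    then have "(\<Sum>j<?p. if is ! j = k then 1 else 0) = (\<Sum>j<?p. if j = j0 then 1 else 0 :: nat)"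
      using j0 by (intro sum.cong) (auto simp: nth_eq_iff_index_eq)
    then show ?thesis using j0 True by simp
  next
    case False
    then have "(\<Sum>j<?p. if is ! j = k then 1 else 0 :: nat) = 0" by (intro sum.neutral) (auto simp: in_set_conv_nth)
    then show ?thesis using False by simp
  qed
  ultimately show ?thesis
    using assms(2) by (simp add: Qhat_exp_def sum.distrib sum_xexp[OF assms(1)])
qed

lemma prod_dq_mon:
  assumes "is \<in> incr_seqs n p" "length ls = p"
  shows "(\<Prod>j<p. dq (is ! j) (mon (ls ! j))) = (\<Sum>as\<in>a_choices ls is. xymon (Q_exp ls is as) (Qhat_exp ls is as))"
proof -
  have l: "length is = p" and s: "set is \<subseteq> {1..n}" and so: "sorted_wrt (<) is"
    using assms(1) by (auto simp: incr_seqs_def)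
  have "(\<Prod>j<p. dq (is ! j) (mon (ls ! j))) =
     (\<Prod>j<p. \<Sum>a<(ls ! j) (is ! j). xymon (xexp (is ! j) (ls ! j) a) (yexp (is ! j) (ls ! j) a))"
  proof (rule prod.cong[OF refl])
    fix j assume "j \<in> {..<p}"
    then have "is ! j \<in> set is" using l by simp
    then show "dq (is ! j) (mon (ls ! j)) = (\<Sum>a<(ls ! j) (is ! j). xymon (xexp (is ! j) (ls ! j) a) (yexp (is ! j) (ls ! j) a))"
      using s by (intro dq_mon_expand) blast
  qed
  also have "\<dots> = (\<Sum>as\<in>a_choices ls is. \<Prod>j<p. xymon (xexp (is ! j) (ls ! j) (as ! j)) (yexp (is ! j) (ls ! j) (as ! j)))"
    unfolding prod_sum_lists by (simp add: a_choices_def l)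
  also have "\<dots> = (\<Sum>as\<in>a_choices ls is. xymon (Q_exp ls is as) (Qhat_exp ls is as))"
  proof (rule sum.cong[OF refl])
    fix as assume "as \<in> a_choices ls is"
    then show "(\<Prod>j<p. xymon (xexp (is ! j) (ls ! j) (as ! j)) (yexp (is ! j) (ls ! j) (as ! j))) =
       xymon (Q_exp ls is as) (Qhat_exp ls is as)"
      using sum_xexp[OF so, of ls as] sum_yexp[OF so, of ls as] l assms(2)
      by (simp add: xymon_prod)
  qed
  finally show ?thesis .
qed

lemma ract_sum_left: "ract (sum r I) u \<approx>K (\<Sum>i\<in>I. ract (r i) u)"
proof (induction I rule: infinite_finite_induct)
  case (insert i I)
  have "ract (r i + sum r I) u \<approx>K ract (r i) u + ract (sum r I) u" by (rule ract_add)
  also have "\<dots> \<approx>K ract (r i) u + (\<Sum>i\<in>I. ract (r i) u)" by (intro eqm_add eqm_refl insert.IH)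
  finally show ?case using insert by simp
qed simp_all

lemma ract_xymon: "ract (xymon \<alpha> \<beta>) (frag_of ([1, 1], ws)) \<approx>K frag_of ([mon \<alpha>, mon \<beta>], ws)"
proof -
  have "mon (Poly_Mapping.lookup (restr \<beta>)) = mon \<beta>" by (rule mon_cong) (simp add: lookup_restr)
  then show ?thesis
    using ract_single[of "restr \<beta>" "mon \<alpha>" "frag_of ([1, 1], ws)"] by (simp add: xymon_def)
qed

lemma psig_monomials:
  assumes "length ls = p"
  shows "psig ([1] @ map mon ls @ [1]) \<approx>K (\<Sum>is\<in>incr_seqs n p. \<Sum>as\<in>a_choices ls is.
     frag_of ([mon (Q_exp ls is as), mon (Qhat_exp ls is as)], map v is))"
proof -
  have "psig ([1] @ map mon ls @ [1]) \<approx>K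
     (\<Sum>is\<in>incr_seqs n p. ract (\<Prod>j<p. dq (is ! j) (map mon ls ! j)) (frag_of ([1, 1], map v is)))"
    using psig_expand[of 1 "map mon ls" 1] assms by simp
  also have "\<dots> = (\<Sum>is\<in>incr_seqs n p. ract (\<Sum>as\<in>a_choices ls is. xymon (Q_exp ls is as) (Qhat_exp ls is as)) (frag_of ([1, 1], map v is)))"
    using assms by (intro sum.cong refl) (simp flip: prod_dq_mon)
  also have "\<dots> \<approx>K (\<Sum>is\<in>incr_seqs n p. \<Sum>as\<in>a_choices ls is. ract (xymon (Q_exp ls is as) (Qhat_exp ls is as)) (frag_of ([1, 1], map v is)))"
    by (intro eqm_sum ract_sum_left)
  also have "\<dots> \<approx>K (\<Sum>is\<in>incr_seqs n p. \<Sum>as\<in>a_choices ls is.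
     frag_of ([mon (Q_exp ls is as), mon (Qhat_exp ls is as)], map v is))"
    by (intro eqm_sum ract_xymon)
  finally show ?thesis .
qed

section \<open>Psi is determined by its values on monomials\<close>

lemma pure_eq: "length xs = q \<Longrightarrow> pure sS xs = cls (tpow_gens q) (tpow_rels sS q) (frag_of xs)"
  by (simp add: pure_def)

text \<open>By S^e-linearity it is enough to compare the maps on 1 \<otimes> f_1 \<otimes> ... \<otimes> f_p \<otimes> 1, and by multilinearity
  the f_j may be taken to be monomials.\<close>

lemma env_linear_eqI:
  assumes f: "env_linear (bar sS p) (kos sV sS p) f" and g: "env_linear (bar sS p) (kos sV sS p) g"
    and eq: "\<And>ls. length ls = p \<Longrightarrow> f (pure sS ([1] @ map mon ls @ [1])) = g (pure sS ([1] @ map mon ls @ [1]))"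
    and x: "x \<in> carrier (bar sS p)"
  shows "f x = g x"
proof -
  interpret B: frag_mod "bar sS p" "XB p" "RB p" "\<lambda>a b u. aL a (aR b u)" by (rule bar_mod)
  interpret K: frag_mod "kos sV sS p" "XK p" "RK p" "\<lambda>a b u. kL a (kR b u)" by (rule kos_mod)
  interpret Kg: comm_group "kos sV sS p" by (rule env_mod.comm[OF K.env_mod])
  let ?c = "bar_cls p"
  define ag where "ag u \<longleftrightarrow> f (?c u) = g (?c u)" for u
  have fh: "f \<in> hom (bar sS p) (kos sV sS p)" "\<And>a b x. x \<in> carrier (bar sS p) \<Longrightarrow> f (act (bar sS p) a b x) = act (kos sV sS p) a b (f x)"
    using f unfolding env_linear_def by blast+
  have gh: "g \<in> hom (bar sS p) (kos sV sS p)" "\<And>a b x. x \<in> carrier (bar sS p) \<Longrightarrow> g (act (bar sS p) a b x) = act (kos sV sS p) a b (g x)"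
    using g unfolding env_linear_def by blast+
  have ag_add: "ag (u + w)" if "ag u" "ag w" "u \<in> frags_on (XB p)" "w \<in> frags_on (XB p)" for u w
    using that hom_mult[OF fh(1), of "?c u" "?c w"] hom_mult[OF gh(1), of "?c u" "?c w"]
    by (simp add: ag_def B.mult_cls B.cls_carrier)
  have ag_act: "ag (aL a (aR b u))" if "ag u" "u \<in> frags_on (XB p)" for a b u
    using that fh(2)[of "?c u" a b] gh(2)[of "?c u" a b] by (simp add: ag_def B.act_cls B.cls_carrier)
  have ag_eq: "ag u" if "ag w" "u \<approx>B w" "u \<in> frags_on (XB p)" "w \<in> frags_on (XB p)" for u w
    using B.cls_eqI[OF projB[OF that(2,3,4)]] that(1) by (simp add: ag_def)
  \<comment> \<open>The entries of m are arbitrary, those after m are monomials already; m is consumed from the right.\<close>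
  have ag_mon: "ag (frag_of (a # m @ map mon ls @ [1]))" if "length m + length ls = p" for a m ls
    using that
  proof (induction m arbitrary: ls a rule: rev_induct)
    case Nil
    have "ag (frag_of (1 # map mon ls @ [1]))"
      using eq[of ls] Nil by (simp add: ag_def pure_eq[of _ "p + 2"])
    from ag_act[OF this, of a 1] show ?case using Nil by (simp add: aRg_def)
  next
    case (snoc x m)
    show ?case
    proof (induction x arbitrary: a rule: mon_induct)
      case (mon l)
      show ?case using snoc.IH[of "l # ls" a] snoc.prems by simp
    next
      case (add x y)
      let ?f = "\<lambda>x. frag_of ((a # m) @ x # map mon ls @ [1])"
      have "ag (?f (x + y))"
        by (rule ag_eq[OF ag_add B_add]) (use add[of a] snoc.prems in \<open>auto intro!: frags_on_add\<close>)
      then show ?case by simp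
    next
      case (scale c x)
      let ?f = "\<lambda>x. frag_of ((a # m) @ x # map mon ls @ [1])"
      have on: "?f z \<in> frags_on (XB p)" for z using snoc.prems by simp
      have "?f (sS c x) \<approx>B aL (sc c) (?f x)" by (rule B_scale)
      also have "\<dots> \<approx>B aL (sc c) (aR 1 (?f x))" by (intro aL_cong eqm_sym[OF aR_1])
      finally have eqv: "?f (sS c x) \<approx>B aL (sc c) (aR 1 (?f x))" .
      have "ag (?f x)" using scale[of a] by (simp only: append_Cons append_assoc append_Nil)
      from ag_eq[OF ag_act[OF this on] eqv on aLR_on[OF on]] have "ag (?f (sS c x))" .
      then show ?case by simp
    qed
  qed
  have ag_of: "ag (frag_of xs)" if xs: "xs \<in> XB p" for xs
  proof -
    obtain a m b where m: "xs = a # m @ [b]" using xs by (cases xs rule: bar_gen_cases) auto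
    have "ag (aL 1 (aR b (frag_of (a # m @ map mon [] @ [1]))))"
      using xs m by (intro ag_act ag_mon) auto
    then show ?thesis by (simp add: m aRg_def)
  qed
  obtain u where u: "u \<in> frags_on (XB p)" "x = ?c u" using x by (rule B.carrierE)
  have "u \<in> frags_on (XB p) \<and> ag u"
    using u(1)
  proof (induction rule: frags_on_induct)
    case zero
    have "ag 0 \<longleftrightarrow> f (?c 0) = g (?c 0)" by (simp add: ag_def)
    moreover have "f (?c 0) \<otimes>\<^bsub>kos sV sS p\<^esub> f (?c 0) = f (?c 0)" "g (?c 0) \<otimes>\<^bsub>kos sV sS p\<^esub> g (?c 0) = g (?c 0)"
      using hom_mult[OF fh(1), of "?c 0" "?c 0"] hom_mult[OF gh(1), of "?c 0" "?c 0"]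
      by (simp_all add: B.mult_cls B.cls_carrier)
    moreover have "f (?c 0) \<in> carrier (kos sV sS p)" "g (?c 0) \<in> carrier (kos sV sS p)"
      using hom_in_carrier[OF fh(1)] hom_in_carrier[OF gh(1)] by (simp_all add: B.cls_carrier)
    ultimately show ?case by simp
  next
    case (one xs)
    then show ?case by (simp add: ag_of)
  next
    case (diff u w)
    let ?d = "?c (u - w)"
    have d: "u - w \<in> frags_on (XB p)" using diff by (auto intro: frags_on_diff)
    have "f ?d \<otimes>\<^bsub>kos sV sS p\<^esub> f (?c w) = f (?c u)" "g ?d \<otimes>\<^bsub>kos sV sS p\<^esub> g (?c w) = g (?c u)"
      using hom_mult[OF fh(1), of ?d "?c w"] hom_mult[OF gh(1), of ?d "?c w"] d diff
      by (simp_all add: B.mult_cls B.cls_carrier)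
    moreover have "f ?d \<in> carrier (kos sV sS p)" "g ?d \<in> carrier (kos sV sS p)" "f (?c w) \<in> carrier (kos sV sS p)"
      using hom_in_carrier[OF fh(1)] hom_in_carrier[OF gh(1)] d diff by (simp_all add: B.cls_carrier)
    ultimately have "f ?d = g ?d"
      using diff by (simp add: ag_def) (metis Kg.right_cancel)
    then show ?case using d by (simp add: ag_def)
  qed
  then show ?thesis using u(2) by (simp add: ag_def)
qed

lemma Psi_eq: "Psi sV sS \<iota> v n p = restrict (PsiL p) (carrier (bar sS p))"
proof -
  let ?c = "kos_cls p"
  let ?val = "\<lambda>ls. \<Sum>is\<in>incr_seqs n p. \<Sum>as\<in>a_choices ls is.
             frag_of ([mon (Q_exp ls is as), mon (Qhat_exp ls is as)], map v is)"
  interpret B: frag_mod "bar sS p" "XB p" "RB p" "\<lambda>a b u. aL a (aR b u)" by (rule bar_mod)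
  interpret K: frag_mod "kos sV sS p" "XK p" "RK p" "\<lambda>a b u. kL a (kR b u)" by (rule kos_mod)
  let ?R = "restrict (PsiL p) (carrier (bar sS p))"
  have lin: "env_linear (bar sS p) (kos sV sS p) ?R"
    by (rule frag_mod_linear[OF bar_mod kos_mod resp_psi_p psig_on])
       (simp_all add: psi_aL psi_aR PsiL_cls B.cls_carrier)
  have val: "?R (pure sS ([1] @ map mon ls @ [1])) = ?c (?val ls)" if ls: "length ls = p" for ls
  proof -
    have on: "[1] @ map mon ls @ [1] \<in> XB p" using ls by simp
    then have "?R (pure sS ([1] @ map mon ls @ [1])) = ?c (psig ([1] @ map mon ls @ [1]))"
      using PsiL_cls[of p "frag_of ([1] @ map mon ls @ [1])"]
      by (simp add: pure_eq[of _ "p + 2"] B.cls_carrier ls)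
    also have "\<dots> = ?c (?val ls)"
      by (intro K.cls_eqI projK psig_monomials ls psig_on[OF on] frags_on_sum) (auto simp: incr_seqs_def)
    finally show ?thesis .
  qed
  let ?P = "\<lambda>\<psi>. \<psi> \<in> extensional (carrier (bar sS p)) \<and> env_linear (bar sS p) (kos sV sS p) \<psi> \<and>
     (\<forall>ls. length ls = p \<longrightarrow> \<psi> (pure sS ([1] @ map mon ls @ [1])) = ?c (?val ls))"
  have P: "?P ?R"
    by (intro conjI lin restrict_extensional allI impI val)
  have "\<psi> = ?R" if \<psi>: "?P \<psi>" for \<psi>
  proof (rule extensionalityI)
    show "\<psi> \<in> extensional (carrier (bar sS p))" using \<psi> by (rule conjunct1)
    show "?R \<in> extensional (carrier (bar sS p))" by (rule restrict_extensional)
    have \<psi>_lin: "env_linear (bar sS p) (kos sV sS p) \<psi>" using \<psi> by (rule conjunct2[THEN conjunct1])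
    fix x assume "x \<in> carrier (bar sS p)"
    show "\<psi> x = ?R x"
    proof (rule env_linear_eqI[OF \<psi>_lin lin])
      fix ls :: "(nat \<Rightarrow> nat) list" assume ls: "length ls = p"
      have "\<psi> (pure sS ([1] @ map mon ls @ [1])) = ?c (?val ls)"
        using \<psi>[THEN conjunct2, THEN conjunct2] ls by blast
      then show "\<psi> (pure sS ([1] @ map mon ls @ [1])) = ?R (pure sS ([1] @ map mon ls @ [1]))"
        using val[OF ls] by (simp only:)
    qed fact
  qed
  with P show ?thesis unfolding Psi_def by (rule the_equality)
qed

lemma Psi_cls: "u \<in> frags_on (XB p) \<Longrightarrow> Psi sV sS \<iota> v n p (bar_cls p u) = kos_cls p (psi u)"
  using frag_mod.cls_carrier[OF bar_mod] by (simp add: Psi_eq PsiL_cls)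

lemma Psi_linear: "env_linear (bar sS p) (kos sV sS p) (Psi sV sS \<iota> v n p)"
  by (rule frag_mod_linear[OF bar_mod kos_mod resp_psi_p psig_on _ Psi_cls]) (simp_all add: psi_aL psi_aR)

end


section \<open>Tensoring chain homotopies\<close>

lemma env_linear_hom: "env_linear M N f \<Longrightarrow> f \<in> hom M N"
  by (simp add: env_linear_def)

lemma env_linear_closed: "env_linear M N f \<Longrightarrow> x \<in> carrier M \<Longrightarrow> f x \<in> carrier N"
  by (metis env_linear_hom hom_in_carrier)

lemma env_linear_comp:
  assumes "env_linear M N f" "env_linear N L g"
  shows "env_linear M L (\<lambda>x. g (f x))"
  using assms hom_compose[of f M N g L] env_linear_closed[OF assms(1)]
  unfolding env_linear_def by (simp add: comp_def)

lemma env_linear_id: "env_linear M M (\<lambda>x. x)"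
  by (simp add: env_linear_def hom_def)

lemma stensor_map_id: "env_mod M \<Longrightarrow> C \<in> carrier (stensor M) \<Longrightarrow> stensor_map M (\<lambda>x. x) C = C"
proof (elim stensor_carrierE)
  fix u assume M: "env_mod M" and C: "C = cls (stensor_gens M) (stensor_rels M) u"
  have "frag_extend (smap (\<lambda>x. x)) u = frag_extend frag_of u"
    by (rule frag_extend_eq) (auto simp: smap_def)
  then show "stensor_map M (\<lambda>x. x) C = C"
    by (simp add: C stensor_map_cls[OF M M env_linear_id])
qed

text \<open>A map with trivial values is its own double.\<close>

lemma stensor_map_const_one:
  assumes M: "env_mod M" and N: "env_mod N" and k: "env_linear M N k"
    and one: "\<And>x. x \<in> carrier M \<Longrightarrow> k x = \<one>\<^bsub>N\<^esub>" and C: "C \<in> carrier (stensor M)"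
  shows "stensor_map N k C = \<one>\<^bsub>stensor N\<^esub>"
proof -
  interpret N: env_mod N by fact
  interpret Ng: comm_group N by (rule N.comm)
  interpret S: comm_group "stensor N"
    unfolding stensor_def by (rule comm_group_presented[OF N.stensor_rels_on])
  have "stensor_map N k C = stensor_map N k C \<otimes>\<^bsub>stensor N\<^esub> stensor_map N k C"
    by (rule stensor_map_mult[OF M N k k k _ C]) (simp add: one)
  moreover have "stensor_map N k C \<in> carrier (stensor N)"
    using hom_in_carrier[OF stensor_map_hom[OF M N k] C] .
  ultimately show ?thesis by (metis S.r_cancel_one)
qed

section \<open>Scalar multiplication\<close>

definition sscale :: "('k \<Rightarrow> 's \<Rightarrow> 's) \<Rightarrow> 'k \<Rightarrow> 's \<times> 'm \<Rightarrow> ('s \<times> 'm \<Rightarrow>\<^sub>0 int)" where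
  "sscale sS c = (\<lambda>(s, x). frag_of (sS c s, x))"

lemma (in symmetric_algebra) sscale_resp:
  "resp (stensor_rels M) (stensor_rels M) (sscale sS c)"
  unfolding resp_def
proof
  fix r assume "r \<in> stensor_rels M"
  then consider
    (1) s t x where "r = frag_of (s + t, x) - frag_of (s, x) - frag_of (t, x)" "x \<in> carrier M"
  | (2) s x y where "r = frag_of (s, x \<otimes>\<^bsub>M\<^esub> y) - frag_of (s, x) - frag_of (s, y)" "x \<in> carrier M" "y \<in> carrier M"
  | (3) s a b x where "r = frag_of (b * s * a, x) - frag_of (s, act M a b x)" "x \<in> carrier M"
    unfolding stensor_rels_def by blast
  then have "frag_extend (sscale sS c) r \<in> stensor_rels M"
  proof cases
    case 1
    have "frag_of (sS c s + sS c t, x) - frag_of (sS c s, x) - frag_of (sS c t, x) \<in> stensor_rels M"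
      using 1(2) unfolding stensor_rels_def by blast
    then show ?thesis by (simp add: 1 frag_extend_diff sscale_def vs2.scale_right_distrib)
  next
    case 2
    have "frag_of (sS c s, x \<otimes>\<^bsub>M\<^esub> y) - frag_of (sS c s, x) - frag_of (sS c s, y) \<in> stensor_rels M"
      using 2(2,3) unfolding stensor_rels_def by blast
    then show ?thesis by (simp add: 2 frag_extend_diff sscale_def)
  next
    case 3
    have "frag_of (b * sS c s * a, x) - frag_of (sS c s, act M a b x) \<in> stensor_rels M"
      using 3(2) unfolding stensor_rels_def by blast
    moreover have "sS c (b * s * a) = b * sS c s * a"
    proof -
      have "sS c (b * s * a) = sS c (s * (b * a))" by (simp add: ac_simps)
      also have "\<dots> = sS c s * (b * a)" by (rule scale_mult)
      finally show ?thesis by (simp add: ac_simps)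
    qed
    ultimately show ?thesis by (simp add: 3 frag_extend_diff sscale_def)
  qed
  then show "eqm (stensor_rels M) (frag_extend (sscale sS c) r) 0"
    by (simp add: eqm_zero_iff gensub.base)
qed

context symmetric_algebra
begin

lemma stensor_scale_eq: "stensor_scale sS M c = lift (stensor_gens M) (stensor_rels M) (sscale sS c)"
  by (simp only: stensor_scale_def sscale_def)

lemma stensor_scale_cls:
  assumes "env_mod M"
  shows "stensor_scale sS M c (cls (stensor_gens M) (stensor_rels M) u) =
    cls (stensor_gens M) (stensor_rels M) (frag_extend (sscale sS c) u)"
  unfolding stensor_scale_eq
  by (rule lift_cls[OF env_mod.stensor_rels_on[OF assms] env_mod.stensor_rels_on[OF assms] sscale_resp])

lemma stensor_scale_hom:
  assumes "env_mod M" shows "stensor_scale sS M c \<in> hom (stensor M) (stensor M)"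
  unfolding stensor_scale_eq stensor_def
  by (rule lift_hom[OF env_mod.stensor_rels_on[OF assms] env_mod.stensor_rels_on[OF assms] sscale_resp])
     (auto simp: sscale_def stensor_gens_def)

lemma stensor_scale_map:
  assumes M: "env_mod M" and N: "env_mod N" and f: "env_linear M N f" and C: "C \<in> carrier (stensor M)"
  shows "stensor_map N f (stensor_scale sS M c C) = stensor_scale sS N c (stensor_map N f C)"
proof -
  obtain u where u: "C = cls (stensor_gens M) (stensor_rels M) u" using C by (rule stensor_carrierE)
  have "frag_extend (\<lambda>z. frag_extend (smap f) (sscale sS c z)) u = frag_extend (\<lambda>z. frag_extend (sscale sS c) (smap f z)) u"
    by (rule frag_extend_eq) (auto simp: smap_def sscale_def)
  then show ?thesis
    by (simp add: u stensor_scale_cls[OF M] stensor_scale_cls[OF N] stensor_map_cls[OF M N f] frag_extend_extend)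
qed

end

section \<open>Hochschild homology\<close>

context sym_basis
begin

lemma env_mod_bar: "env_mod (bar sS p)" by (rule frag_mod.env_mod[OF bar_mod])
lemma env_mod_kos: "env_mod (kos sV sS p)" by (rule frag_mod.env_mod[OF kos_mod])

lemma barE:
  assumes "x \<in> carrier (bar sS p)"
  obtains u where "u \<in> frags_on (XB p)" "x = bar_cls p u"
  using frag_mod.carrierE[OF bar_mod assms] .

lemma kosE:
  assumes "x \<in> carrier (kos sV sS p)"
  obtains u where "u \<in> frags_on (XK p)" "x = kos_cls p u"
  using frag_mod.carrierE[OF kos_mod assms] .

abbreviation "PsiD p \<equiv> Psi sV sS \<iota> v n p"
abbreviation "bdD p \<equiv> bar_diff sS (Suc p)"
abbreviation "kdD p \<equiv> kos_diff sV sS \<iota> (Suc p)"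

lemma bd_XB: "u \<in> frags_on (XB (Suc p)) \<Longrightarrow> bd u \<in> frags_on (XB p)"
  by (rule bd_on) simp
lemma kbd_XK: "u \<in> frags_on (XK (Suc p)) \<Longrightarrow> kbd u \<in> frags_on (XK p)"
  by (erule frags_on_extend) (rule kbdg_on)
lemma Ph_XB: "u \<in> frags_on (XK p) \<Longrightarrow> Ph p u \<in> frags_on (XB p)"
  by (erule frags_on_extend) (rule phi_on)
lemma Htpy_XB: "u \<in> frags_on (XB p) \<Longrightarrow> Htpy p u \<in> frags_on (XB (Suc p))"
  by (erule frags_on_extend) (rule htpy_on')

lemma eqB_cls: "u \<approx>B w \<Longrightarrow> u \<in> frags_on (XB p) \<Longrightarrow> w \<in> frags_on (XB p) \<Longrightarrow>
    bar_cls p u = bar_cls p w"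
  by (intro frag_mod.cls_eqI[OF bar_mod] projB) auto

lemma eqK_cls: "u \<approx>K w \<Longrightarrow> u \<in> frags_on (XK p) \<Longrightarrow> w \<in> frags_on (XK p) \<Longrightarrow>
    kos_cls p u = kos_cls p w"
  by (intro frag_mod.cls_eqI[OF kos_mod] projK)

lemma bar_diff_diff:
  assumes "x \<in> carrier (bar sS (Suc (Suc p)))" shows "bdD p (bdD (Suc p) x) = \<one>\<^bsub>bar sS p\<^esub>"
proof -
  obtain u where u: "u \<in> frags_on (XB (Suc (Suc p)))" "x = bar_cls (Suc (Suc p)) u"
    using assms by (rule barE)
  then show ?thesis
    by (simp only: bar_diff_cls bd_XB bd_bd frag_mod.on[OF bar_mod] one_presented[OF tpow_rels_on])
qed

lemma kos_diff_diff:
  assumes "x \<in> carrier (kos sV sS (Suc (Suc p)))" shows "kdD p (kdD (Suc p) x) = \<one>\<^bsub>kos sV sS p\<^esub>"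
proof -
  obtain u where u: "u \<in> frags_on (XK (Suc (Suc p)))" "x = kos_cls (Suc (Suc p)) u"
    using assms by (rule kosE)
  then show ?thesis
    by (simp only: kos_diff_cls kbd_XK kbd_kbd frag_mod.on[OF kos_mod] one_presented[OF tens_ext_rels_on])
qed

lemma Psi_chain:
  assumes "x \<in> carrier (bar sS (Suc p))" shows "PsiD p (bdD p x) = kdD p (PsiD (Suc p) x)"
proof -
  obtain u where u: "u \<in> frags_on (XB (Suc p))" "x = bar_cls (Suc p) u"
    using assms by (rule barE)
  show ?thesis
    unfolding u(2) bar_diff_cls[OF u(1)] Psi_cls[OF u(1)] Psi_cls[OF bd_XB[OF u(1)]] kos_diff_cls[OF psi_on[OF u(1)]]
    by (rule eqK_cls[OF eqm_sym[OF kbd_psi] psi_on[OF bd_XB[OF u(1)]] kbd_XK[OF psi_on[OF u(1)]]])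
qed

lemma Phi_chain:
  assumes "x \<in> carrier (kos sV sS (Suc p))" shows "PhiL p (kdD p x) = bdD p (PhiL (Suc p) x)"
proof -
  obtain u where u: "u \<in> frags_on (XK (Suc p))" "x = kos_cls (Suc p) u"
    using assms by (rule kosE)
  show ?thesis
    unfolding u(2) kos_diff_cls[OF u(1)] PhiL_cls bar_diff_cls[OF Ph_XB[OF u(1)]]
    by (rule eqB_cls[OF eqm_sym[OF bd_Ph] Ph_XB[OF kbd_XK[OF u(1)]] bd_XB[OF Ph_XB[OF u(1)]]])
qed

lemma Psi_Phi:
  assumes "y \<in> carrier (kos sV sS p)" shows "PsiD p (PhiL p y) = y"
proof -
  obtain u where u: "u \<in> frags_on (XK p)" "y = kos_cls p u" using assms by (rule kosE)
  show ?thesis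
    unfolding u(2) PhiL_cls Psi_cls[OF Ph_XB[OF u(1)]]
    by (rule eqK_cls[OF psi_Ph[OF u(1)] psi_on[OF Ph_XB[OF u(1)]] u(1)])
qed

lemma Phi_Psi_0:
  assumes "x \<in> carrier (bar sS 0)" shows "PhiL 0 (PsiD 0 x) = x \<otimes>\<^bsub>bar sS 0\<^esub> bdD 0 (HtpyL 0 x)"
proof -
  interpret B: frag_mod "bar sS 0" "XB 0" "RB 0" "\<lambda>a b u. aL a (aR b u)" by (rule bar_mod)
  obtain u where u: "u \<in> frags_on (XB 0)" "x = bar_cls 0 u" using assms by (rule barE)
  have "Htpy 0 u = 0" by (simp add: frag_extend_eq_0)
  moreover have "Ph 0 (psi u) = u" using u(1) by (intro Ph_psi_0) simp
  moreover have "bar_cls 0 u \<otimes>\<^bsub>bar sS 0\<^esub> bar_cls 0 0 = bar_cls 0 (u + 0)"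
    by (rule B.mult_cls[OF u(1) frags_on_0])
  ultimately show ?thesis
    unfolding u(2) HtpyL_cls Psi_cls[OF u(1)] PhiL_cls bar_diff_cls[OF Htpy_XB[OF u(1)]]
    by (simp only: frag_extend_0 add_0_right)
qed

lemma Phi_Psi_Suc:
  assumes "x \<in> carrier (bar sS (Suc p))"
  shows "PhiL (Suc p) (PsiD (Suc p) x) =
    x \<otimes>\<^bsub>bar sS (Suc p)\<^esub> (bdD (Suc p) (HtpyL (Suc p) x) \<otimes>\<^bsub>bar sS (Suc p)\<^esub> HtpyL p (bdD p x))"
proof -
  interpret B: frag_mod "bar sS (Suc p)" "XB (Suc p)" "RB (Suc p)" "\<lambda>a b u. aL a (aR b u)" by (rule bar_mod)
  obtain u where u: "u \<in> frags_on (XB (Suc p))" "x = bar_cls (Suc p) u" using assms by (rule barE)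
  let ?A = "bd (Htpy (Suc p) u)" and ?B = "Htpy p (bd u)"
  have on: "?A \<in> frags_on (XB (Suc p))" "?B \<in> frags_on (XB (Suc p))"
    by (rule bd_XB[OF Htpy_XB[OF u(1)]], rule Htpy_XB[OF bd_XB[OF u(1)]])
  have "u \<in> frags_on (tpow_gens (p + 3))" using u(1) by (simp add: numeral_3_eq_3 numeral_2_eq_2)
  from homotopy[OF this] have "Ph (Suc p) (psi u) - u - ?B + (u + ?B) \<approx>B ?A + (u + ?B)"
    by (intro eqm_add eqm_refl)
  then have "Ph (Suc p) (psi u) \<approx>B u + (?A + ?B)" by (simp add: algebra_simps del: phi.simps htpy.simps)
  then have "bar_cls (Suc p) (Ph (Suc p) (psi u)) = bar_cls (Suc p) (u + (?A + ?B))"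
    by (rule eqB_cls[OF _ Ph_XB[OF psi_on[OF u(1)]] frags_on_add[OF u(1) frags_on_add[OF on]]])
  also have "\<dots> = bar_cls (Suc p) u \<otimes>\<^bsub>bar sS (Suc p)\<^esub>
      (bar_cls (Suc p) ?A \<otimes>\<^bsub>bar sS (Suc p)\<^esub> bar_cls (Suc p) ?B)"
    unfolding B.mult_cls[OF on] B.mult_cls[OF u(1) frags_on_add[OF on]] ..
  finally show ?thesis
    unfolding u(2) HtpyL_cls Psi_cls[OF u(1)] PhiL_cls bar_diff_cls[OF u(1)] bar_diff_cls[OF Htpy_XB[OF u(1)]] .
qed

lemma bar_chain_diff_Suc: "bar_chain_diff sS (Suc p) = stensor_map (bar sS p) (bdD p)"
  by (simp add: bar_chain_diff_def)

lemma kos_chain_diff_Suc: "kos_chain_diff sV sS \<iota> (Suc p) = stensor_map (kos sV sS p) (kdD p)"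
  by (simp add: kos_chain_diff_def)

lemma bar_chain_cx: "chain_cx (bar_chains sS) (bar_chain_diff sS)"
proof (rule chain_cx.intro)
  fix p
  show "comm_group (bar_chains sS p)"
    unfolding bar_chains_def stensor_def by (rule comm_group_presented[OF env_mod.stensor_rels_on[OF env_mod_bar]])
  show "bar_chain_diff sS (Suc p) \<in> hom (bar_chains sS (Suc p)) (bar_chains sS p)"
    unfolding bar_chains_def bar_chain_diff_Suc by (rule stensor_map_hom[OF env_mod_bar env_mod_bar bar_diff_linear])
  fix x assume x: "x \<in> carrier (bar_chains sS (Suc (Suc p)))"
  note l = env_linear_comp[OF bar_diff_linear bar_diff_linear]
  have "bar_chain_diff sS (Suc p) (bar_chain_diff sS (Suc (Suc p)) x) = stensor_map (bar sS p) (\<lambda>x. bdD p (bdD (Suc p) x)) x"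
    unfolding bar_chain_diff_Suc
    by (rule stensor_map_comp[OF env_mod_bar env_mod_bar env_mod_bar bar_diff_linear bar_diff_linear l refl])
       (use x in \<open>simp add: bar_chains_def\<close>)
  also have "\<dots> = \<one>\<^bsub>bar_chains sS p\<^esub>"
    unfolding bar_chains_def
    by (rule stensor_map_const_one[OF env_mod_bar env_mod_bar l bar_diff_diff])
       (use x in \<open>simp_all add: bar_chains_def\<close>)
  finally show "bar_chain_diff sS (Suc p) (bar_chain_diff sS (Suc (Suc p)) x) = \<one>\<^bsub>bar_chains sS p\<^esub>" .
qed

lemma kos_chain_cx: "chain_cx (kos_chains sV sS) (kos_chain_diff sV sS \<iota>)"
proof (rule chain_cx.intro)
  fix p
  show "comm_group (kos_chains sV sS p)"
    unfolding kos_chains_def stensor_def by (rule comm_group_presented[OF env_mod.stensor_rels_on[OF env_mod_kos]])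
  show "kos_chain_diff sV sS \<iota> (Suc p) \<in> hom (kos_chains sV sS (Suc p)) (kos_chains sV sS p)"
    unfolding kos_chains_def kos_chain_diff_Suc by (rule stensor_map_hom[OF env_mod_kos env_mod_kos kos_diff_linear])
  fix x assume x: "x \<in> carrier (kos_chains sV sS (Suc (Suc p)))"
  note l = env_linear_comp[OF kos_diff_linear kos_diff_linear]
  have "kos_chain_diff sV sS \<iota> (Suc p) (kos_chain_diff sV sS \<iota> (Suc (Suc p)) x) =
      stensor_map (kos sV sS p) (\<lambda>x. kdD p (kdD (Suc p) x)) x"
    unfolding kos_chain_diff_Suc
    by (rule stensor_map_comp[OF env_mod_kos env_mod_kos env_mod_kos kos_diff_linear kos_diff_linear l refl])
       (use x in \<open>simp add: kos_chains_def\<close>)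
  also have "\<dots> = \<one>\<^bsub>kos_chains sV sS p\<^esub>"
    unfolding kos_chains_def
    by (rule stensor_map_const_one[OF env_mod_kos env_mod_kos l kos_diff_diff])
       (use x in \<open>simp_all add: kos_chains_def\<close>)
  finally show "kos_chain_diff sV sS \<iota> (Suc p) (kos_chain_diff sV sS \<iota> (Suc (Suc p)) x) = \<one>\<^bsub>kos_chains sV sS p\<^esub>" .
qed

abbreviation "Psi_chains p \<equiv> id_tensor_Psi sV sS \<iota> v n p"
abbreviation "Phi_chains p \<equiv> stensor_map (bar sS p) (PhiL p)"
abbreviation "htpy_chains p \<equiv> stensor_map (bar sS (Suc p)) (HtpyL p)"

lemma Psi_chains_hom: "Psi_chains p \<in> hom (bar_chains sS p) (kos_chains sV sS p)"
  unfolding id_tensor_Psi_def bar_chains_def kos_chains_def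
  by (rule stensor_map_hom[OF env_mod_bar env_mod_kos Psi_linear])

lemma Psi_chains_diff:
  assumes "x \<in> carrier (bar_chains sS (Suc p))"
  shows "Psi_chains p (bar_chain_diff sS (Suc p) x) = kos_chain_diff sV sS \<iota> (Suc p) (Psi_chains (Suc p) x)"
proof -
  have x: "x \<in> carrier (stensor (bar sS (Suc p)))" using assms by (simp add: bar_chains_def)
  note l = env_linear_comp[OF bar_diff_linear Psi_linear]
  have "Psi_chains p (bar_chain_diff sS (Suc p) x) = stensor_map (kos sV sS p) (\<lambda>x. PsiD p (bdD p x)) x"
    unfolding id_tensor_Psi_def bar_chain_diff_Suc
    by (rule stensor_map_comp[OF env_mod_bar env_mod_bar env_mod_kos bar_diff_linear Psi_linear l refl x])
  also have "\<dots> = kos_chain_diff sV sS \<iota> (Suc p) (Psi_chains (Suc p) x)"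
    unfolding id_tensor_Psi_def kos_chain_diff_Suc
    by (rule stensor_map_comp[OF env_mod_bar env_mod_kos env_mod_kos Psi_linear kos_diff_linear l _ x, symmetric])
       (simp add: Psi_chain)
  finally show ?thesis .
qed

lemma Phi_chains_diff:
  assumes "x \<in> carrier (kos_chains sV sS (Suc p))"
  shows "Phi_chains p (kos_chain_diff sV sS \<iota> (Suc p) x) = bar_chain_diff sS (Suc p) (Phi_chains (Suc p) x)"
proof -
  have x: "x \<in> carrier (stensor (kos sV sS (Suc p)))" using assms by (simp add: kos_chains_def)
  note l = env_linear_comp[OF kos_diff_linear PhiL_linear]
  have "Phi_chains p (kos_chain_diff sV sS \<iota> (Suc p) x) = stensor_map (bar sS p) (\<lambda>x. PhiL p (kdD p x)) x"
    unfolding kos_chain_diff_Suc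
    by (rule stensor_map_comp[OF env_mod_kos env_mod_kos env_mod_bar kos_diff_linear PhiL_linear l refl x])
  also have "\<dots> = bar_chain_diff sS (Suc p) (Phi_chains (Suc p) x)"
    unfolding bar_chain_diff_Suc
    by (rule stensor_map_comp[OF env_mod_kos env_mod_bar env_mod_bar PhiL_linear bar_diff_linear l _ x, symmetric])
       (simp add: Phi_chain)
  finally show ?thesis .
qed

lemma Psi_Phi_chains:
  assumes "y \<in> carrier (kos_chains sV sS p)" shows "Psi_chains p (Phi_chains p y) = y"
proof -
  have y: "y \<in> carrier (stensor (kos sV sS p))" using assms by (simp add: kos_chains_def)
  have "Psi_chains p (Phi_chains p y) = stensor_map (kos sV sS p) (\<lambda>x. x) y"
    unfolding id_tensor_Psi_def
    by (rule stensor_map_comp[OF env_mod_kos env_mod_bar env_mod_kos PhiL_linear Psi_linear env_linear_id Psi_Phi y])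
  then show ?thesis by (simp add: stensor_map_id[OF env_mod_kos y])
qed

lemma Phi_Psi_chains:
  assumes "x \<in> carrier (stensor (bar sS p))"
  shows "Phi_chains p (Psi_chains p x) = stensor_map (bar sS p) (\<lambda>x. PhiL p (PsiD p x)) x"
  unfolding id_tensor_Psi_def
  by (rule stensor_map_comp[OF env_mod_bar env_mod_kos env_mod_bar Psi_linear PhiL_linear
        env_linear_comp[OF Psi_linear PhiL_linear] refl assms])

lemma diff_htpy_chains:
  assumes "x \<in> carrier (stensor (bar sS p))"
  shows "bar_chain_diff sS (Suc p) (htpy_chains p x) = stensor_map (bar sS p) (\<lambda>x. bdD p (HtpyL p x)) x"
  unfolding bar_chain_diff_Suc
  by (rule stensor_map_comp[OF env_mod_bar env_mod_bar env_mod_bar HtpyL_linear bar_diff_linear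
        env_linear_comp[OF HtpyL_linear bar_diff_linear] refl assms])

lemma htpy_diff_chains:
  assumes "x \<in> carrier (stensor (bar sS (Suc p)))"
  shows "htpy_chains p (bar_chain_diff sS (Suc p) x) = stensor_map (bar sS (Suc p)) (\<lambda>x. HtpyL p (bdD p x)) x"
  unfolding bar_chain_diff_Suc
  by (rule stensor_map_comp[OF env_mod_bar env_mod_bar env_mod_bar bar_diff_linear HtpyL_linear
        env_linear_comp[OF bar_diff_linear HtpyL_linear] refl assms])

lemma Phi_Psi_chains_0:
  assumes "x \<in> carrier (bar_chains sS 0)"
  shows "Phi_chains 0 (Psi_chains 0 x) = x \<otimes>\<^bsub>bar_chains sS 0\<^esub> bar_chain_diff sS 1 (htpy_chains 0 x)"
proof -
  have x: "x \<in> carrier (stensor (bar sS 0))" using assms by (simp add: bar_chains_def)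
  have "stensor_map (bar sS 0) (\<lambda>x. PhiL 0 (PsiD 0 x)) x =
      stensor_map (bar sS 0) (\<lambda>x. x) x \<otimes>\<^bsub>stensor (bar sS 0)\<^esub> stensor_map (bar sS 0) (\<lambda>x. bdD 0 (HtpyL 0 x)) x"
    by (rule stensor_map_mult[OF env_mod_bar env_mod_bar env_linear_id env_linear_comp[OF HtpyL_linear bar_diff_linear]
          env_linear_comp[OF Psi_linear PhiL_linear] Phi_Psi_0 x])
  then show ?thesis
    using diff_htpy_chains[OF x] Phi_Psi_chains[OF x] stensor_map_id[OF env_mod_bar x]
    by (simp add: bar_chains_def One_nat_def)
qed

lemma env_linear_mult:
  assumes "env_linear (bar sS p) (bar sS q) f" "env_linear (bar sS p) (bar sS q) g"
  shows "env_linear (bar sS p) (bar sS q) (\<lambda>x. f x \<otimes>\<^bsub>bar sS q\<^esub> g x)"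
proof -
  interpret B: frag_mod "bar sS q" "XB q" "RB q" "\<lambda>a b u. aL a (aR b u)" by (rule bar_mod)
  interpret G: comm_group "bar sS q" by (rule env_mod.comm[OF env_mod_bar])
  note fc = env_linear_closed[OF assms(1)] and gc = env_linear_closed[OF assms(2)]
  have m: "act (bar sS q) a b (x \<otimes>\<^bsub>bar sS q\<^esub> y) = act (bar sS q) a b x \<otimes>\<^bsub>bar sS q\<^esub> act (bar sS q) a b y"
    if xy: "x \<in> carrier (bar sS q)" "y \<in> carrier (bar sS q)" for a b x y
  proof -
    obtain u where "u \<in> frags_on (XB q)" "x = cls (XB q) (RB q) u" using xy(1) by (rule barE)
    moreover obtain w where "w \<in> frags_on (XB q)" "y = cls (XB q) (RB q) w" using xy(2) by (rule barE)
    ultimately show ?thesis by (simp add: B.mult_cls B.act_cls B.A_on frags_on_add frag_lin)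
  qed
  have "(\<lambda>x. f x \<otimes>\<^bsub>bar sS q\<^esub> g x) \<in> hom (bar sS p) (bar sS q)"
  proof (rule homI)
    fix x y assume xy: "x \<in> carrier (bar sS p)" "y \<in> carrier (bar sS p)"
    have "f (x \<otimes>\<^bsub>bar sS p\<^esub> y) = f x \<otimes>\<^bsub>bar sS q\<^esub> f y" "g (x \<otimes>\<^bsub>bar sS p\<^esub> y) = g x \<otimes>\<^bsub>bar sS q\<^esub> g y"
      using hom_mult[OF env_linear_hom[OF assms(1)] xy] hom_mult[OF env_linear_hom[OF assms(2)] xy] by simp_all
    then show "f (x \<otimes>\<^bsub>bar sS p\<^esub> y) \<otimes>\<^bsub>bar sS q\<^esub> g (x \<otimes>\<^bsub>bar sS p\<^esub> y) =
      f x \<otimes>\<^bsub>bar sS q\<^esub> g x \<otimes>\<^bsub>bar sS q\<^esub> (f y \<otimes>\<^bsub>bar sS q\<^esub> g y)"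
      using fc[OF xy(1)] fc[OF xy(2)] gc[OF xy(1)] gc[OF xy(2)] by (simp add: G.m_ac)
  qed (simp add: fc gc)
  then show ?thesis using assms m fc gc unfolding env_linear_def by simp
qed

lemma Phi_Psi_chains_Suc:
  assumes "x \<in> carrier (bar_chains sS (Suc p))"
  shows "Phi_chains (Suc p) (Psi_chains (Suc p) x) = x \<otimes>\<^bsub>bar_chains sS (Suc p)\<^esub>
    (bar_chain_diff sS (Suc (Suc p)) (htpy_chains (Suc p) x) \<otimes>\<^bsub>bar_chains sS (Suc p)\<^esub> htpy_chains p (bar_chain_diff sS (Suc p) x))"
proof -
  let ?S = "stensor_map (bar sS (Suc p))"
  have x: "x \<in> carrier (stensor (bar sS (Suc p)))" using assms by (simp add: bar_chains_def)
  note dh = env_linear_comp[OF HtpyL_linear bar_diff_linear] and hd = env_linear_comp[OF bar_diff_linear HtpyL_linear]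
  let ?k = "\<lambda>x. bdD (Suc p) (HtpyL (Suc p) x) \<otimes>\<^bsub>bar sS (Suc p)\<^esub> HtpyL p (bdD p x)"
  have "?S (\<lambda>x. PhiL (Suc p) (PsiD (Suc p) x)) x = ?S (\<lambda>x. x) x \<otimes>\<^bsub>stensor (bar sS (Suc p))\<^esub> ?S ?k x"
    by (rule stensor_map_mult[OF env_mod_bar env_mod_bar env_linear_id env_linear_mult[OF dh hd]
          env_linear_comp[OF Psi_linear PhiL_linear] Phi_Psi_Suc x])
  also have "?S ?k x = ?S (\<lambda>x. bdD (Suc p) (HtpyL (Suc p) x)) x \<otimes>\<^bsub>stensor (bar sS (Suc p))\<^esub> ?S (\<lambda>x. HtpyL p (bdD p x)) x"
    by (rule stensor_map_mult[OF env_mod_bar env_mod_bar dh hd env_linear_mult[OF dh hd] refl x])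
  finally show ?thesis
    using diff_htpy_chains[OF x] htpy_diff_chains[OF x] Phi_Psi_chains[OF x] stensor_map_id[OF env_mod_bar x]
    by (simp add: bar_chains_def)
qed

lemma HH_Psi_iso: "HH_Psi sV sS \<iota> v n p \<in> iso (HH_bar sS p) (HH_kos sV sS \<iota> p)"
  unfolding HH_Psi_def HH_bar_def HH_kos_def
proof (rule homotopy_equivalence_homology_iso[where g = Phi_chains and h = htpy_chains, OF bar_chain_cx kos_chain_cx Psi_chains_hom])
  fix p
  show "Phi_chains p \<in> hom (kos_chains sV sS p) (bar_chains sS p)"
    unfolding bar_chains_def kos_chains_def by (rule stensor_map_hom[OF env_mod_kos env_mod_bar PhiL_linear])
  show "htpy_chains p \<in> hom (bar_chains sS p) (bar_chains sS (Suc p))"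
    unfolding bar_chains_def by (rule stensor_map_hom[OF env_mod_bar env_mod_bar HtpyL_linear])
qed (rule Psi_chains_diff Phi_chains_diff Psi_Phi_chains Phi_Psi_chains_0 Phi_Psi_chains_Suc, assumption)+

lemma HH_Psi_scale:
  assumes X: "X \<in> carrier (HH_bar sS p)"
  shows "HH_Psi sV sS \<iota> v n p (HH_bar_scale sS p c X) = HH_kos_scale sV sS \<iota> p c (HH_Psi sV sS \<iota> v n p X)"
proof -
  let ?bar = "bar_chains sS" and ?kos = "kos_chains sV sS" and ?d = "bar_chain_diff sS" and ?e = "kos_chain_diff sV sS \<iota>"
  let ?sb = "\<lambda>p. stensor_scale sS (bar sS p) c" and ?sk = "\<lambda>p. stensor_scale sS (kos sV sS p) c"
  have sb: "?sb p \<in> hom (?bar p) (?bar p)" for p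
    unfolding bar_chains_def by (rule stensor_scale_hom[OF env_mod_bar])
  have sk: "?sk p \<in> hom (?kos p) (?kos p)" for p
    unfolding kos_chains_def by (rule stensor_scale_hom[OF env_mod_kos])
  have sbd: "?sb p (?d (Suc p) x) = ?d (Suc p) (?sb (Suc p) x)" if "x \<in> carrier (?bar (Suc p))" for p x
    using that unfolding bar_chains_def bar_chain_diff_Suc
    by (rule stensor_scale_map[OF env_mod_bar env_mod_bar bar_diff_linear, symmetric])
  have skd: "?sk p (?e (Suc p) x) = ?e (Suc p) (?sk (Suc p) x)" if "x \<in> carrier (?kos (Suc p))" for p x
    using that unfolding kos_chains_def kos_chain_diff_Suc
    by (rule stensor_scale_map[OF env_mod_kos env_mod_kos kos_diff_linear, symmetric])
  have vb: "homology_map ?bar ?d p (?sb p) (boundaries ?bar ?d p #>\<^bsub>?bar p\<^esub> z) = boundaries ?bar ?d p #>\<^bsub>?bar p\<^esub> ?sb p z"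
    if "z \<in> carrier (?bar p)" for z
    by (rule chain_map_cycles(3)[where f = ?sb, OF bar_chain_cx bar_chain_cx sb _ that]) (rule sbd)
  have vk: "homology_map ?kos ?e p (?sk p) (boundaries ?kos ?e p #>\<^bsub>?kos p\<^esub> z) = boundaries ?kos ?e p #>\<^bsub>?kos p\<^esub> ?sk p z"
    if "z \<in> carrier (?kos p)" for z
    by (rule chain_map_cycles(3)[where f = ?sk, OF kos_chain_cx kos_chain_cx sk _ that]) (rule skd)
  have vf: "homology_map ?kos ?e p (Psi_chains p) (boundaries ?bar ?d p #>\<^bsub>?bar p\<^esub> z) = boundaries ?kos ?e p #>\<^bsub>?kos p\<^esub> Psi_chains p z"
    if "z \<in> carrier (?bar p)" for z
    by (rule chain_map_cycles(3)[where f = Psi_chains, OF bar_chain_cx kos_chain_cx Psi_chains_hom _ that]) (rule Psi_chains_diff)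
  obtain z where z: "z \<in> cycles ?bar ?d p" "X = boundaries ?bar ?d p #>\<^bsub>?bar p\<^esub> z"
    using X unfolding HH_bar_def chain_cx.homology_carrier[OF bar_chain_cx] by blast
  have zc: "z \<in> carrier (?bar p)" using chain_cx.cyclesD(1)[OF bar_chain_cx z(1)] .
  have "Psi_chains p (?sb p z) = ?sk p (Psi_chains p z)"
    unfolding id_tensor_Psi_def
    using zc by (intro stensor_scale_map[OF env_mod_bar env_mod_kos Psi_linear]) (simp add: bar_chains_def)
  then show ?thesis
    unfolding HH_Psi_def HH_bar_scale_def HH_kos_scale_def z(2)
    by (simp only: vb[OF zc] vf[OF zc] vf[OF hom_in_carrier[OF sb zc]] vk[OF hom_in_carrier[OF Psi_chains_hom zc]])
qed

end


section \<open>The chain map on Hochschild chains\<close>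

lemma (in env_mod) stensor_add: "x \<in> carrier M \<Longrightarrow>
    eqm (stensor_rels M) (frag_of (s + t, x)) (frag_of (s, x) + frag_of (t, x))"
  unfolding stensor_rels_def by (rule eqm_base) (auto simp: diff_diff_eq)

lemma (in env_mod) stensor_act: "x \<in> carrier M \<Longrightarrow>
    eqm (stensor_rels M) (frag_of (b * s * a, x)) (frag_of (s, act M a b x))"
  unfolding stensor_rels_def by (rule eqm_base) blast

lemma (in env_mod) stensor_sum_left:
  assumes x: "x \<in> carrier M"
  shows "eqm (stensor_rels M) (frag_of (sum f I, x)) (\<Sum>i\<in>I. frag_of (f i, x))"
proof -
  have zero: "eqm (stensor_rels M) (frag_of (0, x)) 0"
    using stensor_add[OF x, of 0 0] by (simp add: eqm_double)
  show ?thesis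
  proof (induction I rule: infinite_finite_induct)
    case (insert i I)
    have "eqm (stensor_rels M) (frag_of (f i + sum f I, x)) (frag_of (f i, x) + frag_of (sum f I, x))"
      by (rule stensor_add[OF x])
    also have "eqm (stensor_rels M) \<dots> (frag_of (f i, x) + (\<Sum>i\<in>I. frag_of (f i, x)))"
      by (intro eqm_add eqm_refl insert.IH)
    finally show ?case using insert by simp
  qed (simp_all add: zero)
qed

context frag_mod
begin

lemma stensor_cls_add:
  assumes "u \<in> frags_on X" "w \<in> frags_on X"
  shows "eqm (stensor_rels M) (frag_of (s, cls X R (u + w))) (frag_of (s, cls X R u) + frag_of (s, cls X R w))"
proof -
  have "frag_of (s, cls X R u \<otimes>\<^bsub>M\<^esub> cls X R w) - frag_of (s, cls X R u) - frag_of (s, cls X R w) \<in> stensor_rels M"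
    using cls_carrier[OF assms(1)] cls_carrier[OF assms(2)] unfolding stensor_rels_def by blast
  then show ?thesis by (intro eqm_base) (simp add: mult_cls[OF assms] diff_diff_eq)
qed

lemma stensor_cls_zero: "eqm (stensor_rels M) (frag_of (s, cls X R 0)) 0"
  using stensor_cls_add[of 0 0] by (simp add: eqm_double)

lemma stensor_cls_sum:
  assumes "\<And>i. i \<in> I \<Longrightarrow> f i \<in> frags_on X"
  shows "eqm (stensor_rels M) (frag_of (s, cls X R (sum f I))) (\<Sum>i\<in>I. frag_of (s, cls X R (f i)))"
  using assms
proof (induction I rule: infinite_finite_induct)
  case (insert i I)
  have "eqm (stensor_rels M) (frag_of (s, cls X R (f i + sum f I))) (frag_of (s, cls X R (f i)) + frag_of (s, cls X R (sum f I)))"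
    using insert by (intro stensor_cls_add frags_on_sum) auto
  also have "eqm (stensor_rels M) \<dots> (frag_of (s, cls X R (f i)) + (\<Sum>i\<in>I. frag_of (s, cls X R (f i))))"
    using insert by (intro eqm_add eqm_refl insert.IH) auto
  finally show ?case using insert by simp
qed (simp_all add: stensor_cls_zero)

lemma stensor_cls_act:
  assumes "u \<in> frags_on X"
  shows "eqm (stensor_rels M) (frag_of (s, cls X R (A a b u))) (frag_of (b * s * a, cls X R u))"
  using eqm_sym[OF env_mod.stensor_act[OF env_mod cls_carrier[OF assms], of b s a]]
  by (simp add: act_cls[OF assms])

end

context sym_basis
begin

abbreviation "X1 p \<equiv> (tens_ext_gens 1 p :: ('s list \<times> 'v list) set)"
abbreviation "R1 p \<equiv> tens_ext_rels sV sS 1 p"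
abbreviation "SGB p \<equiv> stensor_gens (bar sS p)"
abbreviation "SRB p \<equiv> stensor_rels (bar sS p)"
abbreviation "SGK p \<equiv> stensor_gens (kos sV sS p)"
abbreviation "SRK p \<equiv> stensor_rels (kos sV sS p)"

text \<open>In S \<otimes>_{S^e} M the two actions of S are absorbed by the factor S, so that an element of S^e acts there
  through its restriction to the diagonal.\<close>

lemma stensor_cls_ract:
  assumes u: "u \<in> frags_on (XK p)"
  shows "eqm (SRK p) (frag_of (s, kos_cls p (ract r u))) (frag_of (diag r * s, kos_cls p u))"
proof -
  interpret K: frag_mod "kos sV sS p" "XK p" "RK p" "\<lambda>a b u. kL a (kR b u)" by (rule kos_mod)
  let ?l = "\<lambda>m. Poly_Mapping.lookup r m" and ?y = "\<lambda>m. mon (Poly_Mapping.lookup m)"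
  have "eqm (SRK p) (frag_of (s, kos_cls p (ract r u)))
      (\<Sum>m\<in>Poly_Mapping.keys r. frag_of (s, kos_cls p (kL (?l m) (kR (?y m) u))))"
    unfolding ract_def by (intro K.stensor_cls_sum kLR_on u)
  also have "eqm (SRK p) \<dots> (\<Sum>m\<in>Poly_Mapping.keys r. frag_of (?y m * s * ?l m, kos_cls p u))"
    by (intro eqm_sum K.stensor_cls_act u)
  also have "eqm (SRK p) \<dots> (frag_of (\<Sum>m\<in>Poly_Mapping.keys r. ?y m * s * ?l m, kos_cls p u))"
    by (rule eqm_sym[OF env_mod.stensor_sum_left[OF env_mod_kos K.cls_carrier[OF u]]])
  also have "(\<Sum>m\<in>Poly_Mapping.keys r. ?y m * s * ?l m) = diag r * s"
    unfolding diag_def sum_distrib_right by (rule sum.cong) (simp_all add: ac_simps)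
  finally show ?thesis .
qed

lemma bar_canon_pure:
  assumes fs: "length fs = p"
  shows "bar_canon sS p (pure sS (f0 # fs)) = cls (SGB p) (SRB p) (frag_of (f0, pure sS (1 # fs @ [1])))"
proof -
  interpret B: frag_mod "bar sS p" "XB p" "RB p" "\<lambda>a b u. aL a (aR b u)" by (rule bar_mod)
  let ?c = "\<lambda>xs. bar_cls p (frag_of xs)"
  let ?g = "\<lambda>xs. frag_of (hd xs, ?c ([1] @ tl xs @ [1]))"
  have len: "length (x # xs @ [y]) = p + 2" if "length xs = p" for x y :: 's and xs
    using that by simp
  have cc: "?c xs \<in> carrier (bar sS p)" if "length xs = p + 2" for xs
    using that by (intro B.cls_carrier) simp
  have "resp (tpow_rels sS (p + 1)) (SRB p) ?g"
  proof (rule resp_tpow[where scl = "\<lambda>c. frag_extend (sscale sS c)"])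
    fix A C :: "'s list" and x y assume l: "length (A @ x # C) = p + 1"
    show "eqm (SRB p) (?g (A @ (x + y) # C)) (?g (A @ x # C) + ?g (A @ y # C))"
    proof (cases A)
      case Nil
      then show ?thesis using l env_mod.stensor_add[OF env_mod_bar cc[of "1 # C @ [1]"], of x y] by simp
    next
      case (Cons a A')
      let ?f = "\<lambda>x. frag_of ((1 # A') @ x # C @ [1])"
      have on: "?f x \<in> frags_on (XB p)" for x using l Cons by simp
      have "?c ((1 # A') @ (x + y) # C @ [1]) = bar_cls p (?f x + ?f y)"
        by (rule eqB_cls[OF B_add on frags_on_add[OF on on]])
      then show ?thesis using Cons B.stensor_cls_add[OF on[of x] on[of y], of a] by simp
    qed
  next
    fix A C :: "'s list" and x c assume l: "length (A @ x # C) = p + 1"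
    show "eqm (SRB p) (?g (A @ sS c x # C)) (frag_extend (sscale sS c) (?g (A @ x # C)))"
    proof (cases A)
      case (Cons a A')
      let ?f = "\<lambda>x. frag_of ((1 # A') @ x # C @ [1])"
      have on: "?f x \<in> frags_on (XB p)" for x using l Cons by simp
      have ar: "aR 1 (?f x) = ?f x"
        using gen_simps(5)[of 1 "(1 # A') @ x # C" 1] by simp
      have "?f (sS c x) \<approx>B aL (sc c) (aR 1 (?f x))" unfolding ar by (rule B_scale)
      then have "?c ((1 # A') @ sS c x # C @ [1]) = bar_cls p (aL (sc c) (aR 1 (?f x)))"
        by (rule eqB_cls[OF _ on aLR_on[OF on]])
      then have "eqm (SRB p) (frag_of (a, ?c ((1 # A') @ sS c x # C @ [1]))) (frag_of (1 * a * sc c, ?c ((1 # A') @ x # C @ [1])))"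
        using B.stensor_cls_act[OF on[of x], of a "sc c" 1] by simp
      moreover have "1 * a * sc c = sS c a" by (simp add: scale_sc[of c a] mult.commute)
      ultimately show ?thesis using Cons by (simp add: sscale_def)
    qed (simp add: sscale_def)
  qed
  from lift_on[OF tpow_rels_on env_mod.stensor_rels_on[OF env_mod_bar] this]
  show ?thesis
    unfolding bar_canon_def using fs
    by (simp add: pure_eq[of "f0 # fs" "p + 1"] pure_eq[of "1 # fs @ [1]" "p + 2"] pure_eq[of "1 # tl _ @ [1]" "p + 2"])
qed

text \<open>The closed form of \<open>\<Psi>\<close> restricted to the diagonal.\<close>

lemma id_tensor_Psi_pure:
  assumes fs: "length fs = p"
  shows "id_tensor_Psi sV sS \<iota> v n p (cls (SGB p) (SRB p) (frag_of (f0, pure sS (1 # fs @ [1])))) =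
    cls (SGK p) (SRK p) (\<Sum>is\<in>incr_seqs n p.
      frag_of (f0 * (\<Prod>j<p. pdiff sS \<iota> v n (is ! j) (fs ! j)), kos_cls p (frag_of ([1, 1], map v is))))"
proof -
  interpret K: frag_mod "kos sV sS p" "XK p" "RK p" "\<lambda>a b u. kL a (kR b u)" by (rule kos_mod)
  let ?r = "\<lambda>is. \<Prod>j<p. dq (is ! j) (fs ! j)" and ?w = "\<lambda>is. frag_of ([1, 1], map v is)"
  have on: "?w is \<in> frags_on (XK p)" if "is \<in> incr_seqs n p" for "is"
    using that by (simp add: incr_seqs_def)
  have "psi (frag_of (1 # fs @ [1])) \<approx>K (\<Sum>is\<in>incr_seqs n p. ract (?r is) (?w is))"
    using psig_expand[of 1 fs 1] fs by simp
  then have P: "PsiD p (pure sS (1 # fs @ [1])) = kos_cls p (\<Sum>is\<in>incr_seqs n p. ract (?r is) (?w is))"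
    using fs by (subst pure_eq[of _ "p + 2"], simp, subst Psi_cls, simp)
      (intro eqK_cls psi_on frags_on_sum ract_on on, simp_all)
  have "eqm (SRK p) (frag_of (f0, kos_cls p (\<Sum>is\<in>incr_seqs n p. ract (?r is) (?w is))))
      (\<Sum>is\<in>incr_seqs n p. frag_of (f0, kos_cls p (ract (?r is) (?w is))))"
    by (intro K.stensor_cls_sum ract_on on)
  also have "eqm (SRK p) \<dots> (\<Sum>is\<in>incr_seqs n p. frag_of (diag (?r is) * f0, kos_cls p (?w is)))"
    by (intro eqm_sum stensor_cls_ract on)
  also have "\<dots> = (\<Sum>is\<in>incr_seqs n p.
      frag_of (f0 * (\<Prod>j<p. pdiff sS \<iota> v n (is ! j) (fs ! j)), kos_cls p (?w is)))"
  proof (rule sum.cong[OF refl])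
    fix "is" assume i: "is \<in> incr_seqs n p"
    have "is ! j \<in> {1..n}" if "j < p" for j
      using i that nth_mem[of j "is"] by (simp add: incr_seqs_def subset_iff)
    then have "diag (?r is) = (\<Prod>j<p. pdiff sS \<iota> v n (is ! j) (fs ! j))"
      unfolding diag_prod by (intro prod.cong refl) (simp add: pdiff_eq)
    then show "frag_of (diag (?r is) * f0, kos_cls p (?w is)) =
        frag_of (f0 * (\<Prod>j<p. pdiff sS \<iota> v n (is ! j) (fs ! j)), kos_cls p (?w is))"
      by (simp add: mult.commute)
  qed
  finally show ?thesis
    unfolding id_tensor_Psi_def stensor_map_cls[OF env_mod_bar env_mod_kos Psi_linear]
      cls_eq_iff[OF env_mod.stensor_rels_on[OF env_mod_kos]]
    by (simp add: smap_def P)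
qed

abbreviation kos_canon_gen :: "nat \<Rightarrow> 's list \<times> 'v list \<Rightarrow> 's \<times> ('s list \<times> 'v list \<Rightarrow>\<^sub>0 int) set \<Rightarrow>\<^sub>0 int" where
  "kos_canon_gen p \<equiv> \<lambda>(fs, ws). frag_of (hd fs, kos_cls p (frag_of ([1, 1], ws)))"

lemma resp_tens1:
  assumes add: "\<And>a b ws. length ws = p \<Longrightarrow> eqm N (g ([a + b], ws)) (g ([a], ws) + g ([b], ws))"
    and addW: "\<And>a A w w' C. length (A @ w # C) = p \<Longrightarrow>
      eqm N (g ([a], A @ (w + w') # C)) (g ([a], A @ w # C) + g ([a], A @ w' # C))"
    and scl: "\<And>a A w C c. length (A @ w # C) = p \<Longrightarrow> eqm N (g ([a], A @ sV c w # C)) (g ([sS c a], A @ w # C))"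
    and alt: "\<And>a A w B C. length (A @ w # B @ w # C) = p \<Longrightarrow> eqm N (g ([a], A @ w # B @ w # C)) 0"
  shows "resp (R1 p) N g"
  unfolding resp_def
proof
  have one: "\<exists>a. xs = [a]" if "length xs = 1" for xs :: "'s list"
    using that by (auto simp: length_Suc_conv One_nat_def)
  fix r assume "r \<in> R1 p"
  then show "eqm N (frag_extend g r) 0"
  proof (cases rule: tens_ext_rels_cases)
    case (1 xs ws i x y)
    obtain a where "xs = [a]" using one 1 by blast
    then show ?thesis
      using 1 add[of ws x y] by (simp add: frag_extend_diff frag_extend_add diff_diff_eq eqm_diff_zero)
  next
    case (2 xs ws i x y)
    obtain a where "xs = [a]" using one 2 by blast
    then show ?thesis using addW[of "take i ws" x "drop (Suc i) ws" a y] 2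
      by (simp add: upd_conv_take_nth_drop frag_extend_diff frag_extend_add diff_diff_eq eqm_diff_zero)
  next
    case (3 xs ws i j c)
    then show ?thesis by simp
  next
    case (4 xs ws i j c)
    obtain a where "xs = [a]" using one 4 by blast
    then show ?thesis using scl[of "take j ws" "ws ! j" "drop (Suc j) ws" a c] 4
      by (simp add: upd_conv_take_nth_drop id_take_nth_drop[symmetric] frag_extend_diff eqm_diff_zero eqm_sym)
  next
    case (5 xs A w B C)
    obtain a where "xs = [a]" using one 5 by blast
    then show ?thesis using 5 by (simp add: alt)
  qed
qed

lemma resp_kos_canon_gen: "resp (R1 p) (SRK p) (kos_canon_gen p)"
proof -
  interpret K: frag_mod "kos sV sS p" "XK p" "RK p" "\<lambda>a b u. kL a (kR b u)" by (rule kos_mod)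
  let ?f = "\<lambda>ws. frag_of ([1, 1], ws)"
  have on: "?f ws \<in> frags_on (XK p)" if "length ws = p" for ws using that by simp
  show ?thesis
  proof (rule resp_tens1)
    fix a b :: 's and ws :: "'v list" assume "length ws = p"
    then show "eqm (SRK p) (kos_canon_gen p ([a + b], ws)) (kos_canon_gen p ([a], ws) + kos_canon_gen p ([b], ws))"
      using env_mod.stensor_add[OF env_mod_kos K.cls_carrier[OF on]] by simp
  next
    fix a and A :: "'v list" and w w' C assume l: "length (A @ w # C) = p"
    have "kos_cls p (?f (A @ (w + w') # C)) = kos_cls p (?f (A @ w # C) + ?f (A @ w' # C))"
      using l by (intro eqK_cls[OF K_addW] frags_on_add on) simp_all
    then show "eqm (SRK p) (kos_canon_gen p ([a], A @ (w + w') # C)) (kos_canon_gen p ([a], A @ w # C) + kos_canon_gen p ([a], A @ w' # C))"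
      using l K.stensor_cls_add[of "?f (A @ w # C)" "?f (A @ w' # C)" a] on by simp
  next
    fix a and A :: "'v list" and w C c assume l: "length (A @ w # C) = p"
    have "?f (A @ sV c w # C) \<approx>K kL (sc c) (kR 1 (?f (A @ w # C)))"
      using K_scaleW[of 1 1 A c w C] by simp
    then have "kos_cls p (?f (A @ sV c w # C)) = kos_cls p (kL (sc c) (kR 1 (?f (A @ w # C))))"
      using l by (intro eqK_cls kLR_on on) simp_all
    moreover have "1 * a * sc c = sS c a" by (simp add: scale_sc[of c a] mult.commute)
    ultimately show "eqm (SRK p) (kos_canon_gen p ([a], A @ sV c w # C)) (kos_canon_gen p ([sS c a], A @ w # C))"
      using K.stensor_cls_act[OF on[OF l], of a "sc c" 1] by simp
  next
    fix a and A :: "'v list" and w B C assume l: "length (A @ w # B @ w # C) = p"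
    have "kos_cls p (?f (A @ w # B @ w # C)) = kos_cls p 0"
      using l by (intro eqK_cls[OF K_alt] on) simp_all
    then show "eqm (SRK p) (kos_canon_gen p ([a], A @ w # B @ w # C)) 0"
      using K.stensor_cls_zero[of a] by simp
  qed
qed

lemma kos_canon_cls: "kos_canon sV sS p (cls (X1 p) (R1 p) f) = cls (SGK p) (SRK p) (frag_extend (kos_canon_gen p) f)"
  unfolding kos_canon_def
  by (rule lift_cls[OF tens_ext_rels_on env_mod.stensor_rels_on[OF env_mod_kos] resp_kos_canon_gen])

definition tens1_rels :: "('s list \<times> 'v list \<Rightarrow>\<^sub>0 int) set" where
  "tens1_rels = (\<Union>p. R1 p)"

lemma proj1:
  assumes "eqm tens1_rels u w" "u \<in> frags_on (X1 p)" "w \<in> frags_on (X1 p)"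
  shows "eqm (R1 p) u w"
proof (rule eqm_project[OF assms(1)])
  fix r assume "r \<in> tens1_rels"
  then obtain p' where r: "r \<in> R1 p'" by (auto simp: tens1_rels_def)
  then have "Poly_Mapping.keys r \<subseteq> X1 p'" using tens_ext_rels_on by (auto simp: frags_on_def)
  then show "r \<in> R1 p \<and> Poly_Mapping.keys r \<subseteq> X1 p \<or> Poly_Mapping.keys r \<inter> X1 p = {}"
    using r by (cases "p' = p") (auto simp: tens_ext_gens_def)
qed (use assms in \<open>simp_all add: frags_on_def\<close>)

text \<open>The inverse f \<otimes> (a \<otimes> b \<otimes> w) \<mapsto> f a b \<otimes> w of the canonical map, with f fixed.\<close>

definition uncanon_gen :: "'s \<Rightarrow> 's list \<times> 'v list \<Rightarrow> 's list \<times> 'v list \<Rightarrow>\<^sub>0 int" where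
  "uncanon_gen s = (\<lambda>(xs, ws). if length xs = 2 then frag_of ([xs ! 0 * xs ! 1 * s], ws) else 0)"

lemma uncanon_gen_simps [simp]: "uncanon_gen s ([a, b], ws) = frag_of ([a * b * s], ws)"
  "length xs \<noteq> 2 \<Longrightarrow> uncanon_gen s (xs, ws) = 0"
  by (simp_all add: uncanon_gen_def One_nat_def)

lemma tens1_eqmI: "u - w \<in> R1 p \<Longrightarrow> eqm tens1_rels u w"
  by (rule eqm_base) (auto simp: tens1_rels_def)

lemma tens1_add: "eqm tens1_rels (frag_of ([a + b], ws)) (frag_of ([a], ws) + frag_of ([b], ws))"
  using tens_ext_rels_addX[of 0 "[a]" a b ws] by (intro tens1_eqmI) (simp add: diff_diff_eq One_nat_def)

lemma resp_uncanon_gen: "resp kos_rels tens1_rels (uncanon_gen s)"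
proof (rule resp_kos)
  fix a a' b b' ws c
  show "eqm tens1_rels (uncanon_gen s ([a + a', b], ws)) (uncanon_gen s ([a, b], ws) + uncanon_gen s ([a', b], ws))"
    using tens1_add[of "a * b * s" "a' * b * s" ws] by (simp add: distrib_right)
  show "eqm tens1_rels (uncanon_gen s ([a, b + b'], ws)) (uncanon_gen s ([a, b], ws) + uncanon_gen s ([a, b'], ws))"
    using tens1_add[of "a * b * s" "a * b' * s" ws] by (simp add: distrib_right distrib_left)
  show "eqm tens1_rels (uncanon_gen s ([a, sS c b], ws)) (uncanon_gen s ([sS c a, b], ws))"
    by (simp add: sS_mult)
next
  fix a b and A :: "'v list" and w w' C c
  show "eqm tens1_rels (uncanon_gen s ([a, b], A @ (w + w') # C)) (uncanon_gen s ([a, b], A @ w # C) + uncanon_gen s ([a, b], A @ w' # C))"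
    using tens_ext_rels_addW[of "[a * b * s]" A w w' C] by (simp, intro tens1_eqmI) (simp add: diff_diff_eq One_nat_def)
  show "eqm tens1_rels (uncanon_gen s ([a, b], A @ sV c w # C)) (uncanon_gen s ([sS c a, b], A @ w # C))"
    using tens_ext_rels_scaleW[of 0 "[a * b * s]" c A w C]
    by (simp add: sS_mult, intro eqm_sym[OF tens1_eqmI]) (simp add: One_nat_def)
next
  fix a b and A :: "'v list" and w B C
  show "eqm tens1_rels (uncanon_gen s ([a, b], A @ w # B @ w # C)) 0"
    using tens_ext_rels_alt[of "[a * b * s]" A w B C] by (simp, intro tens1_eqmI) (simp add: One_nat_def)
qed simp

text \<open>A generator of S \<otimes>_{S^e} M carries a class of M, so a representative has to be chosen; by
  \<open>uncanon_cls\<close> any other one gives the same result modulo the relations.\<close>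

definition uncanon :: "nat \<Rightarrow> 's \<times> ('s list \<times> 'v list \<Rightarrow>\<^sub>0 int) set \<Rightarrow> 's list \<times> 'v list \<Rightarrow>\<^sub>0 int" where
  "uncanon p = (\<lambda>(s, C). frag_extend (uncanon_gen s) (SOME u. u \<in> frags_on (XK p) \<and> C = kos_cls p u))"

lemma uncanon_cls:
  assumes "u \<in> frags_on (XK p)"
  shows "eqm tens1_rels (uncanon p (s, kos_cls p u)) (frag_extend (uncanon_gen s) u)"
proof -
  define u' where "u' = (SOME u'. u' \<in> frags_on (XK p) \<and> kos_cls p u = kos_cls p u')"
  have "u' \<in> frags_on (XK p) \<and> kos_cls p u = kos_cls p u'"
    unfolding u'_def by (rule someI[of _ u]) (simp add: assms)
  then have "eqm (RK p) u' u" by (simp add: cls_eq_iff[OF tens_ext_rels_on] eqm_sym)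
  then have "u' \<approx>K u" by (rule eqm_mono) (use tens_ext_rels_kos_rels gensub.base in blast)
  from resp_eqm[OF resp_uncanon_gen this] show ?thesis by (simp add: uncanon_def u'_def)
qed

lemma resp_uncanon: "resp (SRK p) tens1_rels (uncanon p)"
  unfolding resp_def
proof
  interpret K: frag_mod "kos sV sS p" "XK p" "RK p" "\<lambda>a b u. kL a (kR b u)" by (rule kos_mod)
  let ?c = "kos_cls p"
  fix r assume "r \<in> SRK p"
  then consider
    (1) s t x where "r = frag_of (s + t, x) - frag_of (s, x) - frag_of (t, x)" "x \<in> carrier (kos sV sS p)"
  | (2) s x y where "r = frag_of (s, x \<otimes>\<^bsub>kos sV sS p\<^esub> y) - frag_of (s, x) - frag_of (s, y)"
      "x \<in> carrier (kos sV sS p)" "y \<in> carrier (kos sV sS p)"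
  | (3) s a b x where "r = frag_of (b * s * a, x) - frag_of (s, act (kos sV sS p) a b x)" "x \<in> carrier (kos sV sS p)"
    unfolding stensor_rels_def by blast
  then show "eqm tens1_rels (frag_extend (uncanon p) r) 0"
  proof cases
    case 1
    obtain u where u: "u \<in> frags_on (XK p)" "x = ?c u" using 1(2) by (rule kosE)
    have "eqm tens1_rels (uncanon_gen (s + t) z) (uncanon_gen s z + uncanon_gen t z)" for z
      by (cases z rule: kos_gen_cases) (simp_all add: distrib_left tens1_add)
    then have "eqm tens1_rels (frag_extend (uncanon_gen (s + t)) u) (frag_extend (uncanon_gen s) u + frag_extend (uncanon_gen t) u)"
      unfolding frag_extend_add_fun[symmetric] by (rule frag_extend_eqm)
    with uncanon_cls[OF u(1)] have "eqm tens1_rels (uncanon p (s + t, ?c u)) (frag_extend (uncanon_gen s) u + frag_extend (uncanon_gen t) u)"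
      by (rule eqm_trans)
    also have "eqm tens1_rels \<dots> (uncanon p (s, ?c u) + uncanon p (t, ?c u))"
      by (intro eqm_add eqm_sym[OF uncanon_cls] u)
    finally show ?thesis by (simp add: 1(1) u(2) frag_extend_diff frag_extend_add diff_diff_eq eqm_diff_zero)
  next
    case 2
    obtain u where u: "u \<in> frags_on (XK p)" "x = ?c u" using 2(2) by (rule kosE)
    obtain w where w: "w \<in> frags_on (XK p)" "y = ?c w" using 2(3) by (rule kosE)
    have "eqm tens1_rels (uncanon p (s, ?c (u + w))) (frag_extend (uncanon_gen s) u + frag_extend (uncanon_gen s) w)"
      using uncanon_cls[OF frags_on_add[OF u(1) w(1)], of s] by (simp add: frag_extend_add)
    also have "eqm tens1_rels \<dots> (uncanon p (s, ?c u) + uncanon p (s, ?c w))"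
      by (intro eqm_add eqm_sym[OF uncanon_cls] u w)
    finally show ?thesis
      by (simp add: 2(1) u(2) w(2) K.mult_cls[OF u(1) w(1)] frag_extend_diff frag_extend_add diff_diff_eq eqm_diff_zero)
  next
    case 3
    obtain u where u: "u \<in> frags_on (XK p)" "x = ?c u" using 3(2) by (rule kosE)
    have "uncanon_gen (b * s * a) z = frag_extend (uncanon_gen s) (kL a (kRg b z))" for z
      by (cases z rule: kos_gen_cases) (simp_all add: ac_simps)
    then have "frag_extend (uncanon_gen (b * s * a)) u = frag_extend (\<lambda>z. frag_extend (uncanon_gen s) (kL a (kRg b z))) u"
      by (intro frag_extend_eq) blast
    then have e: "frag_extend (uncanon_gen (b * s * a)) u = frag_extend (uncanon_gen s) (kL a (kR b u))"
      by (simp only: frag_extend_extend)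
    have "eqm tens1_rels (uncanon p (b * s * a, ?c u)) (frag_extend (uncanon_gen (b * s * a)) u)" by (rule uncanon_cls[OF u(1)])
    also have "eqm tens1_rels \<dots> (uncanon p (s, ?c (kL a (kR b u))))"
      unfolding e by (rule eqm_sym[OF uncanon_cls[OF kLR_on[OF u(1)]]])
    finally have "eqm tens1_rels (uncanon p (b * s * a, ?c u)) (uncanon p (s, ?c (kL a (kR b u))))" .
    then show ?thesis
      by (simp add: 3(1) u(2) K.act_cls[OF u(1)] frag_extend_diff eqm_diff_zero)
  qed
qed

lemma uncanon_kos_canon_gen:
  assumes "f \<in> frags_on (X1 p)"
  shows "eqm tens1_rels (frag_extend (uncanon p) (frag_extend (kos_canon_gen p) f)) f"
proof -
  have "eqm tens1_rels (frag_extend (\<lambda>z. frag_extend (uncanon p) (kos_canon_gen p z)) f) (frag_extend frag_of f)"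
  proof (rule frag_extend_eqm_on[OF assms])
    fix z assume "z \<in> X1 p"
    then obtain a ws where z: "z = ([a], ws)" "length ws = p"
      by (cases z) (auto simp: length_Suc_conv One_nat_def)
    then show "eqm tens1_rels (frag_extend (uncanon p) (kos_canon_gen p z)) (frag_of z)"
      using uncanon_cls[of "frag_of ([1, 1], ws)" p a] by simp
  qed
  then show ?thesis by (simp add: frag_extend_extend)
qed

lemma inj_kos_canon: "inj_on (kos_canon sV sS p) (carrier (tens_ext sV sS 1 p))"
proof (rule inj_onI)
  fix x y assume "x \<in> carrier (tens_ext sV sS 1 p)" "y \<in> carrier (tens_ext sV sS 1 p)"
    and eq: "kos_canon sV sS p x = kos_canon sV sS p y"
  then obtain f g where f: "f \<in> frags_on (X1 p)" "x = cls (X1 p) (R1 p) f"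
    and g: "g \<in> frags_on (X1 p)" "y = cls (X1 p) (R1 p) g"
    by (auto simp: tens_ext_def carrier_presented)
  have "eqm (SRK p) (frag_extend (kos_canon_gen p) f) (frag_extend (kos_canon_gen p) g)"
    using eq unfolding f g kos_canon_cls cls_eq_iff[OF env_mod.stensor_rels_on[OF env_mod_kos]] .
  from resp_eqm[OF resp_uncanon this] have "eqm tens1_rels f g"
    using uncanon_kos_canon_gen[OF f(1)] uncanon_kos_canon_gen[OF g(1)] eqm_trans eqm_sym by meson
  then show "x = y"
    unfolding f g cls_eq_iff[OF tens_ext_rels_on] by (rule proj1[OF _ f(1) g(1)])
qed

lemma Psi_star_pure:
  assumes fs: "length fs = p"
  shows "Psi_star sV sS \<iota> v n p (pure sS (f0 # fs)) =
    cls (X1 p) (R1 p) (\<Sum>is\<in>incr_seqs n p. frag_of ([f0 * (\<Prod>j<p. pdiff sS \<iota> v n (is ! j) (fs ! j))], map v is))"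
    (is "_ = cls _ _ ?u")
proof -
  have u: "?u \<in> frags_on (X1 p)" by (rule frags_on_sum) (simp add: incr_seqs_def)
  have "id_tensor_Psi sV sS \<iota> v n p (bar_canon sS p (pure sS (f0 # fs))) = kos_canon sV sS p (cls (X1 p) (R1 p) ?u)"
    unfolding bar_canon_pure[OF fs] id_tensor_Psi_pure[OF fs] kos_canon_cls by (simp add: frag_extend_sum')
  moreover have "cls (X1 p) (R1 p) ?u \<in> carrier (tens_ext sV sS 1 p)"
    using u by (simp add: tens_ext_def carrier_presented)
  ultimately show ?thesis
    unfolding Psi_star_def by (simp add: inv_into_f_f[OF inj_kos_canon])
qed

end

theorem theorem6p1:
  fixes sV :: "'k::field \<Rightarrow> 'v::ab_group_add \<Rightarrow> 'v"
    and sS :: "'k \<Rightarrow> 's::comm_ring_1 \<Rightarrow> 's"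
    and \<iota> :: "'v \<Rightarrow> 's"
    and v :: "nat \<Rightarrow> 'v" and n :: nat
  assumes "symmetric_algebra sV sS \<iota>"
    and "indexed_basis sV v n"
  shows "(\<forall>p. HH_Psi sV sS \<iota> v n p \<in> iso (HH_bar sS p) (HH_kos sV sS \<iota> p) \<and>
              (\<forall>c. \<forall>X\<in>carrier (HH_bar sS p).
                 HH_Psi sV sS \<iota> v n p (HH_bar_scale sS p c X) =
                 HH_kos_scale sV sS \<iota> p c (HH_Psi sV sS \<iota> v n p X))) \<and>
         (\<forall>p f0 fs. length fs = p \<longrightarrow>
            Psi_star sV sS \<iota> v n p (pure sS ([f0] @ fs)) =
            cls (tens_ext_gens 1 p) (tens_ext_rels sV sS 1 p)
              (\<Sum>is\<in>incr_seqs n p.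
                 frag_of ([f0 * (\<Prod>j<p. pdiff sS \<iota> v n (is ! j) (fs ! j))], map v is)))"
proof -
  interpret sym_basis sV sS \<iota> v n
    by (rule sym_basis.intro[OF assms(1) sym_basis_axioms.intro[OF assms(2)]])
  show ?thesis
    using HH_Psi_iso HH_Psi_scale Psi_star_pure by simp
qed

end
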